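(* Let $m>n\ge1$, let $X\subseteq\mathbb{R}^m$ be bounded and open, let $Y\subseteq\mathbb{R}^n$ be bounded, open and convex with outward unit normal $\mathbf n_Y$, let $c\in C^2(\overline X\times\overline Y)$ be twisted, $V\in C^2(\overline Y)$, and $W\in C^2(\overline Y\times\overline Y)$ symmetric, such that for some constant $C_0>0$, $D^2_{yy}c(x,y)+D^2V(y)+D^2_{yy}W(z,y)\ge C_0\,\mathrm{Id}$ for all $(x,y,z)\in X\times Y\times Y$, and $[D_yc(x,y)+DV(y)+D_yW(y,z)]\cdot\mathbf n_Y(y)\ge0$ for all $x\in X$, $z\in Y$, $y\in\partial Y$. Let $\mu$ be a probability measure on $X$, absolutely continuous with respect to Lebesgue measure with bounded density, whose $L^\infty$ norm is denoted $\|\mu\|_\infty$. Assume that $D^2_{yy}c\ge\eta\,\mathrm{Id}$ with $\eta>0$, that $D^2_{xy}c$ has maximal rank, and that there are constants $\lambda>0$, $M\in\mathbb{R}$, $k>0$, $C$ such that for all $\nu,\nu_0,\nu_1\in P(\overline Y)$: (i) $D^2F_{V,W}[\nu]\ge\lambda\,\mathrm{Id}$ in $Y$; (ii) $\mathcal H^{m-n}(B_\nu^{-1}(y))\le M$ for all $y\in Y$; (iii) $JB_\nu\ge k$ in $X$; (iv) $\int_Y|DF_{V,W}[\nu_1]-DF_{V,W}[\nu_0]|\,dy\le C\,\mathcal W_1(\nu_1,\nu_0)$. Assume moreover that $\|\mu\|_\infty MC<k(\eta+\lambda)$. Then the map $\mathcal B:P(\overline Y)\to P(\overline Y)$, $\mathcal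 B(\nu)=(B_\nu)_\#\mu$, is a contraction of $(P(\overline Y),\mathcal W_1)$, and its unique fixed point $\nu^\star$ is a solution of $$\min_{\nu\in P(\overline Y)}\ \mathcal T_c(\mu,\nu)+\int_YV\,d\nu+\frac12\int_Y\int_YW(y,z)\,d\nu(z)\,d\nu(y).$$
   Context: $P(\overline Y)$ is the set of Borel probability measures on $\overline Y$. $\mathcal T_c(\mu,\nu)=\inf_{\gamma\in\Pi(\mu,\nu)}\int c\,d\gamma$, with $\Pi(\mu,\nu)$ the couplings of $\mu$ and $\nu$. $\mathcal W_1$ is the 1-Wasserstein distance. Twisted: for each $x\in X$, $y\mapsto D_xc(x,y)$ is injective on $Y$. $F_{V,W}[\nu](y)=V(y)+\int_YW(y,z)\,d\nu(z)$. For $\nu\in P(\overline Y)$, $B_\nu:X\to\overline Y$ is the map such that $B_\nu(x)$ is the unique point of $\overline Y$ with $D_yc(x,B_\nu(x))+DF_{V,W}[\nu](B_\nu(x))=0$ (well defined under the convexity and boundary conditions on $c+V+W$ in the claim). $JB_\nu=\sqrt{\det(DB_\nu\,DB_\nu^{T})}$ is the $n$-dimensional Jacobian of $B_\nu$, and $\mathcal H^{m-n}$ is $(m-n)$-dimensional Hausdorff measure. *)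

theory Defs
  imports "HOL-Probability.Probability"
begin

text \<open>
  \<open>C\<^sup>2(closure S)\<close> for an open set \<open>S\<close>: all derivatives of order at most two exist in \<open>S\<close> and
  extend continuously to \<open>closure S\<close>.
\<close>

definition C2_closure :: "('a::euclidean_space \<Rightarrow> real) \<Rightarrow> 'a set \<Rightarrow> bool" where
  "C2_closure f S \<longleftrightarrow>
     (\<exists>(f' :: 'a \<Rightarrow> 'a \<Rightarrow>\<^sub>L real) (f'' :: 'a \<Rightarrow> 'a \<Rightarrow>\<^sub>L 'a \<Rightarrow>\<^sub>L real).
        continuous_on (closure S) f \<and> continuous_on (closure S) f' \<and> continuous_on (closure S) f'' \<and>
        (\<forall>x\<in>S. (f has_derivative blinfun_apply (f' x)) (at x)) \<and>
        (\<forall>x\<in>S. (f' has_derivative blinfun_apply (f'' x)) (at x)))"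

text \<open>
  Functions of \<open>y\<close> matter only on the closure of a convex domain \<open>Y\<close>, so their gradients at
  boundary points are taken with respect to the filter \<open>at y within closure Y\<close>. If \<open>Y\<close> is open,
  convex and nonempty and \<open>f\<close> is \<open>C\<^sup>1\<close> up to the boundary, this gradient exists, is unique, and is
  the continuous extension of the gradient from \<open>Y\<close>.
\<close>

definition gradient :: "(real ^ 'n \<Rightarrow> real) \<Rightarrow> (real ^ 'n) filter \<Rightarrow> real ^ 'n" where
  "gradient f F = (\<chi> i. frechet_derivative f F (axis i 1))"

definition hessian :: "(real ^ 'n \<Rightarrow> real) \<Rightarrow> real ^ 'n \<Rightarrow> real ^ 'n ^ 'n" where
  "hessian f y = jacobian (\<lambda>y'. gradient f (at y')) (at y)"

definition mixed_hessian ::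
  "(real ^ 'm \<Rightarrow> real ^ 'n \<Rightarrow> real) \<Rightarrow> real ^ 'm \<Rightarrow> real ^ 'n \<Rightarrow> real ^ 'm ^ 'n" where
  "mixed_hessian c x y = jacobian (\<lambda>x'. gradient (c x') (at y)) (at x)"

text \<open>\<open>A \<ge> a Id\<close> in the sense of quadratic forms.\<close>

definition matrix_ge :: "real ^ 'n ^ 'n \<Rightarrow> real \<Rightarrow> bool" where
  "matrix_ge A a \<longleftrightarrow> (\<forall>v. a * (v \<bullet> v) \<le> v \<bullet> (A *v v))"

text \<open>
  Outward unit normals of a convex set. Where the boundary is smooth there is exactly one; at a
  corner these are the unit vectors of the normal cone.
\<close>

definition outward_unit_normals :: "'a::euclidean_space set \<Rightarrow> 'a \<Rightarrow> 'a set" where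
  "outward_unit_normals S y = {n. norm n = 1 \<and> (\<forall>z\<in>S. n \<bullet> (z - y) \<le> 0)}"

definition twisted ::
  "(real ^ 'm \<Rightarrow> real ^ 'n \<Rightarrow> real) \<Rightarrow> (real ^ 'm) set \<Rightarrow> (real ^ 'n) set \<Rightarrow> bool" where
  "twisted c X Y \<longleftrightarrow> (\<forall>x\<in>X. inj_on (\<lambda>y. gradient (\<lambda>x'. c x' y) (at x)) Y)"

text \<open>The \<open>n\<close>-dimensional Jacobian of a map into \<open>\<real>\<^sup>n\<close>.\<close>

definition jacobian_factor :: "(real ^ 'm \<Rightarrow> real ^ 'n) \<Rightarrow> real ^ 'm \<Rightarrow> real" where
  "jacobian_factor f x = sqrt (det (jacobian f (at x) ** transpose (jacobian f (at x))))"

text \<open>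
  The \<open>s\<close>-dimensional Hausdorff measure, normalised so that for \<open>s = n\<close> it agrees with Lebesgue
  measure on \<open>\<real>\<^sup>n\<close>. Boundedness is required explicitly because \<^const>\<open>diameter\<close> is a real-valued
  supremum without meaning on unbounded sets.
\<close>

definition hausdorff_pre :: "nat \<Rightarrow> real \<Rightarrow> 'a::metric_space set \<Rightarrow> ennreal" where
  "hausdorff_pre s \<delta> A =
     (INF U \<in> {U :: nat \<Rightarrow> 'a set. A \<subseteq> (\<Union>i. U i) \<and> (\<forall>i. bounded (U i) \<and> diameter (U i) \<le> \<delta>)}.
        \<Sum>i. if U i = {} then 0 else ennreal (unit_ball_vol (real s) * (diameter (U i) / 2) ^ s))"

definition hausdorff_measure :: "nat \<Rightarrow> 'a::metric_space set \<Rightarrow> ennreal" where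
  "hausdorff_measure s A = (SUP \<delta> \<in> {0<..}. hausdorff_pre s \<delta> A)"

text \<open>The Borel probability measures on \<open>S\<close>, as measures whose underlying space is \<open>S\<close>.\<close>

abbreviation Prob :: "'a::topological_space set \<Rightarrow> 'a measure set" where
  "Prob S \<equiv> space (prob_algebra (restrict_space borel S))"

text \<open>The \<open>L\<^sup>\<infinity>\<close> norm of the density of \<open>\<mu>\<close> with respect to Lebesgue measure on \<open>X\<close>.\<close>

definition Linf_density :: "'a::euclidean_space set \<Rightarrow> 'a measure \<Rightarrow> ennreal" where
  "Linf_density X \<mu> =
     esssup (restrict_space lborel X) (RN_deriv (restrict_space lborel X) \<mu>)"

definition couplings :: "'a measure \<Rightarrow> 'b measure \<Rightarrow> ('a \<times> 'b) measure set" where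
  "couplings \<mu> \<nu> =
     {\<gamma>. sets \<gamma> = sets (\<mu> \<Otimes>\<^sub>M \<nu>) \<and> distr \<gamma> \<mu> fst = \<mu> \<and> distr \<gamma> \<nu> snd = \<nu>}"

text \<open>
  A real-valued infimum; only used for costs that are continuous on the compact product of
  closures containing the supports, where it is finite.
\<close>

definition transport_cost :: "('a \<Rightarrow> 'b \<Rightarrow> real) \<Rightarrow> 'a measure \<Rightarrow> 'b measure \<Rightarrow> real" where
  "transport_cost c \<mu> \<nu> = (INF \<gamma> \<in> couplings \<mu> \<nu>. \<integral>p. c (fst p) (snd p) \<partial>\<gamma>)"

definition wasserstein1 :: "'a::metric_space measure \<Rightarrow> 'a measure \<Rightarrow> real" where
  "wasserstein1 = transport_cost dist"

definition first_variation ::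
  "('a \<Rightarrow> real) \<Rightarrow> ('a \<Rightarrow> 'a \<Rightarrow> real) \<Rightarrow> 'a measure \<Rightarrow> 'a \<Rightarrow> real" where
  "first_variation V W \<nu> y = V y + (\<integral>z. W y z \<partial>\<nu>)"

definition total_cost ::
  "('a \<Rightarrow> 'b \<Rightarrow> real) \<Rightarrow> ('b \<Rightarrow> real) \<Rightarrow> ('b \<Rightarrow> 'b \<Rightarrow> real) \<Rightarrow> 'a measure \<Rightarrow> 'b measure \<Rightarrow> real" where
  "total_cost c V W \<mu> \<nu> =
     transport_cost c \<mu> \<nu> + (\<integral>y. V y \<partial>\<nu>) + 1 / 2 * (\<integral>y. (\<integral>z. W y z \<partial>\<nu>) \<partial>\<nu>)"

definition best_reply ::
  "(real ^ 'm \<Rightarrow> real ^ 'n \<Rightarrow> real) \<Rightarrow> (real ^ 'n \<Rightarrow> real) \<Rightarrow> (real ^ 'n \<Rightarrow> real ^ 'n \<Rightarrow> real) \<Rightarrow>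
   (real ^ 'n) set \<Rightarrow> (real ^ 'n) measure \<Rightarrow> real ^ 'm \<Rightarrow> real ^ 'n" where
  "best_reply c V W Y \<nu> x =
     (THE y. y \<in> closure Y \<and>
        gradient (c x) (at y within closure Y) +
        gradient (first_variation V W \<nu>) (at y within closure Y) = 0)"

definition best_reply_measure ::
  "(real ^ 'm \<Rightarrow> real ^ 'n \<Rightarrow> real) \<Rightarrow> (real ^ 'n \<Rightarrow> real) \<Rightarrow> (real ^ 'n \<Rightarrow> real ^ 'n \<Rightarrow> real) \<Rightarrow>
   (real ^ 'n) set \<Rightarrow> (real ^ 'm) measure \<Rightarrow> (real ^ 'n) measure \<Rightarrow> (real ^ 'n) measure" where
  "best_reply_measure c V W Y \<mu> \<nu> =
     distr \<mu> (restrict_space borel (closure Y)) (best_reply c V W Y \<nu>)"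

definition contraction_on :: "'a set \<Rightarrow> ('a \<Rightarrow> 'a \<Rightarrow> real) \<Rightarrow> ('a \<Rightarrow> 'a) \<Rightarrow> bool" where
  "contraction_on P d T \<longleftrightarrow>
     T ` P \<subseteq> P \<and> (\<exists>q. 0 \<le> q \<and> q < 1 \<and> (\<forall>x\<in>P. \<forall>y\<in>P. d (T x) (T y) \<le> q * d x y))"

end

theory Submission
  imports Defs
begin

text \<open>
  Two best replies satisfy \<open>(\<eta> + \<kappa>) \<bar>B\<^sub>1 x - B\<^sub>0 x\<bar> \<le> \<bar>DF\<^sub>1 - DF\<^sub>0\<bar> (B\<^sub>0 x)\<close> by strong monotonicity of the
  first order condition. Integrating against \<open>\<mu>\<close>, the coarea inequality
  \<open>k |X \<inter> B\<^sup>-\<^sup>1 E| \<le> M |E|\<close> turns the right-hand side into the integral of \<open>\<bar>DF\<^sub>1 - DF\<^sub>0\<bar>\<close> over \<open>Y\<close>,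
  which (iv) bounds by \<open>C \<W>\<^sub>1\<close>. So \<open>\<nu> \<mapsto> B\<^sub>\<nu>\<close> is a contraction from \<open>\<W>\<^sub>1\<close> into \<open>L\<^sup>1(\<mu>)\<close>.

  The coarea inequality is reduced, on small pieces where \<open>B\<close> is almost linear, to Fubini's theorem,
  and the lower bound of Hausdorff measure by Lebesgue measure of projections is the isodiametric
  inequality, proved by Steiner symmetrisation. That \<open>B\<close> takes values in the open set \<open>Y\<close> follows from
  \<open>JB \<ge> k > 0\<close>: at a point sent to the boundary, a supporting functional of \<open>Y\<close> composed with \<open>B\<close> would
  have a critical point.

  The energy need not be convex, so a fixed point is not a minimiser for free. An almost minimiser is
  compared with its mixtures with its own best reply; this shows that it is almost a fixed point, hence
  close to \<open>\<nu>\<^sup>\<star>\<close> by contraction, and the energy is Lipschitz along the coupling. No compactness of the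
  space of measures is needed.
\<close>


text \<open>The constant called lambda in the statement is \<open>\<kappa>\<close> here. What shapes
  the proof is the frontier of \<open>Y\<close>. A best reply is a priori only a point of
  \<open>closure Y\<close>, while the Hessian bounds and the fibre bound (ii) speak of
  \<open>Y\<close> alone, and \<open>JB \<ge> k\<close> means something only once \<open>B\<close>
  is known to be differentiable. So \<open>B\<close> has to be differentiated while its values may
  still lie on the frontier, where neighbourhoods within \<open>closure Y\<close> are one-sided.
  Strict differentiability survives there, because it can be tested on pairs of points of the closed
  set and transfers by density from \<open>Y\<close>; it is also what lets the coarea inequality
  compare \<open>B\<close> with a linear map on a whole ball. \<open>X\<close> need not be convex,
  so derivative data of \<open>c\<close> are used on products of a ball with \<open>Y\<close>. The
  contraction factor is the product of the density bound, the ratio \<open>M / k\<close> from the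
  coarea inequality, \<open>C\<close> from (iv), and \<open>1 / (\<eta> + \<kappa>)\<close> from
  monotonicity.\<close>

section \<open>Steiner symmetrisation and the isodiametric inequality\<close>

text \<open>Fubini along the direction \<open>b\<close> without splitting the space as a product:
  the base hyperplane is thickened to a slab of width one. A point of \<open>A\<close> is reached
  from base points in the slab for a set of parameters \<open>t\<close> of length exactly one, so
  nothing is counted twice.\<close>

lemma emeasure_lborel_slab:
  fixes A :: "'a::euclidean_space set"
  assumes A[measurable]: "A \<in> sets borel" and b: "b \<in> Basis"
  shows "emeasure lborel A =
    (\<integral>\<^sup>+x. indicator {x. -1 \<le> x \<bullet> b \<and> x \<bullet> b \<le> 0} x * emeasure lborel {t::real. x + t *\<^sub>R b \<in> A} \<partial>lborel)"
proof -
  let ?C = "{x. -1 \<le> x \<bullet> b \<and> x \<bullet> b \<le> 0} :: 'a set"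
  have [measurable]: "?C \<in> sets borel" by measurable
  have slice: "emeasure lborel {t::real. x + t *\<^sub>R b \<in> A} = (\<integral>\<^sup>+t. indicator A (x + t *\<^sub>R b) \<partial>lborel)" for x
  proof -
    have "(\<integral>\<^sup>+t. indicator A (x + t *\<^sub>R b) \<partial>lborel) = (\<integral>\<^sup>+t. indicator {t::real. x + t *\<^sub>R b \<in> A} t \<partial>lborel)"
      by (intro nn_integral_cong) (auto simp: indicator_def)
    then show ?thesis by simp
  qed
  have "(\<integral>\<^sup>+x. indicator ?C x * emeasure lborel {t::real. x + t *\<^sub>R b \<in> A} \<partial>lborel)
      = (\<integral>\<^sup>+x. (\<integral>\<^sup>+t. indicator ?C x * indicator A (x + t *\<^sub>R b) \<partial>(lborel::real measure)) \<partial>lborel)"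
    unfolding slice by (intro nn_integral_cong nn_integral_cmult[symmetric]) measurable
  also have "\<dots> = (\<integral>\<^sup>+t. (\<integral>\<^sup>+x. indicator ?C x * indicator A (x + t *\<^sub>R b) \<partial>lborel) \<partial>(lborel::real measure))"
    by (rule lborel_pair.Fubini'[symmetric]) measurable
  also have "\<dots> = (\<integral>\<^sup>+t. (\<integral>\<^sup>+x. indicator ?C (x - t *\<^sub>R b) * indicator A x \<partial>lborel) \<partial>(lborel::real measure))"
  proof (rule nn_integral_cong)
    fix t :: real
    have "(\<integral>\<^sup>+x. indicator ?C (x - t *\<^sub>R b) * indicator A x \<partial>lborel)
       = (\<integral>\<^sup>+x. indicator ?C (x - t *\<^sub>R b) * indicator A x \<partial>(distr lborel borel ((+) (t *\<^sub>R b))))"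
      by (simp add: lborel_distr_plus)
    also have "\<dots> = (\<integral>\<^sup>+x. indicator ?C x * indicator A (x + t *\<^sub>R b) \<partial>lborel)"
      by (subst nn_integral_distr) (auto simp: add.commute)
    finally show "(\<integral>\<^sup>+x. indicator ?C x * indicator A (x + t *\<^sub>R b) \<partial>lborel)
       = (\<integral>\<^sup>+x. indicator ?C (x - t *\<^sub>R b) * indicator A x \<partial>lborel)" ..
  qed
  also have "\<dots> = (\<integral>\<^sup>+x. (\<integral>\<^sup>+t. indicator ?C (x - t *\<^sub>R b) * indicator A x \<partial>(lborel::real measure)) \<partial>lborel)"
    by (rule lborel_pair.Fubini') measurable
  also have "\<dots> = (\<integral>\<^sup>+x. indicator A x \<partial>lborel)"
  proof (rule nn_integral_cong)
    fix x
    have "indicator ?C (x - t *\<^sub>R b) = (indicator {x \<bullet> b .. x \<bullet> b + 1} t :: ennreal)" for t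
      using b by (auto simp: indicator_def inner_diff_left)
    then show "(\<integral>\<^sup>+t. indicator ?C (x - t *\<^sub>R b) * indicator A x \<partial>(lborel::real measure)) = indicator A x"
      by (simp add: nn_integral_multc)
  qed
  finally show ?thesis by simp
qed

lemma emeasure_lborel_mono_slices:
  fixes A A' :: "'a::euclidean_space set"
  assumes "A \<in> sets borel" "A' \<in> sets borel" "b \<in> Basis"
    and "\<And>x. emeasure lborel {t::real. x + t *\<^sub>R b \<in> A} \<le> emeasure lborel {t. x + t *\<^sub>R b \<in> A'}"
  shows "emeasure lborel A \<le> emeasure lborel A'"
  unfolding emeasure_lborel_slab[OF assms(1,3)] emeasure_lborel_slab[OF assms(2,3)]
  by (intro nn_integral_mono mult_left_mono assms) auto

definition reflect :: "'a::real_inner \<Rightarrow> 'a \<Rightarrow> 'a" where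
  "reflect b x = x - (2 * (x \<bullet> b)) *\<^sub>R b"

lemma reflect_line: 
  assumes "b \<in> Basis" "b' \<in> Basis" "b \<noteq> b'"
  shows "reflect b' (x + t *\<^sub>R b) = reflect b' x + t *\<^sub>R b"
  using assms by (simp add: reflect_def inner_add_left inner_not_same_Basis)

lemma reflect_reflect: "b \<in> Basis \<Longrightarrow> reflect b (reflect b x) = x"
  by (simp add: reflect_def inner_diff_left algebra_simps)

lemma continuous_on_reflect: "continuous_on S (reflect b)"
  unfolding reflect_def by (intro continuous_intros)

lemma compact_slice:
  fixes A :: "'a::euclidean_space set"
  assumes "compact A" "b \<in> Basis"
  shows "compact {t::real. x + t *\<^sub>R b \<in> A}"
proof -
  obtain B where B: "\<And>a. a \<in> A \<Longrightarrow> norm a \<le> B"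
    using compact_imp_bounded[OF assms(1)] by (auto simp: bounded_iff)
  have "\<bar>t\<bar> \<le> B + norm x" if "x + t *\<^sub>R b \<in> A" for t
    using B[OF that] norm_triangle_ineq2[of "x + t *\<^sub>R b" x] assms(2) 
      norm_triangle_ineq4[of "x + t *\<^sub>R b" x] by simp
  then have "bounded {t::real. x + t *\<^sub>R b \<in> A}"
    by (auto simp: bounded_iff)
  moreover have "closed {t::real. x + t *\<^sub>R b \<in> A}"
  proof -
    have "closed ((\<lambda>t::real. x + t *\<^sub>R b) -` A)"
      by (intro closed_vimage compact_imp_closed assms continuous_intros)
    then show ?thesis by (simp add: vimage_def)
  qed
  ultimately show ?thesis by (simp add: compact_eq_bounded_closed)
qed

text \<open>\<open>A'\<close> is the closure of the symmetrised set; this settles compactness and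
  measurability at once, since a bound on distances passes to closures. Reflections in other
  coordinate directions commute with sliding along \<open>b\<close>, so symmetries obtained earlier
  survive.\<close>

lemma steiner_symmetrization:
  fixes A :: "'a::euclidean_space set"
  assumes A: "compact A" and b: "b \<in> Basis"
    and D: "\<And>x y. x \<in> A \<Longrightarrow> y \<in> A \<Longrightarrow> dist x y \<le> D"
  obtains A' :: "'a set" where "compact A'" "emeasure lborel A \<le> emeasure lborel A'"
    "\<And>x y. x \<in> A' \<Longrightarrow> y \<in> A' \<Longrightarrow> dist x y \<le> D"
    "reflect b ` A' \<subseteq> A'"
    "\<And>b'. b' \<in> Basis \<Longrightarrow> reflect b' ` A \<subseteq> A \<Longrightarrow> reflect b' ` A' \<subseteq> A'"
proof
  define sl where "sl x = {t::real. x + t *\<^sub>R b \<in> A}" for x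
  define l where "l x = measure lborel (sl x)" for x
  \<comment> \<open>Each slice becomes an interval of the same length centred at the hyperplane
    orthogonal to \<open>b\<close>. Lines that miss \<open>A\<close> have \<open>l x = 0\<close> and
    would otherwise contribute their midpoint, hence the second conjunct.\<close>
  define S where "S = {x. 2 * \<bar>x \<bullet> b\<bar> \<le> l x \<and> sl x \<noteq> {}}"
  have csl: "compact (sl x)" for x
    unfolding sl_def by (rule compact_slice[OF A b])
  have fsl: "emeasure lborel (sl x) = ennreal (l x)" for x
    unfolding l_def using emeasure_compact_finite[OF csl[of x]]
    by (simp add: emeasure_eq_ennreal_measure)
  have sl_shift: "sl (x + s *\<^sub>R b) = (+) (- s) ` sl x" for x s
  proof -
    have "t \<in> (+) (- s) ` sl x" if "t \<in> sl (x + s *\<^sub>R b)" for t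
      using that by (intro image_eqI[of _ _ "s + t"]) (auto simp: sl_def algebra_simps)
    then show ?thesis by (auto simp: sl_def algebra_simps)
  qed
  have l_shift: "l (x + s *\<^sub>R b) = l x" for x s
  proof -
    have "(+) (- s) ` sl x \<in> sets lborel" "sl x \<in> sets lborel"
      using borel_compact[OF csl[of x]] borel_compact[OF compact_translation[OF csl[of x], of "- s"]] by auto
    then show ?thesis
      using measure_translation[of "-s" "sl x"] unfolding l_def sl_shift by (simp only: measure_completion)
  qed
  have slS: "x + t *\<^sub>R b \<in> S \<longleftrightarrow> 2 * \<bar>x \<bullet> b + t\<bar> \<le> l x \<and> sl x \<noteq> {}" for x t
    using b by (simp add: S_def l_shift inner_add_left sl_shift)
  have distS: "dist x y \<le> D" if "x \<in> S" "y \<in> S" for x y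
  proof -
    define x0 y0 where "x0 = x - (x \<bullet> b) *\<^sub>R b" and "y0 = y - (y \<bullet> b) *\<^sub>R b"
    have lx: "l x0 = l x" "l y0 = l y" 
      using l_shift[of x "- (x \<bullet> b)"] l_shift[of y "- (y \<bullet> b)"] unfolding x0_def y0_def by simp_all
    have ne: "sl x0 \<noteq> {}" "sl y0 \<noteq> {}"
      using that sl_shift[of x "- (x \<bullet> b)"] sl_shift[of y "- (y \<bullet> b)"] unfolding x0_def y0_def S_def
      by simp_all
    have orth: "(x0 - y0) \<bullet> b = 0"
      using b by (simp add: x0_def y0_def inner_diff_left)
    have pyth: "(dist (x0 + s *\<^sub>R b) (y0 + t *\<^sub>R b))\<^sup>2 = (dist x0 y0)\<^sup>2 + (s - t)\<^sup>2" for s t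
    proof -
      have eq: "x0 + s *\<^sub>R b - (y0 + t *\<^sub>R b) = (x0 - y0) + (s - t) *\<^sub>R b" by (simp add: algebra_simps)
      have "orthogonal (x0 - y0) ((s - t) *\<^sub>R b)" using orth by (simp add: orthogonal_def)
      from norm_add_Pythagorean[OF this] b show ?thesis unfolding dist_norm eq by simp
    qed
    obtain p1 where p1: "p1 \<in> sl x0" "\<And>t. t \<in> sl x0 \<Longrightarrow> p1 \<le> t"
      using compact_attains_inf[OF csl ne(1)] by auto
    obtain p2 where p2: "p2 \<in> sl x0" "\<And>t. t \<in> sl x0 \<Longrightarrow> t \<le> p2"
      using compact_attains_sup[OF csl ne(1)] by auto
    obtain q1 where q1: "q1 \<in> sl y0" "\<And>t. t \<in> sl y0 \<Longrightarrow> q1 \<le> t"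
      using compact_attains_inf[OF csl ne(2)] by auto
    obtain q2 where q2: "q2 \<in> sl y0" "\<And>t. t \<in> sl y0 \<Longrightarrow> t \<le> q2"
      using compact_attains_sup[OF csl ne(2)] by auto
    have "l x0 \<le> measure lborel {p1..p2}"
      unfolding l_def
    proof (rule measure_mono_fmeasurable)
      show "sl x0 \<subseteq> {p1..p2}" using p1(2) p2(2) by auto
      show "sl x0 \<in> sets lborel" using csl by (simp add: borel_compact)
      show "{p1..p2} \<in> fmeasurable lborel" by (intro fmeasurable_compact compact_Icc)
    qed
    then have lx0: "l x0 \<le> p2 - p1" using p1 p2 by simp
    have "l y0 \<le> measure lborel {q1..q2}"
      unfolding l_def
    proof (rule measure_mono_fmeasurable)
      show "sl y0 \<subseteq> {q1..q2}" using q1(2) q2(2) by auto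
      show "sl y0 \<in> sets lborel" using csl by (simp add: borel_compact)
      show "{q1..q2} \<in> fmeasurable lborel" by (intro fmeasurable_compact compact_Icc)
    qed
    then have ly0: "l y0 \<le> q2 - q1" using q1 q2 by simp
    have xs: "2 * \<bar>x \<bullet> b\<bar> \<le> l x" "2 * \<bar>y \<bullet> b\<bar> \<le> l y" using that by (auto simp: S_def)
    \<comment> \<open>The sum \<open>(p2 - q1) + (q2 - p1)\<close> is at least
      \<open>l x0 + l y0\<close>, hence at least twice the height difference of two points in the
      centred intervals, so one of the two crossed differences is large enough.\<close>
    have "\<bar>x \<bullet> b - y \<bullet> b\<bar> \<le> \<bar>p2 - q1\<bar> \<or> \<bar>x \<bullet> b - y \<bullet> b\<bar> \<le> \<bar>p1 - q2\<bar>"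
      using xs lx0 ly0 lx by linarith
    then obtain p q where pq: "p \<in> sl x0" "q \<in> sl y0" "\<bar>x \<bullet> b - y \<bullet> b\<bar> \<le> \<bar>p - q\<bar>"
      using p1(1) p2(1) q1(1) q2(1) by blast
    have "(dist x y)\<^sup>2 = (dist x0 y0)\<^sup>2 + (x \<bullet> b - y \<bullet> b)\<^sup>2"
      using pyth[of "x \<bullet> b" "y \<bullet> b"] by (simp add: x0_def y0_def)
    also have "\<dots> \<le> (dist x0 y0)\<^sup>2 + (p - q)\<^sup>2"
      using pq(3) by (simp add: abs_le_square_iff)
    also have "\<dots> = (dist (x0 + p *\<^sub>R b) (y0 + q *\<^sub>R b))\<^sup>2" by (simp add: pyth)
    finally have "dist x y \<le> dist (x0 + p *\<^sub>R b) (y0 + q *\<^sub>R b)"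
      using power2_le_imp_le zero_le_dist by blast
    also have "\<dots> \<le> D" using D pq by (auto simp: sl_def)
    finally show ?thesis .
  qed
  have distC: "dist x y \<le> D" if "x \<in> closure S" "y \<in> closure S" for x y
  proof -
    have "closed {p :: 'a \<times> 'a. dist (fst p) (snd p) \<le> D}"
      by (intro closed_Collect_le continuous_intros)
    then have "closure (S \<times> S) \<subseteq> {p. dist (fst p) (snd p) \<le> D}"
      using distS by (intro closure_minimal) auto
    then show ?thesis using that by (auto simp: closure_Times)
  qed
  have "bounded S"
  proof (cases "S = {}")
    case False
    then obtain x where "x \<in> S" by auto
    then have "S \<subseteq> cball x D" using distS by auto
    then show ?thesis using bounded_cball bounded_subset by blast
  qed auto
  then show cC: "compact (closure S)" by simp
  show "emeasure lborel A \<le> emeasure lborel (closure S)"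
  proof (rule emeasure_lborel_mono_slices[OF _ _ b])
    show "A \<in> sets borel" "closure S \<in> sets borel" using A cC by (auto simp: borel_compact)
    fix x
    show "emeasure lborel {t::real. x + t *\<^sub>R b \<in> A} \<le> emeasure lborel {t. x + t *\<^sub>R b \<in> closure S}"
    proof (cases "sl x = {}")
      case True then show ?thesis by (simp add: sl_def)
    next
      case False
      have "0 \<le> l x" by (simp add: l_def)
      then have "emeasure lborel (sl x) = emeasure lborel {- (x \<bullet> b) - l x / 2 .. - (x \<bullet> b) + l x / 2}"
        unfolding fsl by simp
      also have "\<dots> \<le> emeasure lborel {t. x + t *\<^sub>R b \<in> closure S}"
      proof (rule emeasure_mono)
        have "{- (x \<bullet> b) - l x / 2 .. - (x \<bullet> b) + l x / 2} \<subseteq> {t. x + t *\<^sub>R b \<in> S}"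
        proof
          fix t assume "t \<in> {- (x \<bullet> b) - l x / 2 .. - (x \<bullet> b) + l x / 2}"
          then have "2 * \<bar>x \<bullet> b + t\<bar> \<le> l x" by (simp add: abs_if field_simps)
          then show "t \<in> {t. x + t *\<^sub>R b \<in> S}" using False by (simp add: slS)
        qed
        then show "{- (x \<bullet> b) - l x / 2 .. - (x \<bullet> b) + l x / 2} \<subseteq> {t. x + t *\<^sub>R b \<in> closure S}"
          using closure_subset by blast
        show "{t. x + t *\<^sub>R b \<in> closure S} \<in> sets lborel"
          using compact_slice[OF cC b] by (simp add: borel_compact)
      qed
      finally show ?thesis by (simp add: sl_def)
    qed
  qed
  show "\<And>x y. x \<in> closure S \<Longrightarrow> y \<in> closure S \<Longrightarrow> dist x y \<le> D" by (rule distC)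
  have cl: "reflect b' ` closure S \<subseteq> closure S" if "reflect b' ` S \<subseteq> S" for b'
    using that closure_subset by (intro image_closure_subset continuous_on_reflect) auto
  have "reflect b x \<in> S" if "x \<in> S" for x
  proof -
    have "x + (- (2 * (x \<bullet> b))) *\<^sub>R b \<in> S"
      unfolding slS using that by (simp add: S_def)
    then show ?thesis by (simp add: reflect_def)
  qed
  then show "reflect b ` closure S \<subseteq> closure S" by (intro cl) auto
  fix b' :: 'a assume b': "b' \<in> Basis" and rA: "reflect b' ` A \<subseteq> A"
  show "reflect b' ` closure S \<subseteq> closure S"
  proof (cases "b' = b")
    case True then show ?thesis using \<open>reflect b ` closure S \<subseteq> closure S\<close> by simp
  next
    case False
    have iff: "reflect b' z \<in> A \<longleftrightarrow> z \<in> A" for z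
      using rA reflect_reflect[OF b', of z] by (metis imageI subsetD)
    have "sl (reflect b' x) = sl x" for x
      unfolding sl_def using reflect_line[OF b b' False[symmetric], of x] iff by metis
    moreover have "reflect b' x \<bullet> b = x \<bullet> b" for x
      using False b b' by (simp add: reflect_def inner_diff_left inner_not_same_Basis)
    ultimately have "reflect b' ` S \<subseteq> S" by (auto simp: S_def l_def)
    then show ?thesis by (rule cl)
  qed
qed

text \<open>Once the set is symmetric in every coordinate hyperplane it is symmetric about the
  origin. Then it contains \<open>- x\<close> with \<open>x\<close>, so
  \<open>2 * norm x \<le> D\<close> and the set lies in the ball of radius \<open>D / 2\<close>,
  although the original set need not lie in any such ball.\<close>

theorem isodiametric_inequality:
  fixes A :: "'a::euclidean_space set"
  assumes A: "compact A" and D0: "0 \<le> D" and D: "\<And>x y. x \<in> A \<Longrightarrow> y \<in> A \<Longrightarrow> dist x y \<le> D"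
  shows "emeasure lborel A \<le> ennreal (unit_ball_vol (real DIM('a)) * (D / 2) ^ DIM('a))"
proof -
  have "\<exists>A' :: 'a set. compact A' \<and> emeasure lborel A \<le> emeasure lborel A' \<and>
      (\<forall>x\<in>A'. \<forall>y\<in>A'. dist x y \<le> D) \<and> (\<forall>b\<in>F. reflect b ` A' \<subseteq> A')"
    if "finite F" "F \<subseteq> Basis" for F :: "'a set"
    using that
  proof (induction F)
    case empty
    show ?case
      by (rule exI[of _ A]) (simp add: A D)
  next
    case (insert b F)
    have b: "b \<in> Basis" and F: "F \<subseteq> Basis" using insert.prems by auto
    from insert.IH[OF F] obtain A1 :: "'a set" where A1: "compact A1" "emeasure lborel A \<le> emeasure lborel A1"
      "\<forall>x\<in>A1. \<forall>y\<in>A1. dist x y \<le> D" "\<forall>b\<in>F. reflect b ` A1 \<subseteq> A1"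
      by (elim exE conjE)
    obtain A' :: "'a set" where A': "compact A'" "emeasure lborel A1 \<le> emeasure lborel A'"
      "\<And>x y. x \<in> A' \<Longrightarrow> y \<in> A' \<Longrightarrow> dist x y \<le> D"
      "reflect b ` A' \<subseteq> A'"
      "\<And>b'. b' \<in> Basis \<Longrightarrow> reflect b' ` A1 \<subseteq> A1 \<Longrightarrow> reflect b' ` A' \<subseteq> A'"
      using steiner_symmetrization[OF A1(1) b, of D] A1(3) by (metis (no_types, lifting))
    have "reflect b' ` A' \<subseteq> A'" if "b' \<in> insert b F" for b'
      using that A'(4,5) A1(4) F by blast
    then show ?case
      using order_trans[OF A1(2) A'(2)] A'(1,3) by (intro exI[of _ A'] conjI ballI) assumption+
  qed
  from this[OF finite_Basis order_refl] obtain A' :: "'a set" where A': "compact A'" "emeasure lborel A \<le> emeasure lborel A'"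
      "\<forall>x\<in>A'. \<forall>y\<in>A'. dist x y \<le> D" "\<forall>b\<in>Basis. reflect b ` A' \<subseteq> A'"
    by (elim exE conjE)
  \<comment> \<open>Composing the reflections over \<open>F\<close> subtracts twice the
    \<open>F\<close>-components; over the whole basis the result is \<open>- x\<close>.\<close>
  have neg: "x - 2 *\<^sub>R (\<Sum>b\<in>F. (x \<bullet> b) *\<^sub>R b) \<in> A'" if "finite F" "F \<subseteq> Basis" "x \<in> A'" for F x
    using that
  proof (induction F)
    case (insert b F)
    have "(\<Sum>b'\<in>F. (x \<bullet> b') *\<^sub>R b') \<bullet> b = 0"
    proof -
      have "(x \<bullet> b') *\<^sub>R b' \<bullet> b = 0" if "b' \<in> F" for b'
        using inner_not_same_Basis[of b' b] insert.prems insert.hyps that by auto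
      then show ?thesis unfolding inner_sum_left by (rule sum.neutral[OF ballI])
    qed
    then have "reflect b (x - 2 *\<^sub>R (\<Sum>b\<in>F. (x \<bullet> b) *\<^sub>R b)) = x - 2 *\<^sub>R (\<Sum>b\<in>insert b F. (x \<bullet> b) *\<^sub>R b)"
      using insert by (simp add: reflect_def inner_diff_left algebra_simps)
    moreover have "reflect b (x - 2 *\<^sub>R (\<Sum>b\<in>F. (x \<bullet> b) *\<^sub>R b)) \<in> A'"
      using A'(4) insert by blast
    ultimately show ?case by metis
  qed auto
  have "A' \<subseteq> cball 0 (D / 2)"
  proof
    fix x assume x: "x \<in> A'"
    have "- x \<in> A'" using neg[of Basis x] x by (simp add: euclidean_representation scaleR_2)
    then have "dist x (- x) \<le> D" using A'(3) x by blast
    moreover have "dist x (- x) = 2 * norm x" by (simp add: dist_norm flip: scaleR_2)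
    ultimately show "x \<in> cball 0 (D / 2)" by simp
  qed
  then have "emeasure lborel A' \<le> emeasure lborel (cball (0::'a) (D / 2))"
    by (intro emeasure_mono) auto
  also have "\<dots> = ennreal (unit_ball_vol (real DIM('a)) * (D / 2) ^ DIM('a))"
    using D0 by (simp add: emeasure_cball)
  finally show ?thesis using A'(2) by simp
qed

section \<open>Lebesgue measure under Lipschitz and linear maps\<close>

text \<open>Vitali covering: up to a null set \<open>K\<close> is filled by disjoint balls centred
  in \<open>K\<close> and contained in an open set of nearly the same measure. A ball of radius
  \<open>r\<close> meets \<open>K\<close> in a set mapped into a ball of radius
  \<open>L * r\<close>, whose volume is \<open>L ^ DIM('a)\<close> times as large, and null sets go
  to null sets. Domain and target may be different types of equal dimension.\<close>

lemma emeasure_lipschitz_image_le: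
  fixes f :: "'a::euclidean_space \<Rightarrow> 'b::euclidean_space"
  assumes dim: "DIM('b) = DIM('a)" and K: "compact K" and L: "0 \<le> L"
    and lip: "\<And>x y. x \<in> K \<Longrightarrow> y \<in> K \<Longrightarrow> dist (f x) (f y) \<le> L * dist x y"
  shows "emeasure lborel (f ` K) \<le> ennreal (L ^ DIM('a)) * emeasure lborel K"
proof -
  have cont: "continuous_on K f"
    using lip L by (intro lipschitz_on_continuous_on[of L]) (simp add: lipschitz_on_def)
  have fK: "compact (f ` K)" using K cont by (rule compact_continuous_image[rotated])
  have "emeasure lborel (f ` K) \<le> ennreal (L ^ DIM('a)) * (emeasure lborel K + ennreal e)"
    if e: "e > 0" for e
  proof -
    obtain U where U: "open U" "K \<subseteq> U" "emeasure lborel (U - K) < e"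
      using outer_regular_lborel[of K e] K e by (auto simp: borel_compact)
    have "emeasure lborel U \<le> emeasure lborel K + emeasure lborel (U - K)"
    proof -
      have "K \<in> sets lborel" "U - K \<in> sets lborel"
        using K U(1) by (auto simp: borel_compact intro!: sets.Diff)
      from emeasure_subadditive[OF this] U(2) show ?thesis by (simp add: Un_absorb1)
    qed
    also have "\<dots> \<le> emeasure lborel K + ennreal e"
      using U(3) by (intro add_left_mono) simp
    finally have Ule: "emeasure lborel U \<le> emeasure lborel K + ennreal e" .
    define I where "I = {(a, r). a \<in> K \<and> 0 < r \<and> cball a r \<subseteq> U}"
    obtain C where C: "countable C" "C \<subseteq> I"
      "pairwise (\<lambda>i j. disjnt (cball (fst i) (snd i)) (cball (fst j) (snd j))) C"
      "negligible (K - (\<Union>i\<in>C. cball (fst i) (snd i)))"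
    proof (rule Vitali_covering_theorem_cballs[of I snd K fst])
      fix x d assume x: "x \<in> K" and d: "(d::real) > 0"
      obtain r where r: "r > 0" "cball x r \<subseteq> U"
        using U x by (metis open_contains_cball subsetD)
      have "cball x (min r (d / 2)) \<subseteq> cball x r" by auto
      with r have "cball x (min r (d/2)) \<subseteq> U" by blast
      with r d x show "\<exists>i. i \<in> I \<and> x \<in> cball (fst i) (snd i) \<and> snd i < d"
        by (intro exI[of _ "(x, min r (d / 2))"]) (auto simp: I_def)
    qed (auto simp: I_def)
    let ?B = "\<lambda>i. cball (fst i) (snd i)" and ?B' = "\<lambda>i. cball (f (fst i)) (L * snd i)"
    let ?N = "K - (\<Union>i\<in>C. ?B i)"
    have neg: "negligible (f ` ?N)"
    proof (rule negligible_locally_Lipschitz_image[OF _ C(4)])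
      show "DIM('a) \<le> DIM('b)" using dim by simp
      fix x assume "x \<in> ?N"
      then show "\<exists>T B. open T \<and> x \<in> T \<and> (\<forall>y\<in>?N \<inter> T. norm (f y - f x) \<le> B * norm (y - x))"
        using lip by (intro exI[of _ UNIV] exI[of _ L]) (auto simp: dist_norm)
    qed
    have sub: "f ` K \<subseteq> (\<Union>i\<in>C. ?B' i) \<union> f ` ?N"
    proof
      fix z assume "z \<in> f ` K"
      then obtain x where x: "x \<in> K" "z = f x" by auto
      show "z \<in> (\<Union>i\<in>C. ?B' i) \<union> f ` ?N"
      proof (cases "x \<in> ?N")
        case False
        then obtain i where i: "i \<in> C" "dist (fst i) x \<le> snd i" using x by auto
        then have "fst i \<in> K" using C(2) by (auto simp: I_def)
        then have "dist (f (fst i)) z \<le> L * snd i"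
          using lip[of "fst i" x] x i L by (smt (verit) mult_left_mono)
        then show ?thesis using i by auto
      qed (use x in auto)
    qed
    have bB': "(\<Union>i\<in>C. ?B' i) \<in> sets lborel"
      using C(1) by (intro sets.countable_UN'') auto
    have "emeasure lborel (f ` K) = emeasure lebesgue (f ` K)"
      using fK by (simp add: borel_compact)
    also have "\<dots> \<le> emeasure lebesgue ((\<Union>i\<in>C. ?B' i) \<union> f ` ?N)"
      using sub bB' neg by (intro emeasure_mono) (auto simp: negligible_iff_null_sets)
    also have "\<dots> \<le> emeasure lebesgue (\<Union>i\<in>C. ?B' i)"
      using bB' neg by (subst emeasure_Un_null_set) (auto simp: negligible_iff_null_sets)
    also have "\<dots> = emeasure lborel (\<Union>i\<in>C. ?B' i)"
      using bB' by simp
    also have "\<dots> \<le> (\<integral>\<^sup>+i. emeasure lborel (?B' i) \<partial>count_space C)"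
    proof -
      have "(\<integral>\<^sup>+x. indicator (\<Union>i\<in>C. ?B' i) x \<partial>lborel) \<le> (\<integral>\<^sup>+x. (\<integral>\<^sup>+i. indicator (?B' i) x \<partial>count_space C) \<partial>lborel)"
      proof (rule nn_integral_mono)
        fix x
        show "indicator (\<Union>i\<in>C. ?B' i) x \<le> (\<integral>\<^sup>+i. indicator (?B' i) x \<partial>count_space C)"
        proof (cases "x \<in> (\<Union>i\<in>C. ?B' i)")
          case True
          then obtain i where i: "i \<in> C" "x \<in> ?B' i" by blast
          have "(\<integral>\<^sup>+j. indicator {i} j \<partial>count_space C) \<le> (\<integral>\<^sup>+j. (indicator (?B' j) x :: ennreal) \<partial>count_space C)"
            using i by (intro nn_integral_mono) (auto simp: indicator_def)
          moreover have "(\<integral>\<^sup>+j. indicator {i} j \<partial>count_space C) = (1::ennreal)"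
            using i by simp
          ultimately show ?thesis using True by simp
        qed simp
      qed
      also have "\<dots> = (\<integral>\<^sup>+i. (\<integral>\<^sup>+x. indicator (?B' i) x \<partial>lborel) \<partial>count_space C)"
        by (rule nn_integral_count_space_nn_integral[OF C(1)]) (auto intro!: borel_measurable_indicator)
      finally show ?thesis using bB' by simp
    qed
    also have "\<dots> = (\<integral>\<^sup>+i. ennreal (L ^ DIM('a)) * emeasure lborel (?B i) \<partial>count_space C)"
    proof (rule nn_integral_cong)
      fix i assume "i \<in> space (count_space C)"
      then have r: "0 \<le> snd i" using C(2) by (auto simp: I_def)
      then show "emeasure lborel (?B' i) = ennreal (L ^ DIM('a)) * emeasure lborel (?B i)"
        using L by (simp add: emeasure_cball dim power_mult_distrib ennreal_mult' mult_ac)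
    qed
    also have "\<dots> = ennreal (L ^ DIM('a)) * (\<integral>\<^sup>+i. emeasure lborel (?B i) \<partial>count_space C)"
      by (rule nn_integral_cmult) simp
    also have "(\<integral>\<^sup>+i. emeasure lborel (?B i) \<partial>count_space C) = emeasure lborel (\<Union>i\<in>C. ?B i)"
      using C(1,3) by (intro emeasure_UN_countable[symmetric]) 
        (auto simp: disjoint_family_on_def pairwise_def disjnt_def)
    also have "\<dots> \<le> emeasure lborel U"
    proof (rule emeasure_mono)
      show "(\<Union>i\<in>C. ?B i) \<subseteq> U"
      proof (rule UN_least)
        fix i assume "i \<in> C"
        with C(2) have "i \<in> I" by blast
        then show "?B i \<subseteq> U" by (cases i) (simp add: I_def)
      qed
    qed (use U in simp)
    finally show ?thesis
      using Ule by (meson mult_left_mono order_trans zero_le)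
  qed note * = this
  have fin: "emeasure lborel K < \<infinity>" using emeasure_compact_finite[OF K] by simp
  show ?thesis
  proof (rule ennreal_le_epsilon)
    fix e :: real assume e: "0 < e"
    \<comment> \<open>The \<open>+ 1\<close> keeps the quotient meaningful when
      \<open>L = 0\<close>.\<close>
    define e' where "e' = e / (L ^ DIM('a) + 1)"
    have L': "0 \<le> L ^ DIM('a)" using L by simp
    have e': "e' > 0" "L ^ DIM('a) * e' \<le> e" using e L' by (auto simp: e'_def field_simps)
    have "emeasure lborel (f ` K) \<le> ennreal (L ^ DIM('a)) * emeasure lborel K + ennreal (L ^ DIM('a)) * ennreal e'"
      using *[OF e'(1)] by (simp add: distrib_left)
    also have "ennreal (L ^ DIM('a)) * ennreal e' \<le> ennreal e"
      using e' L' by (simp add: ennreal_mult'[symmetric] ennreal_leI)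
    finally show "emeasure lborel (f ` K) \<le> ennreal (L ^ DIM('a)) * emeasure lborel K + ennreal e"
      by (simp add: add_left_mono)
  qed
qed

text \<open>The map and its inverse are both Lipschitz with constant one.\<close>

lemma emeasure_isometry_image:
  fixes f :: "'a::euclidean_space \<Rightarrow> 'b::euclidean_space"
  assumes dim: "DIM('b) = DIM('a)" and K: "compact K"
    and iso: "\<And>x y. x \<in> K \<Longrightarrow> y \<in> K \<Longrightarrow> dist (f x) (f y) = dist x y"
  shows "emeasure lborel (f ` K) = emeasure lborel K"
proof (rule antisym)
  show "emeasure lborel (f ` K) \<le> emeasure lborel K"
    using emeasure_lipschitz_image_le[OF dim K, of 1 f] iso by simp
  have inj: "inj_on f K" using iso by (metis dist_eq_0_iff inj_onI)
  have "continuous_on K f"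
    using iso by (intro lipschitz_on_continuous_on[of 1]) (simp add: lipschitz_on_def)
  then have "compact (f ` K)" using K compact_continuous_image by blast
  moreover have "dist (the_inv_into K f u) (the_inv_into K f v) \<le> 1 * dist u v"
    if "u \<in> f ` K" "v \<in> f ` K" for u v
    using that inj iso by (auto simp: the_inv_into_f_f)
  ultimately have "emeasure lborel (the_inv_into K f ` f ` K) \<le> emeasure lborel (f ` K)"
    using emeasure_lipschitz_image_le[of "f ` K" 1 "the_inv_into K f"] dim by simp
  then show "emeasure lborel K \<le> emeasure lborel (f ` K)"
    using inj by (simp add: the_inv_into_onto)
qed

lemma compact_linear_image:
  fixes f :: "'a::euclidean_space \<Rightarrow> 'b::real_normed_vector"
  assumes "compact K" "linear f"
  shows "compact (f ` K)"
  using assms by (intro compact_continuous_image linear_continuous_on) (simp_all add: linear_conv_bounded_linear)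

text \<open>Induction over elementary linear maps. Transpositions are isometries, and a shear
  translates every line parallel to the changed axis, so it keeps the length of each slice in that
  direction.\<close>

lemma emeasure_linear_image:
  fixes f :: "real ^ 'n \<Rightarrow> real ^ 'n"
  assumes "linear f" "compact K"
  shows "emeasure lborel (f ` K) = ennreal \<bar>det (matrix f)\<bar> * emeasure lborel K"
proof -
  have "linear f \<and> (\<forall>K. compact K \<longrightarrow> emeasure lborel (f ` K) = ennreal \<bar>det (matrix f)\<bar> * emeasure lborel K)"
  proof (rule induct_linear_elementary[OF assms(1)], goal_cases)
    case (1 f g)
    show ?case
    proof (intro conjI allI impI)
      show "linear (f \<circ> g)" using 1 by (simp add: linear_compose)
      fix K :: "(real ^ 'n) set" assume K: "compact K"
      then have "compact (g ` K)" using 1 by (simp add: compact_linear_image)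
      then show "emeasure lborel ((f \<circ> g) ` K) = ennreal \<bar>det (matrix (f \<circ> g))\<bar> * emeasure lborel K"
        using 1 K matrix_compose[of g f] unfolding image_comp[symmetric]
        by (simp add: det_mul abs_mult ennreal_mult' mult.assoc)
    qed
  next
    case (2 f i)
    then have ninj: "\<not> inj f"
      by (metis (full_types) linear_injective_imp_surjective one_neq_zero surjE vec_component)
    show ?case
    proof (intro conjI allI impI)
      fix K :: "(real ^ 'n) set" assume K: "compact K"
      have "f ` K \<in> null_sets lebesgue"
        using negligible_linear_singular_image[OF 2(1) ninj] by (simp add: negligible_iff_null_sets)
      moreover have "f ` K \<in> sets borel" 
        using K 2(1) by (simp add: borel_compact compact_linear_image)
      ultimately have "emeasure lborel (f ` K) = 0"
        using emeasure_completion[of "f ` K" lborel] by (auto simp: null_sets_def)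
      then show "emeasure lborel (f ` K) = ennreal \<bar>det (matrix f)\<bar> * emeasure lborel K"
        using ninj 2(1) det_nz_iff_inj[of f] by auto
    qed (fact 2)
  next
    case (3 c)
    have lin: "linear (\<lambda>x::real^'n. \<chi> i. c i * x $ i)"
      by (rule linearI) (simp_all add: vec_eq_iff algebra_simps)
    have det: "det (matrix (\<lambda>x::real^'n. \<chi> i. c i * x $ i)) = prod c UNIV"
      by (simp add: axis_def matrix_def det_diagonal)
    show ?case
    proof (intro conjI allI impI)
      fix K :: "(real ^ 'n) set" assume K: "compact K"
      let ?f = "\<lambda>x::real^'n. \<chi> i. c i * x $ i"
      have cf: "compact (?f ` K)" using compact_linear_image[OF K lin] .
      have "measure lborel (?f ` K) = \<bar>prod c UNIV\<bar> * measure lborel K"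
        using measure_stretch[of K c] lmeasurable_compact[OF K] K cf
        by (simp add: measure_completion borel_compact)
      moreover have "emeasure lborel S = ennreal (measure lborel S)" if "compact S" for S :: "(real ^ 'n) set"
        using emeasure_compact_finite[OF that] by (simp add: emeasure_eq_ennreal_measure)
      ultimately show "emeasure lborel (?f ` K) = ennreal \<bar>det (matrix ?f)\<bar> * emeasure lborel K"
        using K cf unfolding det by (simp add: ennreal_mult')
    qed (fact lin)
  next
    case (4 m n)
    let ?f = "\<lambda>x::real^'n. \<chi> i. x $ Transposition.transpose m n i"
    have lin: "linear ?f"
      by (rule linearI) (simp_all add: vec_eq_iff)
    have norm: "norm (?f x) = norm x" for x
      unfolding norm_vec_def L2_set_def
      using sum.permute[OF permutes_swap_id[of m UNIV n], of "\<lambda>i. (norm (x $ i))\<^sup>2"] by (simp add: o_def)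
    then have orth: "orthogonal_transformation ?f"
      using lin by (simp add: orthogonal_transformation)
    have det: "\<bar>det (matrix ?f)\<bar> = 1"
      using orthogonal_transformation_det[OF orth] .
    have "dist (?f x) (?f y) = dist x y" for x y
      using norm[of "x - y"] linear_diff[OF lin, of x y] by (simp add: dist_norm)
    then show ?case
      using lin det emeasure_isometry_image[of _ ?f] by simp
  next
    case (5 m n)
    let ?f = "\<lambda>x::real^'n. \<chi> i. if i = m then x $ m + x $ n else x $ i"
    let ?g = "\<lambda>x::real^'n. x - (x $ n) *\<^sub>R axis m 1"
    have lin: "linear ?f"
      by (rule linearI) (simp_all add: vec_eq_iff algebra_simps)
    have fg: "?f (?g y) = y" "?g (?f y) = y" for y
      using 5 by (auto simp: vec_eq_iff axis_def)
    have "matrix ?f = (\<chi> k. if k = m then row m (mat 1) + 1 *s row n (mat 1) else row k (mat 1))"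
      using 5 by (auto simp: vec_eq_iff matrix_def row_def mat_def axis_def)
    then have det: "det (matrix ?f) = 1"
      using det_row_operation[OF 5, of "mat 1" 1] by simp
    show ?case
    proof (intro conjI allI impI)
      fix K :: "(real ^ 'n) set" assume K: "compact K"
      have cf: "compact (?f ` K)" using compact_linear_image[OF K lin] .
      have ax: "axis m (1::real) \<in> Basis" by simp
      have mem: "y \<in> ?f ` K \<longleftrightarrow> ?g y \<in> K" for y
      proof
        assume "y \<in> ?f ` K"
        then obtain k where "k \<in> K" "y = ?f k" by (rule imageE)
        then show "?g y \<in> K" by (simp only: fg)
      next
        assume "?g y \<in> K"
        then have "?f (?g y) \<in> ?f ` K" by (rule imageI)
        then show "y \<in> ?f ` K" by (simp only: fg)
      qed
      have "emeasure lborel {t. x + t *\<^sub>R axis m 1 \<in> ?f ` K} = emeasure lborel {t. x + t *\<^sub>R axis m 1 \<in> K}" for x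
      proof -
        let ?T = "{t. x + t *\<^sub>R axis m 1 \<in> K}"
        \<comment> \<open>The coordinate \<open>n\<close> is constant along the line because
          \<open>m \<noteq> n\<close>, so the shear moves the whole line by the fixed amount
          \<open>x $ n\<close>.\<close>
        have eq: "?g (x + t *\<^sub>R axis m 1) = x + (t - x $ n) *\<^sub>R axis m 1" for t
          using 5 by (simp add: axis_def algebra_simps)
        have "{t. x + t *\<^sub>R axis m 1 \<in> ?f ` K} = {t. t - x $ n \<in> ?T}"
          by (simp only: mem eq mem_Collect_eq)
        also have "\<dots> = (\<lambda>t. x $ n + t) ` ?T"
        proof (intro set_eqI iffI)
          fix t assume "t \<in> {t. t - x $ n \<in> ?T}"
          then show "t \<in> (\<lambda>t. x $ n + t) ` ?T"
            by (intro image_eqI[of _ _ "t - x $ n"]) simp_all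
        qed auto
        also have "emeasure lborel \<dots> = emeasure lborel ?T"
          using compact_slice[OF K ax] by (intro emeasure_isometry_image) (auto simp: dist_norm)
        finally show ?thesis .
      qed
      then have "emeasure lborel (?f ` K) = emeasure lborel K"
        using K cf ax by (intro antisym; intro emeasure_lborel_mono_slices[where b="axis m 1"]) (auto simp: borel_compact)
      then show "emeasure lborel (?f ` K) = ennreal \<bar>det (matrix ?f)\<bar> * emeasure lborel K"
        by (simp add: det)
    qed (fact lin)
  qed
  then show ?thesis using assms by blast
qed

lemma emeasure_linear_times_id_image:
  fixes f :: "real ^ 'n \<Rightarrow> real ^ 'n" and K :: "((real ^ 'n) \<times> 's::euclidean_space) set"
  assumes f: "linear f" and K: "compact K"
  shows "emeasure lborel (map_prod f id ` K) = ennreal \<bar>det (matrix f)\<bar> * emeasure lborel K"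
proof -
  have cK: "compact (map_prod f id ` K)"
  proof (rule compact_linear_image[OF K])
    show "linear (map_prod f (id :: 's \<Rightarrow> 's))"
      using f by (intro linearI) (auto simp: linear_add linear_scale)
  qed
  have slice: "compact {y. (y, z) \<in> K'}" if "compact K'" for z and K' :: "((real ^ 'n) \<times> 's) set"
  proof -
    have "{y. (y, z) \<in> K'} = fst ` (K' \<inter> (UNIV \<times> {z}))" by force
    moreover have "compact (K' \<inter> (UNIV \<times> {z}))"
      using that by (intro compact_Int_closed closed_Times) auto
    ultimately show ?thesis by (simp add: compact_continuous_image continuous_on_fst continuous_on_id)
  qed
  have fubini: "emeasure lborel K' = (\<integral>\<^sup>+z. emeasure lborel {y. (y, z) \<in> K'} \<partial>lborel)"
    if "compact K'" for K' :: "((real ^ 'n) \<times> 's) set"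
  proof -
    have "K' \<in> sets ((lborel :: (real ^ 'n) measure) \<Otimes>\<^sub>M (lborel :: 's measure))"
      unfolding lborel_prod using that by (simp add: borel_compact)
    from lborel_pair.emeasure_pair_measure_alt2[OF this] show ?thesis
      unfolding lborel_prod by (simp add: vimage_def)
  qed
  have "{y. (y, z) \<in> map_prod f id ` K} = f ` {y. (y, z) \<in> K}" for z by force
  then have "emeasure lborel (map_prod f id ` K) = (\<integral>\<^sup>+z. ennreal \<bar>det (matrix f)\<bar> * emeasure lborel {y. (y, z) \<in> K} \<partial>lborel)"
    unfolding fubini[OF cK] using emeasure_linear_image[OF f slice[OF K]] by simp
  also have "\<dots> = ennreal \<bar>det (matrix f)\<bar> * (\<integral>\<^sup>+z. emeasure lborel {y. (y, z) \<in> K} \<partial>lborel)"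
  proof (rule nn_integral_cmult)
    have "(\<lambda>z. emeasure lborel ((\<lambda>y. (y, z)) -` K)) \<in> borel_measurable (lborel :: 's measure)"
      unfolding lborel_prod[symmetric] using borel_compact[OF K]
      by (intro lborel_pair.measurable_emeasure_Pair2) (simp only: lborel_prod sets_lborel)
    then show "(\<lambda>z. emeasure lborel {y. (y, z) \<in> K}) \<in> borel_measurable lborel"
      by (simp add: vimage_def)
  qed
  finally show ?thesis by (simp add: fubini[OF K])
qed

section \<open>The coarea inequality\<close>

text \<open>Disjoint compact pieces are at positive distance, so a covering set of small enough
  diameter meets at most one of them. By the isodiametric inequality its weight then pays for the
  projection of its part of that piece. Each piece has its own projection \<open>P i\<close>,
  because a fibre will be cut by a partition of \<open>X\<close> whose cells carry different
  coordinates.\<close>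

lemma hausdorff_measure_ge_sum:
  fixes P :: "'i \<Rightarrow> 'a::heine_borel \<Rightarrow> 'b::euclidean_space"
  assumes I: "finite I" and Q: "\<And>i. i \<in> I \<Longrightarrow> compact (Q i)"
    and disj: "disjoint_family_on Q I"
    and lip: "\<And>i x y. i \<in> I \<Longrightarrow> x \<in> Q i \<Longrightarrow> y \<in> Q i \<Longrightarrow> dist (P i x) (P i y) \<le> dist x y"
    and sub: "(\<Union>i\<in>I. Q i) \<subseteq> A"
  shows "(\<Sum>i\<in>I. emeasure lborel (P i ` Q i)) \<le> hausdorff_measure (DIM('b)) A"
proof -
  have "\<exists>d>0. \<forall>p\<in>I\<times>I. fst p \<noteq> snd p \<longrightarrow> (\<forall>x\<in>Q (fst p). \<forall>y\<in>Q (snd p). d \<le> dist x y)"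
  proof -
    have "\<exists>d>0. fst p \<noteq> snd p \<longrightarrow> (\<forall>x\<in>Q (fst p). \<forall>y\<in>Q (snd p). d \<le> dist x y)" if "p \<in> I \<times> I" for p
    proof (cases "fst p = snd p")
      case True then show ?thesis by (intro exI[of _ 1]) auto
    next
      case False
      moreover have "fst p \<in> I" "snd p \<in> I" using that by auto
      ultimately have "Q (fst p) \<inter> Q (snd p) = {}" using disj unfolding disjoint_family_on_def by blast
      moreover have "compact (Q (fst p))" "closed (Q (snd p))"
        using Q \<open>fst p \<in> I\<close> \<open>snd p \<in> I\<close> by (auto intro: compact_imp_closed)
      ultimately show ?thesis using separate_compact_closed by blast
    qed
    then obtain d where d: "\<And>p. p \<in> I \<times> I \<Longrightarrow> d p > (0::real)"
      "\<And>p x y. p \<in> I \<times> I \<Longrightarrow> fst p \<noteq> snd p \<Longrightarrow> x \<in> Q (fst p) \<Longrightarrow> y \<in> Q (snd p) \<Longrightarrow> d p \<le> dist x y"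
      by metis
    show ?thesis
    proof (intro exI[of _ "Min (insert 1 (d ` (I \<times> I)))"] conjI ballI impI)
      show "0 < Min (insert 1 (d ` (I \<times> I)))" using I d(1) by (subst Min_gr_iff) auto
      fix p x y assume p: "p \<in> I \<times> I" "fst p \<noteq> snd p" "x \<in> Q (fst p)" "y \<in> Q (snd p)"
      have "Min (insert 1 (d ` (I \<times> I))) \<le> d p" using I p by (intro Min_le) auto
      also have "\<dots> \<le> dist x y" by (rule d(2)[OF p])
      finally show "Min (insert 1 (d ` (I \<times> I))) \<le> dist x y" .
    qed
  qed
  then obtain d where d: "d > 0"
    and dd: "\<And>i j x y. i \<in> I \<Longrightarrow> j \<in> I \<Longrightarrow> i \<noteq> j \<Longrightarrow> x \<in> Q i \<Longrightarrow> y \<in> Q j \<Longrightarrow> d \<le> dist x y"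
    by (metis fst_conv snd_conv SigmaI)
  have "(\<Sum>i\<in>I. emeasure lborel (P i ` Q i)) \<le> hausdorff_pre (DIM('b)) (d / 2) A"
    unfolding hausdorff_pre_def
  proof (rule INF_greatest)
    fix U :: "nat \<Rightarrow> 'a set"
    assume "U \<in> {U. A \<subseteq> (\<Union>i. U i) \<and> (\<forall>i. bounded (U i) \<and> diameter (U i) \<le> d / 2)}"
    then have U: "A \<subseteq> (\<Union>j. U j)" "\<And>j. bounded (U j)" "\<And>j. diameter (U j) \<le> d / 2" by auto
    let ?w = "\<lambda>j. ennreal (unit_ball_vol (real DIM('b)) * (diameter (U j) / 2) ^ DIM('b))"
    \<comment> \<open>Closures keep the diameter and make the projected parts measurable.\<close>
    define S where "S i j = closure (P i ` (U j \<inter> Q i))" for i j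
    have bS: "compact (S i j)" "emeasure lborel (S i j) \<le> ?w j" if i: "i \<in> I" for i j
    proof -
      have cont: "continuous_on (Q i) (P i)"
        using lip[OF i] by (intro lipschitz_on_continuous_on[of 1]) (simp add: lipschitz_on_def)
      have "bounded (P i ` Q i)"
        using cont Q[OF i] by (intro compact_imp_bounded compact_continuous_image)
      then have bd: "bounded (P i ` (U j \<inter> Q i))" by (rule bounded_subset) auto
      then show "compact (S i j)" by (simp add: S_def)
      then show "emeasure lborel (S i j) \<le> ?w j"
      proof (rule isodiametric_inequality)
        show "0 \<le> diameter (U j)" using U(2) by (rule diameter_ge_0)
        fix x y assume "x \<in> S i j" "y \<in> S i j"
        then have "dist x y \<le> diameter (S i j)"
          using \<open>compact (S i j)\<close> by (intro diameter_bounded_bound compact_imp_bounded)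
        also have "\<dots> = diameter (P i ` (U j \<inter> Q i))"
          unfolding S_def using bd by (rule diameter_closure)
        also have "\<dots> \<le> diameter (U j)"
        proof (rule diameter_le)
          show "P i ` (U j \<inter> Q i) \<noteq> {} \<or> 0 \<le> diameter (U j)" using diameter_ge_0[OF U(2)] by simp
          fix u v assume "u \<in> P i ` (U j \<inter> Q i)" "v \<in> P i ` (U j \<inter> Q i)"
          then obtain a b where ab: "a \<in> U j \<inter> Q i" "u = P i a" "b \<in> U j \<inter> Q i" "v = P i b" by blast
          then have "dist u v \<le> dist a b" using lip[OF i] by simp
          also have "\<dots> \<le> diameter (U j)" using ab U(2) by (intro diameter_bounded_bound) auto
          finally show "norm (u - v) \<le> diameter (U j)" by (simp add: dist_norm)
        qed
        finally show "dist x y \<le> diameter (U j)" .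
      qed
    qed
    have "(\<Sum>i\<in>I. emeasure lborel (P i ` Q i)) \<le> (\<Sum>i\<in>I. \<Sum>j. emeasure lborel (S i j))"
    proof (rule sum_mono)
      fix i assume i: "i \<in> I"
      have "P i ` Q i \<subseteq> (\<Union>j. S i j)"
      proof
        fix z assume "z \<in> P i ` Q i"
        then obtain x where x: "x \<in> Q i" "z = P i x" by blast
        then obtain j where "x \<in> U j" using U(1) sub i by blast
        then have "z \<in> P i ` (U j \<inter> Q i)" using x by blast
        then have "z \<in> S i j" unfolding S_def by (rule subsetD[OF closure_subset])
        then show "z \<in> (\<Union>j. S i j)" by blast
      qed
      then have "emeasure lborel (P i ` Q i) \<le> emeasure lborel (\<Union>j. S i j)"
        using bS(1)[OF i] by (intro emeasure_mono) (auto simp: borel_compact)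
      also have "\<dots> \<le> (\<Sum>j. emeasure lborel (S i j))"
        using bS(1)[OF i] by (intro emeasure_subadditive_countably) (auto simp: borel_compact)
      finally show "emeasure lborel (P i ` Q i) \<le> (\<Sum>j. emeasure lborel (S i j))" .
    qed
    also have "\<dots> = (\<Sum>j. \<Sum>i\<in>I. emeasure lborel (S i j))"
      by (rule suminf_sum[symmetric]) simp
    also have "\<dots> \<le> (\<Sum>j. if U j = {} then 0 else ?w j)"
    proof (rule suminf_le)
      fix j
      show "(\<Sum>i\<in>I. emeasure lborel (S i j)) \<le> (if U j = {} then 0 else ?w j)"
      proof (cases "\<exists>i\<in>I. U j \<inter> Q i \<noteq> {}")
        case False
        then have "S i j = {}" if "i \<in> I" for i using that by (simp add: S_def)
        then show ?thesis by simp
      next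
        case True
        then obtain i where i: "i \<in> I" "U j \<inter> Q i \<noteq> {}" by blast
        have "S i' j = {}" if i': "i' \<in> I - {i}" for i'
        proof (rule ccontr)
          assume "S i' j \<noteq> {}"
          then obtain y where y: "y \<in> U j" "y \<in> Q i'" by (auto simp: S_def)
          obtain x where x: "x \<in> U j" "x \<in> Q i" using i by blast
          have "d \<le> dist x y" using dd[of i i' x y] i i' x y by auto
          also have "\<dots> \<le> diameter (U j)" using x y U(2) by (intro diameter_bounded_bound)
          also have "\<dots> \<le> d / 2" by (rule U(3))
          finally show False using d by simp
        qed
        then have "(\<Sum>i\<in>I. emeasure lborel (S i j)) = emeasure lborel (S i j)"
          using sum.mono_neutral_right[of I "{i}" "\<lambda>i. emeasure lborel (S i j)"] I i by simp
        also have "\<dots> \<le> ?w j" by (rule bS(2)[OF i(1)])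
        finally show ?thesis using i by auto
      qed
    qed auto
    finally show "(\<Sum>i\<in>I. emeasure lborel (P i ` Q i)) \<le> (\<Sum>j. if U j = {} then 0 else ?w j)" .
  qed
  also have "\<dots> \<le> hausdorff_measure (DIM('b)) A"
    unfolding hausdorff_measure_def using d by (intro SUP_upper) simp
  finally show ?thesis .
qed

text \<open>An index type with as many elements as the kernel of a surjection from
  \<open>real ^ 'm\<close> to \<open>real ^ 'n\<close> has dimensions. The \<open>max 1\<close>
  keeps the type inhabited when \<open>CARD('m) \<le> CARD('n)\<close>.\<close>

typedef ('m, 'n) codim = "{i::nat. i < max 1 (CARD('m) - CARD('n))}"
  by (intro exI[of _ 0]) simp

lemma UNIV_codim: "(UNIV :: ('m, 'n) codim set) = Abs_codim ` {i. i < max 1 (CARD('m) - CARD('n))}"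
  using type_definition.Abs_image[OF type_definition_codim] by (rule sym)

instance codim :: (type, type) finite
  by standard (simp add: UNIV_codim)

lemma CARD_codim: "CARD(('m, 'n) codim) = max 1 (CARD('m) - CARD('n))"
  using type_definition.card[OF type_definition_codim] by simp

lemma linear_isometry_inner:
  fixes f :: "'a::real_inner \<Rightarrow> 'b::real_inner"
  assumes "linear f" "\<And>x. norm (f x) = norm x"
  shows "f x \<bullet> f y = x \<bullet> y"
  using assms(2)[of "x + y"] assms(2)[of x] assms(2)[of y]
  by (simp add: dot_norm linear_add[OF assms(1)])

text \<open>Coordinates adapted to the kernel: \<open>T\<close> is an isometry sending the
  orthogonal complement of the kernel to the first factor and the kernel to the second. The
  complement is embedded by a matrix \<open>G\<close> with \<open>transpose G ** G = mat 1\<close>,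
  so \<open>matrix L\<close> times its transpose equals \<open>matrix R\<close> times its transpose,
  whence the squared determinant.\<close>

lemma surjective_linear_split:
  fixes L :: "real ^ 'm \<Rightarrow> real ^ 'n"
  assumes card: "CARD('n) < CARD('m)" and L: "linear L" "surj L"
  obtains R :: "real ^ 'n \<Rightarrow> real ^ 'n" and T :: "real ^ 'm \<Rightarrow> (real ^ 'n) \<times> (real ^ ('m, 'n) codim)"
  where "linear R" "linear T" "surj T" "\<And>x. norm (T x) = norm x" "\<And>x. L x = R (fst (T x))"
    "det (matrix L ** transpose (matrix L)) = (det (matrix R))\<^sup>2"
proof -
  define N where "N = {x. L x = 0}"
  define N' where "N' = {y \<in> UNIV. \<forall>x\<in>N. orthogonal x y}"
  have sN: "subspace N" unfolding N_def using L(1) by (rule linear_subspace_kernel)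
  have sN': "subspace N'" unfolding N'_def by (simp add: subspace_orthogonal_to_vectors)
  have dsum: "dim N' + dim N = CARD('m)"
    using dim_subspace_orthogonal_to_vectors[OF sN subspace_UNIV] by (simp add: N'_def)
  have decomp: "\<exists>u v. u \<in> N \<and> v \<in> N' \<and> x = u + v" for x
  proof -
    obtain u v where "u \<in> span N" "\<And>w. w \<in> span N \<Longrightarrow> orthogonal v w" "x = u + v"
      using orthogonal_subspace_decomp_exists[of N x] by blast
    moreover have "span N = N" using sN by (rule span_eq_iff[THEN iffD2])
    ultimately show ?thesis by (auto simp: N'_def orthogonal_commute)
  qed
  have LN': "L ` N' = UNIV"
  proof -
    have "y \<in> L ` N'" for y
    proof -
      obtain x where "L x = y" using L(2) by (metis surjD)
      then show ?thesis using decomp[of x] linear_add[OF L(1)] by (auto simp: N_def image_iff)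
    qed
    then show ?thesis by blast
  qed
  have "inj_on L (span N')"
  proof -
    have "inj_on L N'"
    proof (rule inj_onI)
      fix x y assume xy: "x \<in> N'" "y \<in> N'" "L x = L y"
      then have "x - y \<in> N" using linear_diff[OF L(1)] by (simp add: N_def)
      moreover have "x - y \<in> N'" using xy sN' by (simp add: subspace_diff)
      ultimately have "orthogonal (x - y) (x - y)" by (auto simp: N'_def)
      then show "x = y" by (simp add: orthogonal_self)
    qed
    moreover have "span N' = N'" using sN' by (rule span_eq_iff[THEN iffD2])
    ultimately show ?thesis by (simp only:)
  qed
  then have "dim (L ` N') = dim N'" by (rule eucl.dim_image_eq[OF L(1)])
  then have dN': "dim N' = CARD('n)" by (simp add: LN')
  then have dN: "dim N = CARD(('m, 'n) codim)" using dsum card by (simp add: CARD_codim)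
  obtain g :: "real ^ 'n \<Rightarrow> real ^ 'm" where g: "linear g" "range g = N'" "\<And>y. norm (g y) = norm y"
  proof (rule isometries_subspaces[of "UNIV :: (real ^ 'n) set" N'])
    show "dim (UNIV :: (real ^ 'n) set) = dim N'" by (simp add: dN')
  qed (use sN' that in auto)
  obtain h :: "real ^ ('m, 'n) codim \<Rightarrow> real ^ 'm" where h: "linear h" "range h = N" "\<And>y. norm (h y) = norm y"
  proof (rule isometries_subspaces[of "UNIV :: (real ^ ('m, 'n) codim) set" N])
    show "dim (UNIV :: (real ^ ('m, 'n) codim) set) = dim N" by (simp add: dN)
  qed (use sN that in auto)
  have gh: "g y \<bullet> h z = 0" for y z
  proof -
    have "g y \<in> N'" "h z \<in> N" using g h by auto
    then show ?thesis by (auto simp: N'_def orthogonal_def inner_commute)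
  qed
  \<comment> \<open>The isometry is built in this direction because \<open>g\<close> and
    \<open>h\<close> are given on the factors; \<open>T\<close> will be its inverse.\<close>
  define X where "X p = g (fst p) + h (snd p)" for p
  have linX: "linear X"
    unfolding X_def using g(1) h(1)
    by (intro linearI) (simp_all add: linear_add linear_scale algebra_simps)
  have normX: "norm (X p) = norm p" for p
  proof -
    have "(norm (X p))\<^sup>2 = (norm (fst p))\<^sup>2 + (norm (snd p))\<^sup>2"
      unfolding X_def using gh g(3) h(3) by (subst norm_add_Pythagorean) (auto simp: orthogonal_def)
    then show ?thesis by (simp add: norm_prod_def real_sqrt_unique)
  qed
  have injX: "inj X"
    unfolding linear_injective_0[OF linX] by (metis normX norm_eq_zero)
  have surjX: "surj X"
  proof -
    have "x \<in> range X" for x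
    proof -
      obtain u v where uv: "u \<in> N" "v \<in> N'" "x = u + v" using decomp by blast
      then obtain y z where "v = g y" "u = h z" using g(2) h(2) by blast
      with uv have "x = X (y, z)" by (simp add: X_def add.commute)
      then show ?thesis by blast
    qed
    then show ?thesis by blast
  qed
  define T where "T = inv X"
  have XT: "X (T x) = x" and TX: "T (X p) = p" for x p
    using injX surjX by (auto simp: T_def surj_f_inv_f)
  have linT: "linear T"
  proof (rule linearI)
    fix x y :: "real ^ 'm" and c :: real
    have "T (X (T x) + X (T y)) = T x + T y" unfolding linear_add[OF linX, symmetric] TX ..
    then show "T (x + y) = T x + T y" by (simp add: XT)
    have "T (c *\<^sub>R X (T x)) = c *\<^sub>R T x" unfolding linear_scale[OF linX, symmetric] TX ..
    then show "T (c *\<^sub>R x) = c *\<^sub>R T x" by (simp add: XT)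
  qed
  define R where "R = L \<circ> g"
  have linR: "linear R" unfolding R_def using g(1) L(1) by (rule linear_compose)
  have LR: "L x = R (fst (T x))" for x
  proof -
    have "h (snd (T x)) \<in> N" using h(2) by blast
    then have "L (h (snd (T x))) = 0" by (simp add: N_def)
    then have "L (X (T x)) = R (fst (T x))"
      unfolding X_def R_def by (simp add: linear_add[OF L(1)])
    then show ?thesis by (simp add: XT)
  qed
  let ?G = "matrix g"
  have gG: "g y = ?G *v y" for y using g(1) by simp
  have GT: "transpose ?G *v x = fst (T x)" for x
  proof -
    have "w \<bullet> (transpose ?G *v x) = w \<bullet> fst (T x)" for w
    proof -
      have "w \<bullet> (transpose ?G *v x) = (x v* ?G) \<bullet> w" by (simp add: inner_commute)
      also have "\<dots> = x \<bullet> (?G *v w)" by (rule dot_lmul_matrix)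
      also have "\<dots> = g w \<bullet> X (T x)" unfolding gG[symmetric] XT by (rule inner_commute)
      also have "\<dots> = w \<bullet> fst (T x)"
        unfolding X_def by (simp add: inner_add_right gh linear_isometry_inner[OF g(1,3)])
      finally show ?thesis .
    qed
    then show ?thesis by (metis vector_eq_ldot)
  qed
  have eqL: "matrix L = matrix R ** transpose ?G"
  proof -
    have "matrix L *v x = (matrix R ** transpose ?G) *v x" for x
      using L(1) linR LR[of x] GT[of x] by (simp flip: matrix_vector_mul_assoc)
    then show ?thesis by (metis matrix_eq)
  qed
  have eqG: "transpose ?G ** ?G = mat 1"
  proof -
    have "T (g y) = (y, 0)" for y using TX[of "(y, 0)"] linear_0[OF h(1)] by (simp add: X_def)
    then have "(transpose ?G ** ?G) *v y = mat 1 *v y" for y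
      using GT[of "g y"] by (simp flip: matrix_vector_mul_assoc gG)
    then show ?thesis by (metis matrix_eq)
  qed
  have "matrix L ** transpose (matrix L) = matrix R ** (transpose ?G ** ?G) ** transpose (matrix R)"
    by (simp add: eqL matrix_transpose_mul matrix_mul_assoc)
  then have "det (matrix L ** transpose (matrix L)) = (det (matrix R))\<^sup>2"
    by (simp add: eqG det_mul power2_eq_square)
  moreover have "norm (T x) = norm x" for x using normX[of "T x"] by (simp add: XT)
  moreover have "surj T" using TX by (metis surjI)
  ultimately show ?thesis using that linR linT LR by blast
qed

text \<open>\<open>P\<close> is the coordinate along the kernel of \<open>L\<close>. Near
  \<open>x0\<close> the map \<open>\<Phi> = (B, P)\<close> is close to the linear isomorphism
  \<open>H = (L, P)\<close>, so \<open>F\<close>, which is \<open>inv H\<close> after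
  \<open>\<Phi>\<close>, is close to the identity and shrinks volume at most by the factor
  \<open>(1 - t) ^ CARD('m)\<close>. The slices of the image of \<open>Q\<close> under
  \<open>\<Phi>\<close> are the projected fibres, and Fubini concludes.\<close>

lemma coarea_local:
  fixes B :: "real ^ 'm \<Rightarrow> real ^ 'n"
  assumes card: "CARD('n) < CARD('m)" and L: "linear L" and k: "0 < k"
    and Jk: "k \<le> sqrt (det (matrix L ** transpose (matrix L)))"
    and strict: "\<And>e. e > 0 \<Longrightarrow> \<exists>d>0. \<forall>x\<in>ball x0 d. \<forall>y\<in>ball x0 d.
                   norm (B x - B y - L (x - y)) \<le> e * norm (x - y)"
    and t: "0 < t" "t < 1"
  obtains d and P :: "real ^ 'm \<Rightarrow> real ^ ('m, 'n) codim"
  where "d > 0" "\<And>x y. dist (P x) (P y) \<le> dist x y"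
    "\<And>Q. compact Q \<Longrightarrow> Q \<subseteq> ball x0 d \<Longrightarrow>
        (\<lambda>y. emeasure lborel (P ` {x\<in>Q. B x = y})) \<in> borel_measurable lborel"
    "\<And>Q. compact Q \<Longrightarrow> Q \<subseteq> ball x0 d \<Longrightarrow>
        ennreal (k * (1 - t) ^ CARD('m)) * emeasure lborel Q
          \<le> (\<integral>\<^sup>+y. emeasure lborel (P ` {x\<in>Q. B x = y}) \<partial>lborel)"
proof -
  have Jpos: "det (matrix L ** transpose (matrix L)) > 0"
    using k Jk by (smt (verit) real_sqrt_le_0_iff)
  have surjL: "surj L"
  proof -
    let ?A = "matrix L"
    have "invertible (?A ** transpose ?A)" using Jpos by (simp add: invertible_det_nz)
    then obtain C where "(?A ** transpose ?A) ** C = mat 1" by (auto simp: invertible_def)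
    then have "(?A ** transpose ?A ** C) *v y = y" for y by simp
    then have "?A *v ((transpose ?A ** C) *v y) = y" for y
      by (simp add: matrix_vector_mul_assoc matrix_mul_assoc)
    then have "L ((transpose ?A ** C) *v y) = y" for y
      using L by simp
    then show ?thesis by (metis surjI)
  qed
  obtain R :: "real ^ 'n \<Rightarrow> real ^ 'n" and T :: "real ^ 'm \<Rightarrow> (real ^ 'n) \<times> (real ^ ('m, 'n) codim)"
    where R: "linear R" and T: "linear T" "surj T" "\<And>x. norm (T x) = norm x"
      and LR: "\<And>x. L x = R (fst (T x))"
      and det: "det (matrix L ** transpose (matrix L)) = (det (matrix R))\<^sup>2"
    using surjective_linear_split[OF card L surjL] by metis
  have detR: "k \<le> \<bar>det (matrix R)\<bar>" "det (matrix R) \<noteq> 0"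
    using Jk Jpos unfolding det by auto
  have injR: "inj R" using detR(2) det_nz_iff_inj[OF R] by simp
  have surjR: "surj R" using R injR by (simp add: linear_injective_imp_surjective)
  have dT: "dist (T x) (T y) = dist x y" for x y
    using T(3)[of "x - y"] linear_diff[OF T(1)] by (simp add: dist_norm)
  define P where "P = snd \<circ> T"
  define G where "G = map_prod R (id :: real ^ ('m, 'n) codim \<Rightarrow> _)"
  define H where "H x = G (T x)" for x
  have H_eq: "H x = (L x, P x)" for x
    by (simp add: H_def G_def P_def LR map_prod_def case_prod_beta)
  have linG: "linear G"
    unfolding G_def using R by (intro linearI) (auto simp: linear_add linear_scale)
  have linH: "linear H"
    using linear_compose[OF T(1) linG] by (simp add: o_def H_def[abs_def])
  have injT: "inj T" using dT by (metis dist_eq_0_iff injI)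
  have injH: "inj H"
  proof (rule injI)
    fix x y assume "H x = H y"
    then have "fst (T x) = fst (T y)" "snd (T x) = snd (T y)"
      using injR by (simp_all add: H_def G_def prod_eq_iff inj_eq)
    then have "T x = T y" by (rule prod_eqI)
    then show "x = y" using injT by (rule injD[rotated])
  qed
  have surjH: "surj H"
  proof -
    have "p \<in> range H" for p
    proof -
      obtain a where a: "R a = fst p" using surjR by (metis surjD)
      obtain x where "T x = (a, snd p)" using T(2) by (metis surjD)
      then have "H x = p" using a by (simp add: H_def G_def)
      then show ?thesis by blast
    qed
    then show ?thesis by blast
  qed
  obtain b where b: "b > 0" "\<And>x. b * norm x \<le> norm (H x)"
    using linear_inj_bounded_below_pos[OF linH injH] by blast
  \<comment> \<open>\<open>H\<close> is bounded below by \<open>b\<close>, so an error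
    \<open>t * b\<close> of \<open>B\<close> against \<open>L\<close> becomes an error
    \<open>t\<close> of \<open>F\<close> against the identity.\<close>
  have "t * b > 0" using t b by simp
  from strict[OF this] obtain d where d: "d > 0"
    and near: "\<And>x y. x \<in> ball x0 d \<Longrightarrow> y \<in> ball x0 d \<Longrightarrow> norm (B x - B y - L (x - y)) \<le> t * b * norm (x - y)"
    by blast
  define \<Phi> where "\<Phi> x = (B x, P x)" for x
  define F where "F x = inv H (\<Phi> x)" for x
  have HF: "H (F x) = \<Phi> x" for x
    unfolding F_def using surjH by (rule surj_f_inv_f)
  have linP: "linear P" unfolding P_def using T(1) by (intro linear_compose) (auto simp: linear_iff)
  have PLip: "dist (P x) (P y) \<le> dist x y" for x y
    using dist_snd_le[of "T x" "T y"] dT[of x y] by (simp add: P_def)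
  have Fnear: "norm (F x - F y - (x - y)) \<le> t * norm (x - y)" if "x \<in> ball x0 d" "y \<in> ball x0 d" for x y
  proof -
    have "H (F x - F y - (x - y)) = \<Phi> x - \<Phi> y - H (x - y)"
      by (simp add: linear_diff[OF linH] HF)
    also have "\<dots> = (B x - B y - L (x - y), 0)"
      by (simp add: \<Phi>_def H_eq linear_diff[OF linP])
    finally have "norm (H (F x - F y - (x - y))) = norm (B x - B y - L (x - y))"
      by (simp add: norm_prod_def)
    also have "\<dots> \<le> t * b * norm (x - y)" using near that by blast
    finally have "b * norm (F x - F y - (x - y)) \<le> b * (t * norm (x - y))"
      using b(2)[of "F x - F y - (x - y)"] by (simp add: mult_ac)
    then show ?thesis using b(1) by simp
  qed
  have Fexp: "(1 - t) * dist x y \<le> dist (F x) (F y)" if "x \<in> ball x0 d" "y \<in> ball x0 d" for x y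
    using Fnear[OF that] norm_triangle_ineq2[of "x - y" "(x - y) - (F x - F y)"]
    by (simp add: dist_norm norm_minus_commute algebra_simps)
  have Flip: "dist (F x) (F y) \<le> (1 + t) * dist x y" if "x \<in> ball x0 d" "y \<in> ball x0 d" for x y
    using Fnear[OF that] norm_triangle_sub[of "F x - F y" "x - y"]
    by (simp add: dist_norm algebra_simps)
  show ?thesis
  proof (rule that[OF d PLip])
    fix Q assume Q: "compact Q" "Q \<subseteq> ball x0 d"
    have inb: "x \<in> ball x0 d" if "x \<in> Q" for x using Q(2) that by (rule subsetD)
    have "continuous_on Q F"
    proof (rule lipschitz_on_continuous_on[OF lipschitz_onI])
      show "dist (F x) (F y) \<le> (1 + t) * dist x y" if "x \<in> Q" "y \<in> Q" for x y
        using Q(2) that by (intro Flip) auto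
    qed (use t in simp)
    then have cF: "compact (F ` Q)" using Q(1) by (intro compact_continuous_image)
    have \<Phi>F: "\<Phi> ` Q = G ` T ` F ` Q"
      by (simp add: image_image HF flip: H_def)
    have cTF: "compact (T ` F ` Q)" using cF T(1) by (rule compact_linear_image)
    have c\<Phi>: "compact (\<Phi> ` Q)" unfolding \<Phi>F using cTF linG by (rule compact_linear_image)
    then have meas: "\<Phi> ` Q \<in> sets ((lborel :: (real ^ 'n) measure) \<Otimes>\<^sub>M (lborel :: (real ^ ('m, 'n) codim) measure))"
      unfolding lborel_prod by (simp add: borel_compact)
    have slice: "Pair y -` \<Phi> ` Q = P ` {x\<in>Q. B x = y}" for y
      by (auto simp: \<Phi>_def)
    show "(\<lambda>y. emeasure lborel (P ` {x\<in>Q. B x = y})) \<in> borel_measurable lborel"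
      using lborel.measurable_emeasure_Pair[OF meas] by (simp add: slice)
    have "emeasure lborel Q \<le> ennreal ((1 / (1 - t)) ^ CARD('m)) * emeasure lborel (F ` Q)"
    proof -
      have inj: "inj_on F Q"
      proof (rule inj_onI)
        fix x y assume xy: "x \<in> Q" "y \<in> Q" "F x = F y"
        have "(1 - t) * dist x y \<le> 0" using Fexp[OF inb[OF xy(1)] inb[OF xy(2)]] xy(3) by simp
        then show "x = y" using t by (simp add: mult_le_0_iff)
      qed
      have "dist (the_inv_into Q F u) (the_inv_into Q F v) \<le> 1 / (1 - t) * dist u v"
        if uv: "u \<in> F ` Q" "v \<in> F ` Q" for u v
      proof -
        obtain x y where xy: "x \<in> Q" "y \<in> Q" "u = F x" "v = F y" using uv by blast
        have "(1 - t) * dist x y \<le> dist u v"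
          unfolding xy(3,4) by (rule Fexp[OF inb[OF xy(1)] inb[OF xy(2)]])
        then show ?thesis using xy inj t by (simp add: the_inv_into_f_f field_simps)
      qed
      then have "emeasure lborel (the_inv_into Q F ` F ` Q) \<le> ennreal ((1 / (1 - t)) ^ DIM(real ^ 'm)) * emeasure lborel (F ` Q)"
        using t by (intro emeasure_lipschitz_image_le cF) auto
      then show ?thesis using inj by (simp add: the_inv_into_onto)
    qed
    then have "ennreal (k * (1 - t) ^ CARD('m)) * emeasure lborel Q
      \<le> ennreal (k * (1 - t) ^ CARD('m)) * (ennreal ((1 / (1 - t)) ^ CARD('m)) * emeasure lborel (F ` Q))"
      by (rule mult_left_mono) simp
    also have "\<dots> = ennreal k * emeasure lborel (F ` Q)"
      using t k by (simp add: power_divide flip: ennreal_mult mult.assoc)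
    also have "\<dots> \<le> ennreal \<bar>det (matrix R)\<bar> * emeasure lborel (F ` Q)"
      using detR by (intro mult_right_mono ennreal_leI) auto
    \<comment> \<open>\<open>T\<close> is an isometry, so only the factor \<open>R\<close> of
      \<open>H\<close> changes volume.\<close>
    also have "emeasure lborel (F ` Q) = emeasure lborel (T ` F ` Q)"
      using cF dT card by (intro emeasure_isometry_image[symmetric]) (auto simp: CARD_codim)
    also have "ennreal \<bar>det (matrix R)\<bar> * \<dots> = emeasure lborel (\<Phi> ` Q)"
      unfolding \<Phi>F G_def using emeasure_linear_times_id_image[OF R cTF] by simp
    also have "\<dots> = (\<integral>\<^sup>+y. emeasure lborel (Pair y -` \<Phi> ` Q) \<partial>lborel)"
      using lborel.emeasure_pair_measure_alt[OF meas] unfolding lborel_prod .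
    finally show "ennreal (k * (1 - t) ^ CARD('m)) * emeasure lborel Q
          \<le> (\<integral>\<^sup>+y. emeasure lborel (P ` {x\<in>Q. B x = y}) \<partial>lborel)"
      by (simp add: slice)
  qed
qed

lemma strict_derivative_has_derivative:
  fixes B :: "'a::real_normed_vector \<Rightarrow> 'b::real_normed_vector"
  assumes L: "bounded_linear L" and strict: "\<And>e. e > 0 \<Longrightarrow> \<exists>d>0. \<forall>x\<in>ball a d. \<forall>y\<in>ball a d.
                   norm (B x - B y - L (x - y)) \<le> e * norm (x - y)"
  shows "(B has_derivative L) (at a)"
  unfolding has_derivative_at_alt
proof (intro conjI allI impI L)
  fix e :: real assume "e > 0"
  from strict[OF this] obtain d where d: "d > 0" "\<And>x y. x \<in> ball a d \<Longrightarrow> y \<in> ball a d \<Longrightarrow>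
      norm (B x - B y - L (x - y)) \<le> e * norm (x - y)" by blast
  show "\<exists>d>0. \<forall>y. norm (y - a) < d \<longrightarrow> norm (B y - B a - L (y - a)) \<le> e * norm (y - a)"
  proof (intro exI[of _ d] conjI allI impI d(1))
    fix y assume "norm (y - a) < d"
    then show "norm (B y - B a - L (y - a)) \<le> e * norm (y - a)"
      using d(1) by (intro d(2)) (simp_all add: dist_norm norm_minus_commute)
  qed
qed

lemma continuous_on_strict_derivative:
  fixes B :: "'a::euclidean_space \<Rightarrow> 'b::real_normed_vector"
  assumes X: "open X" and L: "\<And>x. x \<in> X \<Longrightarrow> linear (L x)"
    and strict: "\<And>x0 e. x0 \<in> X \<Longrightarrow> e > 0 \<Longrightarrow> \<exists>d>0. \<forall>x\<in>ball x0 d. \<forall>y\<in>ball x0 d.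
                   norm (B x - B y - L x0 (x - y)) \<le> e * norm (x - y)"
  shows "continuous_on X B"
  unfolding continuous_on_eq_continuous_at[OF X]
proof
  fix a assume a: "a \<in> X"
  have "(B has_derivative L a) (at a)"
    using L[OF a] strict[OF a] by (intro strict_derivative_has_derivative) (auto simp: linear_conv_bounded_linear)
  then show "isCont B a" by (rule has_derivative_continuous)
qed

text \<open>Countably many balls of the local estimate cover \<open>X\<close>, they are made
  disjoint, and each piece is approximated from inside by a compact set. Only finitely many pieces
  are used at a time, as the lower bound for Hausdorff measure asks; the loss factor disappears as
  \<open>t\<close> tends to zero.\<close>

lemma coarea_inequality:
  fixes B :: "real ^ 'm \<Rightarrow> real ^ 'n"
  assumes card: "CARD('n) < CARD('m)" and X: "open X" "bounded X"
    and L: "\<And>x. x \<in> X \<Longrightarrow> linear (L x)" and k: "0 < k"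
    and Jk: "\<And>x. x \<in> X \<Longrightarrow> k \<le> sqrt (det (matrix (L x) ** transpose (matrix (L x))))"
    and strict: "\<And>x0 e. x0 \<in> X \<Longrightarrow> e > 0 \<Longrightarrow> \<exists>d>0. \<forall>x\<in>ball x0 d. \<forall>y\<in>ball x0 d.
                   norm (B x - B y - L x0 (x - y)) \<le> e * norm (x - y)"
    and M: "\<And>y. y \<in> B ` X \<Longrightarrow> hausdorff_measure (CARD('m) - CARD('n)) {x\<in>X. B x = y} \<le> ennreal M"
    and E: "E \<in> sets borel" and XE: "{x\<in>X. B x \<in> E} \<in> sets borel"
  shows "ennreal k * emeasure lborel {x\<in>X. B x \<in> E} \<le> ennreal M * emeasure lborel E"
proof (cases "X = {}")
  case False
  define Z where "Z = {x\<in>X. B x \<in> E}"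
  have cB: "continuous_on X B"
    by (rule continuous_on_strict_derivative[OF X(1) L strict])
  have "emeasure lborel Z \<le> emeasure lborel X"
    using X(1) by (intro emeasure_mono) (auto simp: Z_def)
  then have Zfin: "emeasure lborel Z < \<infinity>"
    using emeasure_bounded_finite[OF X(2)] by (simp add: le_less_trans)
  have key: "ennreal (k * (1 - t) ^ CARD('m)) * emeasure lborel Z \<le> ennreal M * emeasure lborel E"
    if t: "0 < t" "t < 1" for t
  proof -
    let ?c = "k * (1 - t) ^ CARD('m)"
    have c: "0 < ?c" using k t by simp
    \<comment> \<open>Radius and projection are packed in a pair so that one choice over all points
      of \<open>X\<close> yields both.\<close>
    define good where "good x0 dP \<longleftrightarrow> fst dP > 0 \<and> (\<forall>x y. dist (snd dP x) (snd dP y) \<le> dist x y) \<and>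
       (\<forall>Q. compact Q \<longrightarrow> Q \<subseteq> ball x0 (fst dP) \<longrightarrow>
        (\<lambda>y. emeasure lborel (snd dP ` {x\<in>Q. B x = y})) \<in> borel_measurable lborel \<and>
        ennreal ?c * emeasure lborel Q \<le> (\<integral>\<^sup>+y. emeasure lborel (snd dP ` {x\<in>Q. B x = y}) \<partial>lborel))"
      for x0 and dP :: "real \<times> (real ^ 'm \<Rightarrow> real ^ ('m, 'n) codim)"
    have "\<forall>x0\<in>X. \<exists>dP. good x0 dP"
    proof
      fix x0 assume x0: "x0 \<in> X"
      show "\<exists>dP. good x0 dP"
      proof (rule coarea_local[OF card L[OF x0] k Jk[OF x0] strict[OF x0] t])
        fix d and P :: "real ^ 'm \<Rightarrow> real ^ ('m, 'n) codim"
        assume "d > 0" "\<And>x y. dist (P x) (P y) \<le> dist x y"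
          "\<And>Q. compact Q \<Longrightarrow> Q \<subseteq> ball x0 d \<Longrightarrow>
            (\<lambda>y. emeasure lborel (P ` {x\<in>Q. B x = y})) \<in> borel_measurable lborel"
          "\<And>Q. compact Q \<Longrightarrow> Q \<subseteq> ball x0 d \<Longrightarrow>
            ennreal ?c * emeasure lborel Q \<le> (\<integral>\<^sup>+y. emeasure lborel (P ` {x\<in>Q. B x = y}) \<partial>lborel)"
        then have "good x0 (d, P)" by (simp add: good_def)
        then show "\<exists>dP. good x0 dP" ..
      qed
    qed
    then obtain f where f: "\<forall>x0\<in>X. good x0 (f x0)" by (rule bchoice[THEN exE])
    define d P where "d x = fst (f x)" and "P x = snd (f x)" for x
    have d: "d x0 > 0" if "x0 \<in> X" for x0
      using f that by (simp add: good_def d_def)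
    have P: "dist (P x0 x) (P x0 y) \<le> dist x y" if "x0 \<in> X" for x0 x y
      using f that by (simp add: good_def P_def)
    have Pm: "(\<lambda>y. emeasure lborel (P x0 ` {x\<in>Q. B x = y})) \<in> borel_measurable lborel"
      and Pe: "ennreal ?c * emeasure lborel Q \<le> (\<integral>\<^sup>+y. emeasure lborel (P x0 ` {x\<in>Q. B x = y}) \<partial>lborel)"
      if "x0 \<in> X" "compact Q" "Q \<subseteq> ball x0 (d x0)" for x0 Q
      using f that by (simp_all add: good_def P_def d_def)
    obtain F where F: "F \<subseteq> (\<lambda>x. ball x (d x)) ` X" "countable F" "\<Union>F = (\<Union>x\<in>X. ball x (d x))"
      by (rule Lindelof[of "(\<lambda>x. ball x (d x)) ` X"]) auto
    have XF: "X \<subseteq> \<Union>F" unfolding F(3) using d by force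
    obtain X' where X': "countable X'" "X' \<subseteq> X" "F = (\<lambda>x. ball x (d x)) ` X'"
      using F(1,2) countable_subset_image[of F "\<lambda>x. ball x (d x)" X] by blast
    have "X' \<noteq> {}" using False XF X' by auto
    then have x: "range (from_nat_into X') = X'" using X' by (simp add: range_from_nat_into)
    define x where "x = from_nat_into X'"
    have xX: "x i \<in> X" for i
      using X'(2) \<open>X' \<noteq> {}\<close> from_nat_into[of X' i] unfolding x_def by (rule_tac subsetD)
    define W where "W i = ball (x i) (d (x i))" for i
    have XW: "X \<subseteq> (\<Union>i. W i)"
    proof -
      have "\<Union>F = (\<Union>i. W i)"
        unfolding X'(3) W_def x_def by (subst x[symmetric]) (simp only: image_image)
      then show ?thesis using XF by (simp only:)
    qed
    define Zi where "Zi i = Z \<inter> disjointed W i" for i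
    have Zi_m: "Zi i \<in> sets borel" for i
    proof -
      have "range W \<subseteq> sets borel" by (auto simp: W_def)
      then have "disjointed W i \<in> sets borel" using sets.range_disjointed_sets[of W borel] by blast
      then show ?thesis using XE unfolding Zi_def Z_def by (rule sets.Int[rotated])
    qed
    have Zi_W: "Zi i \<subseteq> W i" for i using disjointed_subset[of W i] by (auto simp: Zi_def)
    have Zi_Z: "Zi i \<subseteq> Z" for i by (auto simp: Zi_def)
    have Zi_disj: "disjoint_family Zi"
      using disjoint_family_disjointed[of W] unfolding disjoint_family_on_def Zi_def by blast
    have ZiU: "(\<Union>i. Zi i) = Z"
      using XW UN_disjointed_eq[of W] unfolding Zi_def Z_def by blast
    have fin: "(\<Sum>i<N. ennreal ?c * emeasure lborel (Zi i)) \<le> ennreal M * emeasure lborel E" for N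
    proof (rule ennreal_le_epsilon)
      fix e :: real assume e: "0 < e"
      \<comment> \<open>Each of the \<open>N\<close> pieces loses at most \<open>?c * e'\<close>, so
        the total loss stays below \<open>e\<close>; the \<open>+ 1\<close> covers
        \<open>N = 0\<close>.\<close>
      define e' where "e' = e / (?c * (real N + 1))"
      have e': "e' > 0" using e c by (simp add: e'_def)
      have "\<exists>Q. compact Q \<and> Q \<subseteq> Zi i \<and> emeasure lborel (Zi i) \<le> emeasure lborel Q + ennreal e'" for i
      proof -
        have "Zi i \<in> sets lebesgue" using Zi_m[of i] by simp
        then obtain Q where Q: "closed Q" "Q \<subseteq> Zi i" "Zi i - Q \<in> lmeasurable" "emeasure lebesgue (Zi i - Q) < ennreal e'"
          using e' by (rule sets_lebesgue_inner_closed)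
        have "Q \<subseteq> X" using Q(2) Zi_Z[of i] by (auto simp: Z_def)
        then have cQ: "compact Q" using Q(1) X(2) bounded_subset compact_eq_bounded_closed by blast
        have sQ: "Q \<in> sets lborel" "Zi i - Q \<in> sets lborel" using cQ Zi_m[of i] by (auto simp: borel_compact)
        have "emeasure lborel (Zi i) \<le> emeasure lborel Q + emeasure lborel (Zi i - Q)"
          using emeasure_subadditive[OF sQ] Q(2) by (simp add: Un_absorb1)
        also have "\<dots> \<le> emeasure lborel Q + ennreal e'"
          using Q(4) sQ(2) by (intro add_left_mono) simp
        finally show ?thesis using cQ Q(2) by blast
      qed
      then obtain Q where Q: "\<And>i. compact (Q i)" "\<And>i. Q i \<subseteq> Zi i"
        "\<And>i. emeasure lborel (Zi i) \<le> emeasure lborel (Q i) + ennreal e'" by metis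
      have QW: "Q i \<subseteq> ball (x i) (d (x i))" for i using Q(2) Zi_W unfolding W_def by blast
      have "(\<Sum>i<N. ennreal ?c * emeasure lborel (Zi i)) \<le> (\<Sum>i<N. ennreal ?c * emeasure lborel (Q i) + ennreal (?c * e'))"
      proof (rule sum_mono)
        fix i
        have "ennreal ?c * emeasure lborel (Zi i) \<le> ennreal ?c * (emeasure lborel (Q i) + ennreal e')"
          using Q(3) by (rule mult_left_mono) simp
        then show "ennreal ?c * emeasure lborel (Zi i) \<le> ennreal ?c * emeasure lborel (Q i) + ennreal (?c * e')"
          using c e' by (simp add: distrib_left ennreal_mult)
      qed
      also have "\<dots> = (\<Sum>i<N. ennreal ?c * emeasure lborel (Q i)) + ennreal (real N * (?c * e'))"
        using c e' by (simp add: sum.distrib ennreal_mult ennreal_of_nat_eq_real_of_nat)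
      also have "\<dots> \<le> (\<Sum>i<N. ennreal ?c * emeasure lborel (Q i)) + ennreal e"
      proof (intro add_left_mono ennreal_leI)
        have "real N * (?c * e') = real N * e / (real N + 1)" using k t by (simp add: e'_def)
        also have "\<dots> \<le> e" using e by (simp add: field_simps)
        finally show "real N * (?c * e') \<le> e" .
      qed
      also have "(\<Sum>i<N. ennreal ?c * emeasure lborel (Q i))
          \<le> (\<Sum>i<N. \<integral>\<^sup>+y. emeasure lborel (P (x i) ` {x\<in>Q i. B x = y}) \<partial>lborel)"
        by (intro sum_mono Pe xX Q QW)
      also have "\<dots> = (\<integral>\<^sup>+y. (\<Sum>i<N. emeasure lborel (P (x i) ` {x\<in>Q i. B x = y})) \<partial>lborel)"
        by (intro nn_integral_sum[symmetric] Pm xX Q QW)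
      also have "\<dots> \<le> (\<integral>\<^sup>+y. ennreal M * indicator E y \<partial>lborel)"
      proof (rule nn_integral_mono)
        fix y
        have QZ: "Q i \<subseteq> Z" for i using Q(2) Zi_Z by blast
        show "(\<Sum>i<N. emeasure lborel (P (x i) ` {x\<in>Q i. B x = y})) \<le> ennreal M * indicator E y"
        \<comment> \<open>If all fibres over \<open>y\<close> are empty the sum vanishes; so the
          bound \<open>M\<close> is invoked only for values \<open>y\<close> of \<open>B\<close>
          that lie in \<open>E\<close>.\<close>
        proof (cases "\<exists>i. {x\<in>Q i. B x = y} \<noteq> {}")
          case False
          then have "{x\<in>Q i. B x = y} = {}" for i by blast
          then show ?thesis by (simp only: image_empty emeasure_empty sum.neutral_const zero_le)
        next
          case True
          then have yE: "y \<in> E" "y \<in> B ` X" using QZ by (auto simp: Z_def)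
          have "compact {x\<in>Q i. B x = y}" for i
          proof -
            have "continuous_on (Q i) B" using cB QZ[of i] by (rule continuous_on_subset[OF _ order_trans]) (auto simp: Z_def)
            then have "closed {x\<in>Q i. B x = y}"
              using continuous_closed_preimage_constant compact_imp_closed[OF Q(1)] by blast
            moreover have "Q i \<inter> {x\<in>Q i. B x = y} = {x\<in>Q i. B x = y}" by blast
            ultimately show ?thesis using compact_Int_closed[OF Q(1)[of i], of "{x\<in>Q i. B x = y}"] by (simp only:)
          qed
          then have "(\<Sum>i<N. emeasure lborel (P (x i) ` {x\<in>Q i. B x = y}))
              \<le> hausdorff_measure (DIM(real ^ ('m, 'n) codim)) {x\<in>X. B x = y}"
          proof (intro hausdorff_measure_ge_sum)
            show "disjoint_family_on (\<lambda>i. {x \<in> Q i. B x = y}) {..<N}"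
              using Zi_disj Q(2) unfolding disjoint_family_on_def by blast
            show "(\<Union>i\<in>{..<N}. {x \<in> Q i. B x = y}) \<subseteq> {x \<in> X. B x = y}"
              using QZ by (auto simp: Z_def)
          qed (use P xX in auto)
          also have "DIM(real ^ ('m, 'n) codim) = CARD('m) - CARD('n)"
            using card by (simp add: CARD_codim)
          also have "hausdorff_measure (CARD('m) - CARD('n)) {x\<in>X. B x = y} \<le> ennreal M"
            by (rule M[OF yE(2)])
          finally show ?thesis using yE by simp
        qed
      qed
      also have "\<dots> = ennreal M * emeasure lborel E"
        using E by (simp add: nn_integral_cmult)
      finally show "(\<Sum>i<N. ennreal ?c * emeasure lborel (Zi i)) \<le> ennreal M * emeasure lborel E + ennreal e"
        by (simp add: add_right_mono)
    qed
    have "ennreal ?c * emeasure lborel Z = (\<Sum>i. ennreal ?c * emeasure lborel (Zi i))"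
      using suminf_emeasure[of Zi lborel] Zi_m Zi_disj ZiU by (simp add: image_subset_iff)
    also have "\<dots> \<le> ennreal M * emeasure lborel E"
      unfolding suminf_eq_SUP using fin by (intro SUP_least)
    finally show ?thesis .
  qed
  \<comment> \<open>The shift by two keeps \<open>t = 1 / (n + 2)\<close> strictly between zero and
    one; since \<open>Z\<close> has finite measure, the limit passes through the product.\<close>
  have "(\<lambda>n. emeasure lborel Z * ennreal (k * (1 - 1 / real (n + 2)) ^ CARD('m)))
      \<longlonglongrightarrow> emeasure lborel Z * ennreal (k * (1 - 0) ^ CARD('m))"
  proof (intro ennreal_tendsto_cmult tendsto_ennrealI tendsto_intros)
    show "(\<lambda>n. 1 / real (n + 2)) \<longlonglongrightarrow> 0"
      using LIMSEQ_ignore_initial_segment[OF lim_1_over_n, of 2] by simp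
  qed (use Zfin in simp)
  then have "emeasure lborel Z * ennreal (k * (1 - 0) ^ CARD('m)) \<le> ennreal M * emeasure lborel E"
  proof (rule LIMSEQ_le_const2, intro exI[of _ 0] allI impI)
    fix n :: nat
    show "emeasure lborel Z * ennreal (k * (1 - 1 / real (n + 2)) ^ CARD('m)) \<le> ennreal M * emeasure lborel E"
      using key[of "1 / real (n + 2)"] by (simp add: mult.commute)
  qed
  then show ?thesis by (simp add: Z_def mult.commute)
qed simp

section \<open>Strict differentiability up to the boundary\<close>

text \<open>The mean value inequality for \<open>f - A\<close> holds on the convex set and passes to
  its closure by continuity, so no derivative at a boundary point is ever formed.\<close>

lemma near_linear_closure:
  fixes f :: "'a::real_normed_vector \<Rightarrow> 'b::real_normed_vector" and A :: "'a \<Rightarrow>\<^sub>L 'b"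
  assumes T: "convex T" and cont: "continuous_on (closure T) f"
    and der: "\<And>x. x \<in> T \<Longrightarrow> (f has_derivative blinfun_apply (f' x)) (at x)"
    and near: "\<And>x. x \<in> T \<Longrightarrow> norm (f' x - A) \<le> e"
    and pq: "p \<in> closure T" "q \<in> closure T"
  shows "norm (f p - f q - A (p - q)) \<le> e * norm (p - q)"
proof -
  define h where "h x = f x - A x" for x
  have inner: "norm (h x - h y) \<le> e * norm (x - y)" if "x \<in> T" "y \<in> T" for x y
  proof (rule differentiable_bound[OF T _ _ that])
    fix z assume z: "z \<in> T"
    show "(h has_derivative blinfun_apply (f' z - A)) (at z within T)"
      unfolding h_def using has_derivative_at_withinI[OF der[OF z]]
      by (auto intro!: derivative_eq_intros simp: blinfun.diff_left)
    show "onorm (blinfun_apply (f' z - A)) \<le> e"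
      using near[OF z] by (simp add: norm_blinfun.rep_eq)
  qed
  have "norm (h (fst pq) - h (snd pq)) - e * norm (fst pq - snd pq) \<le> 0"
    if "pq \<in> closure (T \<times> T)" for pq
  proof (rule continuous_le_on_closure[OF _ that])
    have "continuous_on (closure T) h" unfolding h_def by (intro continuous_intros cont)
    then have "continuous_on (closure (T \<times> T)) (\<lambda>z. h (fst z))" "continuous_on (closure (T \<times> T)) (\<lambda>z. h (snd z))"
      unfolding closure_Times
      by (auto intro!: continuous_on_compose2[of "closure T" h] continuous_intros)
    then show "continuous_on (closure (T \<times> T)) (\<lambda>pq. norm (h (fst pq) - h (snd pq)) - e * norm (fst pq - snd pq))"
      by (intro continuous_intros)
    show "norm (h (fst z) - h (snd z)) - e * norm (fst z - snd z) \<le> 0" if "z \<in> T \<times> T" for z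
      using inner[of "fst z" "snd z"] that by auto
  qed
  from this[of "(p, q)"] pq have "norm (h p - h q) \<le> e * norm (p - q)" by (simp add: closure_Times)
  then show ?thesis by (simp add: h_def blinfun.diff_right algebra_simps)
qed

text \<open>Strict differentiability, uniform in the base point, tested only on pairs of points of \<open>K\<close>;
  on the closure of a convex domain this is what \<open>C\<^sup>1\<close> up to the boundary amounts to.\<close>

definition usd :: "('a::real_normed_vector \<Rightarrow> 'b::real_normed_vector) \<Rightarrow> ('a \<Rightarrow> 'a \<Rightarrow> 'b) \<Rightarrow> 'a set \<Rightarrow> bool" where
  "usd f D K \<longleftrightarrow> (\<forall>p\<in>K. bounded_linear (D p)) \<and>
     (\<forall>e>0. \<exists>d>0. \<forall>p0\<in>K. \<forall>p\<in>K \<inter> ball p0 d. \<forall>q\<in>K \<inter> ball p0 d.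
        norm (f p - f q - D p0 (p - q)) \<le> e * norm (p - q))"

lemma usdD:
  assumes "usd f D K" "e > 0"
  obtains d where "d > 0" "\<And>p0 p q. p0 \<in> K \<Longrightarrow> p \<in> K \<Longrightarrow> q \<in> K \<Longrightarrow> dist p0 p < d \<Longrightarrow> dist p0 q < d \<Longrightarrow>
        norm (f p - f q - D p0 (p - q)) \<le> e * norm (p - q)"
  using assms unfolding usd_def by auto

lemma usd_bounded_linear: "usd f D K \<Longrightarrow> p \<in> K \<Longrightarrow> bounded_linear (D p)"
  by (simp add: usd_def)

lemma usdI:
  assumes "\<And>p. p \<in> K \<Longrightarrow> bounded_linear (D p)"
    "\<And>e. e > 0 \<Longrightarrow> \<exists>d>0. \<forall>p0\<in>K. \<forall>p\<in>K. \<forall>q\<in>K. dist p0 p < d \<longrightarrow> dist p0 q < d \<longrightarrow>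
        norm (f p - f q - D p0 (p - q)) \<le> e * norm (p - q)"
  shows "usd f D K"
  unfolding usd_def using assms by (fastforce simp: Ball_def)

lemma usd_has_derivative:
  assumes u: "usd f D K" and p: "p \<in> K"
  shows "(f has_derivative D p) (at p within K)"
  unfolding has_derivative_within_alt
proof (intro conjI allI impI usd_bounded_linear[OF u p])
  fix e :: real assume "e > 0"
  from usdD[OF u this] obtain d where d: "d > 0" "\<And>p0 p q. p0 \<in> K \<Longrightarrow> p \<in> K \<Longrightarrow> q \<in> K \<Longrightarrow> dist p0 p < d \<Longrightarrow> dist p0 q < d \<Longrightarrow>
        norm (f p - f q - D p0 (p - q)) \<le> e * norm (p - q)" by blast
  show "\<exists>d>0. \<forall>y\<in>K. norm (y - p) < d \<longrightarrow> norm (f y - f p - D p (y - p)) \<le> e * norm (y - p)"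
    using d p by (intro exI[of _ d]) (auto simp: dist_norm norm_minus_commute)
qed

lemma usd_continuous_on: "usd f D K \<Longrightarrow> continuous_on K f"
  using usd_has_derivative has_derivative_continuous_on by blast

lemma usd_bounded_linear_compose:
  assumes G: "bounded_linear G" and u: "usd f D K"
  shows "usd (\<lambda>p. G (f p)) (\<lambda>p v. G (D p v)) K"
proof (rule usdI)
  show "bounded_linear (\<lambda>v. G (D p v))" if "p \<in> K" for p
    using bounded_linear_compose[OF G usd_bounded_linear[OF u that]] .
  fix e :: real assume e: "e > 0"
  obtain C where C: "C > 0" "\<And>x. norm (G x) \<le> norm x * C" using bounded_linear.pos_bounded[OF G] by blast
  have "e / C > 0" using e C by simp
  from usdD[OF u this] obtain d where d: "d > 0" "\<And>p0 p q. p0 \<in> K \<Longrightarrow> p \<in> K \<Longrightarrow> q \<in> K \<Longrightarrow> dist p0 p < d \<Longrightarrow> dist p0 q < d \<Longrightarrow>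
        norm (f p - f q - D p0 (p - q)) \<le> e / C * norm (p - q)" by blast
  have "norm (G (f p) - G (f q) - G (D p0 (p - q))) \<le> e * norm (p - q)"
    if "p0 \<in> K" "p \<in> K" "q \<in> K" "dist p0 p < d" "dist p0 q < d" for p0 p q
  proof -
    have "G (f p) - G (f q) - G (D p0 (p - q)) = G (f p - f q - D p0 (p - q))"
      using G by (simp add: linear_simps)
    also have "norm \<dots> \<le> norm (f p - f q - D p0 (p - q)) * C" by (rule C)
    also have "\<dots> \<le> e / C * norm (p - q) * C" using C d(2)[OF that] by (intro mult_right_mono) auto
    finally show ?thesis using C by simp
  qed
  then show "\<exists>d>0. \<forall>p0\<in>K. \<forall>p\<in>K. \<forall>q\<in>K. dist p0 p < d \<longrightarrow> dist p0 q < d \<longrightarrow>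
        norm (G (f p) - G (f q) - G (D p0 (p - q))) \<le> e * norm (p - q)"
    using d(1) by blast
qed

lemma usd_add:
  assumes u: "usd f D K" and u': "usd f' D' K"
  shows "usd (\<lambda>p. f p + f' p) (\<lambda>p v. D p v + D' p v) K"
proof (rule usdI)
  show "bounded_linear (\<lambda>v. D p v + D' p v)" if "p \<in> K" for p
    using usd_bounded_linear[OF u that] usd_bounded_linear[OF u' that] by (rule bounded_linear_add)
  fix e :: real assume e: "e > 0"
  then have e2: "e / 2 > 0" by simp
  from usdD[OF u this] obtain d where d: "d > 0" "\<And>p0 p q. p0 \<in> K \<Longrightarrow> p \<in> K \<Longrightarrow> q \<in> K \<Longrightarrow> dist p0 p < d \<Longrightarrow> dist p0 q < d \<Longrightarrow>
        norm (f p - f q - D p0 (p - q)) \<le> e / 2 * norm (p - q)" by blast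
  from usdD[OF u' e2] obtain d' where d': "d' > 0" "\<And>p0 p q. p0 \<in> K \<Longrightarrow> p \<in> K \<Longrightarrow> q \<in> K \<Longrightarrow> dist p0 p < d' \<Longrightarrow> dist p0 q < d' \<Longrightarrow>
        norm (f' p - f' q - D' p0 (p - q)) \<le> e / 2 * norm (p - q)" by blast
  have "norm (f p + f' p - (f q + f' q) - (D p0 (p - q) + D' p0 (p - q))) \<le> e * norm (p - q)"
    if "p0 \<in> K" "p \<in> K" "q \<in> K" "dist p0 p < min d d'" "dist p0 q < min d d'" for p0 p q
  proof -
    have "f p + f' p - (f q + f' q) - (D p0 (p - q) + D' p0 (p - q))
      = (f p - f q - D p0 (p - q)) + (f' p - f' q - D' p0 (p - q))" by simp
    also have "norm \<dots> \<le> e / 2 * norm (p - q) + e / 2 * norm (p - q)"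
      using that by (intro norm_triangle_mono d(2) d'(2)) auto
    finally show ?thesis by simp
  qed
  then show "\<exists>d>0. \<forall>p0\<in>K. \<forall>p\<in>K. \<forall>q\<in>K. dist p0 p < d \<longrightarrow> dist p0 q < d \<longrightarrow>
        norm (f p + f' p - (f q + f' q) - (D p0 (p - q) + D' p0 (p - q))) \<le> e * norm (p - q)"
    using d(1) d'(1) by (intro exI[of _ "min d d'"]) auto
qed

text \<open>Uniform continuity of \<open>f'\<close> on the compact closure gives one radius for all
  base points. A ball of that radius cut with \<open>S\<close> is convex, and \<open>f'\<close> is
  nearly constant on it.\<close>

lemma C1_closure_usd:
  fixes f :: "'a::euclidean_space \<Rightarrow> 'b::real_normed_vector" and f' :: "'a \<Rightarrow> 'a \<Rightarrow>\<^sub>L 'b"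
  assumes S: "open S" "convex S" "bounded S"
    and cont: "continuous_on (closure S) f" "continuous_on (closure S) f'"
    and der: "\<And>x. x \<in> S \<Longrightarrow> (f has_derivative blinfun_apply (f' x)) (at x)"
  shows "usd f (\<lambda>p. blinfun_apply (f' p)) (closure S)"
proof (rule usdI)
  show "bounded_linear (blinfun_apply (f' p))" for p by (rule blinfun.bounded_linear_right)
  fix e :: real assume e: "e > 0"
  have "uniformly_continuous_on (closure S) f'"
    using cont(2) S(3) by (intro compact_uniformly_continuous) auto
  then obtain d where d: "d > 0" "\<And>p p0. p \<in> closure S \<Longrightarrow> p0 \<in> closure S \<Longrightarrow> dist p p0 < d \<Longrightarrow> dist (f' p) (f' p0) < e"
    using e unfolding uniformly_continuous_on_def by metis
  have "norm (f p - f q - f' p0 (p - q)) \<le> e * norm (p - q)"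
    if "p0 \<in> closure S" "p \<in> closure S" "q \<in> closure S" "dist p0 p < d" "dist p0 q < d" for p0 p q
  proof (rule near_linear_closure)
    show "convex (ball p0 d \<inter> S)" using S(2) by (intro convex_Int convex_ball)
    have sub: "closure (ball p0 d \<inter> S) \<subseteq> closure S" by (intro closure_mono) auto
    show "continuous_on (closure (ball p0 d \<inter> S)) f" using cont(1) sub by (rule continuous_on_subset)
    show "(f has_derivative blinfun_apply (f' x)) (at x)" if "x \<in> ball p0 d \<inter> S" for x
      using der that by blast
    show "norm (f' x - f' p0) \<le> e" if "x \<in> ball p0 d \<inter> S" for x
      using d(2)[of x p0] that \<open>p0 \<in> closure S\<close> closure_subset by (fastforce simp: dist_norm norm_minus_commute)
    have "ball p0 d \<inter> closure S \<subseteq> closure (ball p0 d \<inter> S)" by (rule open_Int_closure_subset) simp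
    then show "p \<in> closure (ball p0 d \<inter> S)" "q \<in> closure (ball p0 d \<inter> S)" using that by auto
  qed
  then show "\<exists>d>0. \<forall>p0\<in>closure S. \<forall>p\<in>closure S. \<forall>q\<in>closure S. dist p0 p < d \<longrightarrow> dist p0 q < d \<longrightarrow>
        norm (f p - f q - f' p0 (p - q)) \<le> e * norm (p - q)"
    using d(1) by blast
qed

text \<open>Differentiation under the integral sign. The radius in \<open>usd\<close> serves all
  base points, hence all \<open>z\<close>, so the pointwise error bound can simply be
  integrated.\<close>

lemma usd_integral:
  fixes h :: "'a::euclidean_space \<Rightarrow> 'b::euclidean_space \<Rightarrow> 'c::euclidean_space"
  assumes u: "usd (\<lambda>p. h (fst p) (snd p)) D (K \<times> L)"
    and L: "compact L" and \<nu>: "prob_space \<nu>" "sets \<nu> = sets (restrict_space borel L)"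
    and ch: "\<And>y. y \<in> K \<Longrightarrow> continuous_on L (h y)"
    and cD: "\<And>y v. y \<in> K \<Longrightarrow> continuous_on L (\<lambda>z. D (y, z) (v, 0))"
  shows "usd (\<lambda>y. \<integral>z. h y z \<partial>\<nu>) (\<lambda>y v. \<integral>z. D (y, z) (v, 0) \<partial>\<nu>) K"
proof -
  interpret prob_space \<nu> by fact
  have sp: "space \<nu> = L" using sets_eq_imp_space_eq[OF \<nu>(2)] by (simp add: space_restrict_space)
  have int: "integrable \<nu> g" if "continuous_on L g" for g :: "'b \<Rightarrow> 'c"
  proof -
    have "bounded (g ` L)" using that L by (intro compact_imp_bounded compact_continuous_image)
    then obtain B where "\<And>z. z \<in> L \<Longrightarrow> norm (g z) \<le> B" by (auto simp: bounded_iff)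
    moreover have "g \<in> borel_measurable \<nu>"
      using borel_measurable_continuous_on_restrict[OF that] measurable_cong_sets[OF \<nu>(2) refl] by blast
    ultimately show ?thesis by (intro integrable_const_bound[of _ B]) (auto simp: sp)
  qed
  have nonempty: "L \<noteq> {}" using not_empty sp by simp
  show ?thesis
  proof (rule usdI)
    fix y assume y: "y \<in> K"
    have bl: "bounded_linear (D (y, z))" if "z \<in> L" for z
      using usd_bounded_linear[OF u, of "(y, z)"] y that by simp
    have "linear (\<lambda>v. \<integral>z. D (y, z) (v, 0) \<partial>\<nu>)"
    proof (rule linearI)
      fix v w :: 'a and r :: real
      have "(\<integral>z. D (y, z) (v + w, 0) \<partial>\<nu>) = (\<integral>z. D (y, z) (v, 0) + D (y, z) (w, 0) \<partial>\<nu>)"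
      proof (rule Bochner_Integration.integral_cong)
        fix z assume "z \<in> space \<nu>"
        then have "linear (D (y, z))" using bl sp by (simp add: bounded_linear.linear)
        then have "D (y, z) ((v, 0) + (w, 0)) = D (y, z) (v, 0) + D (y, z) (w, 0)" by (rule linear_add)
        then show "D (y, z) (v + w, 0) = D (y, z) (v, 0) + D (y, z) (w, 0)" by simp
      qed simp
      also have "\<dots> = (\<integral>z. D (y, z) (v, 0) \<partial>\<nu>) + (\<integral>z. D (y, z) (w, 0) \<partial>\<nu>)"
        by (intro Bochner_Integration.integral_add int cD y)
      finally show "(\<integral>z. D (y, z) (v + w, 0) \<partial>\<nu>) = (\<integral>z. D (y, z) (v, 0) \<partial>\<nu>) + (\<integral>z. D (y, z) (w, 0) \<partial>\<nu>)" .
      have "(\<integral>z. D (y, z) (r *\<^sub>R v, 0) \<partial>\<nu>) = (\<integral>z. r *\<^sub>R D (y, z) (v, 0) \<partial>\<nu>)"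
      proof (rule Bochner_Integration.integral_cong)
        fix z assume "z \<in> space \<nu>"
        then have "linear (D (y, z))" using bl sp by (simp add: bounded_linear.linear)
        then have "D (y, z) (r *\<^sub>R (v, 0)) = r *\<^sub>R D (y, z) (v, 0)" by (rule linear_scale)
        then show "D (y, z) (r *\<^sub>R v, 0) = r *\<^sub>R D (y, z) (v, 0)" by simp
      qed simp
      then show "(\<integral>z. D (y, z) (r *\<^sub>R v, 0) \<partial>\<nu>) = r *\<^sub>R (\<integral>z. D (y, z) (v, 0) \<partial>\<nu>)" by simp
    qed
    then show "bounded_linear (\<lambda>v. \<integral>z. D (y, z) (v, 0) \<partial>\<nu>)" by (simp add: linear_conv_bounded_linear)
  next
    fix e :: real assume e: "e > 0"
    from usdD[OF u e] obtain d where d: "d > 0" "\<And>p0 p q. p0 \<in> K \<times> L \<Longrightarrow> p \<in> K \<times> L \<Longrightarrow> q \<in> K \<times> L \<Longrightarrow>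
        dist p0 p < d \<Longrightarrow> dist p0 q < d \<Longrightarrow>
        norm (h (fst p) (snd p) - h (fst q) (snd q) - D p0 (p - q)) \<le> e * norm (p - q)" by blast
    have "norm ((\<integral>z. h p z \<partial>\<nu>) - (\<integral>z. h q z \<partial>\<nu>) - (\<integral>z. D (p0, z) (p - q, 0) \<partial>\<nu>)) \<le> e * norm (p - q)"
      if p: "p0 \<in> K" "p \<in> K" "q \<in> K" "dist p0 p < d" "dist p0 q < d" for p0 p q
    proof -
      have "(\<integral>z. h p z \<partial>\<nu>) - (\<integral>z. h q z \<partial>\<nu>) - (\<integral>z. D (p0, z) (p - q, 0) \<partial>\<nu>)
        = (\<integral>z. h p z - h q z - D (p0, z) (p - q, 0) \<partial>\<nu>)"
        using int[OF ch[OF p(2)]] int[OF ch[OF p(3)]] int[OF cD[OF p(1)]] by simp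
      also have "norm \<dots> \<le> (\<integral>z. e * norm (p - q) \<partial>\<nu>)"
      proof (rule Bochner_Integration.integral_norm_bound_integral)
        show "integrable \<nu> (\<lambda>z. h p z - h q z - D (p0, z) (p - q, 0))"
          using int[OF ch[OF p(2)]] int[OF ch[OF p(3)]] int[OF cD[OF p(1)]] by simp
        fix z assume "z \<in> space \<nu>"
        then show "norm (h p z - h q z - D (p0, z) (p - q, 0)) \<le> e * norm (p - q)"
          using d(2)[of "(p0, z)" "(p, z)" "(q, z)"] p by (simp add: sp dist_Pair_Pair norm_Pair)
      qed simp
      also have "\<dots> = e * norm (p - q)" by (simp add: prob_space)
      finally show ?thesis .
    qed
    then show "\<exists>d>0. \<forall>p0\<in>K. \<forall>p\<in>K. \<forall>q\<in>K. dist p0 p < d \<longrightarrow> dist p0 q < d \<longrightarrow>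
        norm ((\<integral>z. h p z \<partial>\<nu>) - (\<integral>z. h q z \<partial>\<nu>) - (\<integral>z. D (p0, z) (p - q, 0) \<partial>\<nu>)) \<le> e * norm (p - q)"
      using d(1) by blast
  qed
qed

text \<open>Two derivatives within the closure differ by a linear map that vanishes on
  \<open>w - y\<close> for every \<open>w\<close> in \<open>Y\<close>, since the segment from
  \<open>y\<close> to \<open>w\<close> stays in the closure. The set of these directions contains a
  ball, hence spans the space.\<close>

lemma frechet_derivative_closure_convex:
  fixes f :: "'a::euclidean_space \<Rightarrow> 'b::real_normed_vector"
  assumes Y: "open Y" "convex Y" "Y \<noteq> {}" and y: "y \<in> closure Y"
    and D: "(f has_derivative D) (at y within closure Y)"
  shows "frechet_derivative f (at y within closure Y) = D"
proof -
  let ?D' = "frechet_derivative f (at y within closure Y)"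
  have D': "(f has_derivative ?D') (at y within closure Y)"
    using D by (metis differentiableI frechet_derivative_works)
  define E where "E v = ?D' v - D v" for v
  have "linear D" "linear ?D'" using D D' by (auto simp: has_derivative_linear)
  then have linE: "linear E" unfolding E_def by (rule linear_compose_sub[rotated])
  have "((\<lambda>x. f x - f x) has_derivative E) (at y within closure Y)"
    unfolding E_def using D' D by (rule has_derivative_diff)
  then have z: "((\<lambda>x. 0) has_derivative E) (at y within closure Y)" by simp
  have E0: "E (w - y) = 0" if w: "w \<in> Y" for w
  proof -
    have "norm (E (w - y)) \<le> e * norm (w - y)" if e: "e > 0" for e
    proof -
      obtain d where d: "d > 0" "\<And>x. x \<in> closure Y \<Longrightarrow> norm (x - y) < d \<Longrightarrow> norm (E (x - y)) \<le> e * norm (x - y)"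
        using z e unfolding has_derivative_within_alt by fastforce
      obtain t where t: "0 < t" "t \<le> 1" "t * norm (w - y) < d"
      proof (cases "norm (w - y) < d")
        case True then show ?thesis using that[of 1] by simp
      next
        case False
        with d(1) have n: "0 < norm (w - y)" by linarith
        show ?thesis
        proof (rule that)
          show "0 < d / (2 * norm (w - y))" using n d(1) by (rule_tac divide_pos_pos) auto
          have "d \<le> 2 * norm (w - y)" using n False by linarith
          then show "d / (2 * norm (w - y)) \<le> 1" using n by (intro divide_le_eq_1_pos[THEN iffD2]) auto
          show "d / (2 * norm (w - y)) * norm (w - y) < d" using n d(1) by (simp del: zero_less_norm_iff)
        qed
      qed
      have "y + t *\<^sub>R (w - y) \<in> closure Y"
      proof -
        have "(1 - t) *\<^sub>R y + t *\<^sub>R w \<in> closure Y"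
          using convexD[OF convex_closure[OF Y(2)] y, of w "1 - t" t] w t closure_subset by auto
        then show ?thesis by (simp add: algebra_simps)
      qed
      from d(2)[OF this] t have "norm (E (t *\<^sub>R (w - y))) \<le> e * norm (t *\<^sub>R (w - y))" by simp
      then have "t * norm (E (w - y)) \<le> t * (e * norm (w - y))"
        using t linear_scale[OF linE] by (simp add: mult_ac)
      then show ?thesis using t by simp
    qed
    then have "norm (E (w - y)) \<le> 0 + e" if "e > 0" for e
      using that by (cases "norm (w - y) = 0") (force dest: spec[of _ "e / norm (w - y)"])+
    then have "norm (E (w - y)) \<le> 0" by (rule field_le_epsilon)
    then show ?thesis by simp
  qed
  obtain w r where w: "r > 0" "ball w r \<subseteq> Y" using Y by (metis ex_in_conv open_contains_ball)
  have "E v = 0" for v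
  proof (cases "v = 0")
    case True then show ?thesis using linear_0[OF linE] by simp
  next
    case False
    define s where "s = r / (2 * norm v)"
    have s: "s > 0" "w + s *\<^sub>R v \<in> Y" "w \<in> Y"
      using w False by (auto simp: s_def dist_norm intro!: subsetD[OF w(2)])
    have "E (w + s *\<^sub>R v - y) - E (w - y) = E (s *\<^sub>R v)"
      by (simp flip: linear_diff[OF linE])
    then have "s *\<^sub>R E v = 0" using E0 s linear_scale[OF linE] by simp
    then show ?thesis using s by simp
  qed
  then show ?thesis by (auto simp: E_def fun_eq_iff)
qed

text \<open>A minimiser of \<open>h\<close> over the compact closure satisfies the variational
  inequality \<open>0 \<le> g y \<bullet> (w - y)\<close>. At a frontier point with nonzero
  \<open>g y\<close> this makes the normalised \<open>- g y\<close> an outward normal, for which the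
  boundary condition fails.\<close>

lemma exists_critical_point:
  fixes h :: "'a::euclidean_space \<Rightarrow> real"
  assumes Y: "open Y" "convex Y" "Y \<noteq> {}" "bounded Y"
    and der: "\<And>y. y \<in> closure Y \<Longrightarrow> (h has_derivative (\<lambda>v. g y \<bullet> v)) (at y within closure Y)"
    and bdry: "\<And>y n. y \<in> frontier Y \<Longrightarrow> n \<in> outward_unit_normals Y y \<Longrightarrow> g y \<bullet> n \<ge> 0"
  obtains y where "y \<in> closure Y" "g y = 0"
proof -
  have "continuous_on (closure Y) h" by (rule has_derivative_continuous_on[OF der])
  then have "\<exists>y\<in>closure Y. \<forall>z\<in>closure Y. h y \<le> h z"
    using Y(3,4) by (intro continuous_attains_inf) auto
  then obtain y where y: "y \<in> closure Y" "\<And>z. z \<in> closure Y \<Longrightarrow> h y \<le> h z"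
    by blast
  have dir: "g y \<bullet> (w - y) \<ge> 0" if w: "w \<in> closure Y" for w
  proof (rule ccontr)
    assume neg: "\<not> g y \<bullet> (w - y) \<ge> 0"
    then have wy: "w \<noteq> y" by auto
    \<comment> \<open>Half the rate of descent along \<open>w - y\<close>, so the error term can eat
      at most half of the decrease.\<close>
    define e where "e = - (g y \<bullet> (w - y)) / (2 * norm (w - y))"
    have e: "e > 0" unfolding e_def using neg wy by (intro divide_pos_pos) auto
    obtain d where d: "d > 0" "\<And>x. x \<in> closure Y \<Longrightarrow> norm (x - y) < d \<Longrightarrow>
        norm (h x - h y - g y \<bullet> (x - y)) \<le> e * norm (x - y)"
      using der[OF y(1)] e unfolding has_derivative_within_alt by metis
    define t where "t = min 1 (d / (2 * norm (w - y)))"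
    have t: "0 < t" "t \<le> 1" "t * norm (w - y) < d"
    proof -
      show "0 < t" "t \<le> 1" using d wy by (auto simp: t_def)
      have "t * norm (w - y) \<le> d / (2 * norm (w - y)) * norm (w - y)"
        by (intro mult_right_mono) (auto simp: t_def)
      also have "\<dots> < d" using d wy by simp
      finally show "t * norm (w - y) < d" .
    qed
    have x: "y + t *\<^sub>R (w - y) \<in> closure Y"
    proof -
      have "(1 - t) *\<^sub>R y + t *\<^sub>R w \<in> closure Y"
        using convexD[OF convex_closure[OF Y(2)] y(1) w, of "1 - t" t] t by auto
      then show ?thesis by (simp add: algebra_simps)
    qed
    have "norm (h (y + t *\<^sub>R (w - y)) - h y - g y \<bullet> (t *\<^sub>R (w - y))) \<le> e * norm (t *\<^sub>R (w - y))"
      using d(2)[OF x] t by simp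
    then have "h (y + t *\<^sub>R (w - y)) \<le> h y + t * (g y \<bullet> (w - y)) + e * (t * norm (w - y))"
      using t by (simp add: abs_le_iff)
    also have "e * (t * norm (w - y)) = - t * (g y \<bullet> (w - y)) / 2" using wy by (simp add: e_def)
    finally have "h (y + t *\<^sub>R (w - y)) \<le> h y + t * (g y \<bullet> (w - y)) / 2" by simp
    moreover have "t * (g y \<bullet> (w - y)) < 0" using t neg by (simp add: mult_pos_neg)
    ultimately show False using y(2)[OF x] by simp
  qed
  have "g y = 0"
  proof (cases "y \<in> Y")
    case True
    then obtain r where r: "r > 0" "ball y r \<subseteq> Y" using Y(1) by (metis open_contains_ball)
    show ?thesis
    proof (rule ccontr)
      assume g: "g y \<noteq> 0"
      define s where "s = r / (2 * norm (g y))"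
      have s: "s > 0" using r g by (simp add: s_def)
      have "y - s *\<^sub>R g y \<in> ball y r" using r g by (simp add: s_def dist_norm)
      then have "y - s *\<^sub>R g y \<in> closure Y" using r(2) closure_subset by blast
      from dir[OF this] have "s * (g y \<bullet> g y) \<le> 0" by simp
      then have "g y \<bullet> g y \<le> 0" using s by (simp add: mult_le_0_iff)
      moreover have "g y \<bullet> g y > 0" using g by simp
      ultimately show False by linarith
    qed
  next
    case False
    then have fr: "y \<in> frontier Y" using y(1) Y(1) by (simp add: frontier_def interior_open)
    show ?thesis
    proof (rule ccontr)
      assume g: "g y \<noteq> 0"
      let ?n = "- (1 / norm (g y)) *\<^sub>R g y"
      have "?n \<in> outward_unit_normals Y y"
        unfolding outward_unit_normals_def
      proof (intro CollectI conjI ballI)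
        show "norm ?n = 1" using g by simp
        fix z assume "z \<in> Y"
        then have "0 \<le> g y \<bullet> (z - y)" using dir closure_subset by blast
        then show "?n \<bullet> (z - y) \<le> 0" by simp
      qed
      from bdry[OF fr this] have "norm (g y) \<le> 0" using g by (simp add: dot_square_norm power2_eq_square)
      then show False using g by simp
    qed
  qed
  with y(1) that show thesis by blast
qed

text \<open>Mean value theorem along a segment in \<open>Y\<close>. The resulting inequality
  involves values of \<open>g\<close> only, so it extends to the closure although \<open>H\<close>
  is controlled on \<open>Y\<close> alone.\<close>

lemma strongly_monotone_closure:
  fixes g :: "'a::euclidean_space \<Rightarrow> 'a"
  assumes Y: "convex Y" and cont: "continuous_on (closure Y) g"
    and der: "\<And>y. y \<in> Y \<Longrightarrow> (g has_derivative H y) (at y)"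
    and ge: "\<And>y v. y \<in> Y \<Longrightarrow> a * (v \<bullet> v) \<le> v \<bullet> H y v"
    and yz: "y \<in> closure Y" "z \<in> closure Y"
  shows "a * (norm (y - z))\<^sup>2 \<le> (g y - g z) \<bullet> (y - z)"
proof -
  have inner: "a * (norm (y - z))\<^sup>2 \<le> (g y - g z) \<bullet> (y - z)" if y: "y \<in> Y" and z: "z \<in> Y" for y z
  proof -
    define p where "p t = g (z + t *\<^sub>R (y - z)) \<bullet> (y - z)" for t :: real
    have seg: "z + t *\<^sub>R (y - z) \<in> Y" if "0 \<le> t" "t \<le> 1" for t
      using convexD[OF Y z y, of "1 - t" t] that by (simp add: algebra_simps)
    have "\<exists>t>0. t < 1 \<and> p 1 - p 0 = (1 - 0) * ((y - z) \<bullet> H (z + t *\<^sub>R (y - z)) (y - z))"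
    proof (rule MVT2)
      fix t :: real assume t: "0 \<le> t" "t \<le> 1"
      have "(p has_derivative (\<lambda>s. H (z + t *\<^sub>R (y - z)) (s *\<^sub>R (y - z)) \<bullet> (y - z))) (at t)"
        unfolding p_def
        by (rule has_derivative_inner_left)
          (rule has_derivative_compose[of "\<lambda>t. z + t *\<^sub>R (y - z)", OF _ der[OF seg[OF t]]],
            auto intro!: derivative_eq_intros)
      moreover have "linear (H (z + t *\<^sub>R (y - z)))" using der[OF seg[OF t]] has_derivative_linear by blast
      ultimately show "(p has_real_derivative ((y - z) \<bullet> H (z + t *\<^sub>R (y - z)) (y - z))) (at t)"
        unfolding has_field_derivative_def by (simp add: linear_scale inner_commute mult_commute_abs)
    qed simp
    then obtain t where t: "0 < t" "t < 1" "p 1 - p 0 = (y - z) \<bullet> H (z + t *\<^sub>R (y - z)) (y - z)" by auto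
    have "a * ((y - z) \<bullet> (y - z)) \<le> p 1 - p 0" unfolding t(3) using seg t by (intro ge) auto
    then show ?thesis by (simp add: p_def inner_diff_left power2_norm_eq_inner)
  qed
  have "a * (norm (fst p - snd p))\<^sup>2 - (g (fst p) - g (snd p)) \<bullet> (fst p - snd p) \<le> 0"
    if "p \<in> closure (Y \<times> Y)" for p
  proof (rule continuous_le_on_closure[OF _ that])
    have "continuous_on (closure (Y \<times> Y)) (\<lambda>p. g (fst p))" "continuous_on (closure (Y \<times> Y)) (\<lambda>p. g (snd p))"
      unfolding closure_Times by (auto intro!: continuous_on_compose2[OF cont] continuous_intros)
    then show "continuous_on (closure (Y \<times> Y)) (\<lambda>p. a * (norm (fst p - snd p))\<^sup>2 - (g (fst p) - g (snd p)) \<bullet> (fst p - snd p))"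
      by (intro continuous_intros)
    show "a * (norm (fst p - snd p))\<^sup>2 - (g (fst p) - g (snd p)) \<bullet> (fst p - snd p) \<le> 0" if "p \<in> Y \<times> Y" for p
      using inner[of "fst p" "snd p"] that by auto
  qed
  from this[of "(y, z)"] yz show ?thesis by (simp add: closure_Times)
qed

text \<open>Subtracting the quadratic leaves a function \<open>q\<close> of the segment parameter
  whose derivative is nonnegative, by monotonicity between the current point and the zero
  \<open>b\<close> of \<open>g\<close>.\<close>

lemma strongly_convex_growth:
  fixes h :: "'a::euclidean_space \<Rightarrow> real"
  assumes K: "convex K"
    and der: "\<And>y. y \<in> K \<Longrightarrow> (h has_derivative (\<lambda>v. g y \<bullet> v)) (at y within K)"
    and mono: "\<And>y z. y \<in> K \<Longrightarrow> z \<in> K \<Longrightarrow> a * (norm (y - z))\<^sup>2 \<le> (g y - g z) \<bullet> (y - z)"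
    and b: "b \<in> K" "g b = 0" and y: "y \<in> K"
  shows "h b + a / 2 * (norm (y - b))\<^sup>2 \<le> h y"
proof -
  define q where "q t = h (b + t *\<^sub>R (y - b)) - a / 2 * t\<^sup>2 * (norm (y - b))\<^sup>2" for t :: real
  have seg: "b + t *\<^sub>R (y - b) \<in> K" if "t \<in> {0..1}" for t
    using convexD[OF K b(1) y, of "1 - t" t] that by (simp add: algebra_simps)
  have "\<exists>t\<in>{0<..<1}. q 1 - q 0 = (\<lambda>s. s * (g (b + t *\<^sub>R (y - b)) \<bullet> (y - b) - a * t * (norm (y - b))\<^sup>2)) (1 - 0)"
  proof (rule mvt_simple)
    fix t :: real assume t: "0 \<le> t" "t \<le> 1"
    have d1: "((\<lambda>t. b + t *\<^sub>R (y - b)) has_derivative (\<lambda>s. s *\<^sub>R (y - b))) (at t within {0..1})"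
      by (auto intro!: derivative_eq_intros)
    have "((\<lambda>t. h (b + t *\<^sub>R (y - b))) has_derivative (\<lambda>s. g (b + t *\<^sub>R (y - b)) \<bullet> (s *\<^sub>R (y - b)))) (at t within {0..1})"
      by (rule has_derivative_in_compose2[OF _ _ _ d1, of K h "\<lambda>y v. g y \<bullet> v"]) (use der seg t in auto)
    then show "(q has_derivative (\<lambda>s. s * (g (b + t *\<^sub>R (y - b)) \<bullet> (y - b) - a * t * (norm (y - b))\<^sup>2))) (at t within {0..1})"
      unfolding q_def by (auto intro!: derivative_eq_intros simp: algebra_simps)
  qed simp
  then obtain t where t: "0 < t" "t < 1" "q 1 - q 0 = g (b + t *\<^sub>R (y - b)) \<bullet> (y - b) - a * t * (norm (y - b))\<^sup>2"
    by auto
  have "a * (norm (t *\<^sub>R (y - b)))\<^sup>2 \<le> g (b + t *\<^sub>R (y - b)) \<bullet> (t *\<^sub>R (y - b))"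
    using mono[OF seg b(1), of t] t b(2) by simp
  then have "t * (a * t * (norm (y - b))\<^sup>2) \<le> t * (g (b + t *\<^sub>R (y - b)) \<bullet> (y - b))"
    by (simp add: power_mult_distrib power2_eq_square mult_ac)
  then have "0 \<le> q 1 - q 0" using t by simp
  then show ?thesis by (simp add: q_def)
qed

section \<open>The implicit function theorem and submersions\<close>

text \<open>At a frontier point not every direction \<open>v\<close> leads into
  \<open>closure Y\<close>. So the step along \<open>v\<close> starts from a nearby interior point,
  where there is room for it; strict differentiability at \<open>y0\<close> still controls this pair
  of points.\<close>

lemma coercive_strict_derivative:
  fixes g :: "'a::euclidean_space \<Rightarrow> 'a"
  assumes Y: "open Y" "y0 \<in> closure Y" and H: "linear H"
    and mono: "\<And>y z. y \<in> closure Y \<Longrightarrow> z \<in> closure Y \<Longrightarrow> a * (norm (y - z))\<^sup>2 \<le> (g y - g z) \<bullet> (y - z)"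
    and strict: "\<And>e. e > 0 \<Longrightarrow> \<exists>d>0. \<forall>y\<in>closure Y \<inter> ball y0 d. \<forall>z\<in>closure Y \<inter> ball y0 d.
                   norm (g y - g z - H (y - z)) \<le> e * norm (y - z)"
  shows "a * (norm v)\<^sup>2 \<le> v \<bullet> H v"
proof (cases "v = 0")
  case True then show ?thesis using linear_0[OF H] by simp
next
  case False
  have "a * (norm v)\<^sup>2 \<le> v \<bullet> H v + e" if e: "e > 0" for e
  proof -
    define e' where "e' = e / (norm v)\<^sup>2"
    have "e' > 0" using e False by (simp add: e'_def)
    from strict[OF this] obtain d where d: "d > 0"
      "\<And>y z. y \<in> closure Y \<inter> ball y0 d \<Longrightarrow> z \<in> closure Y \<inter> ball y0 d \<Longrightarrow> norm (g y - g z - H (y - z)) \<le> e' * norm (y - z)"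
      by blast
    have "y0 \<in> closure Y \<inter> ball y0 d" using Y d by simp
    then have "Y \<inter> ball y0 d \<noteq> {}"
      using open_Int_closure_eq_empty[of "ball y0 d" Y] by (auto simp: Int_commute)
    then obtain y where y: "y \<in> Y \<inter> ball y0 d" by blast
    then obtain r where r: "r > 0" "ball y r \<subseteq> Y \<inter> ball y0 d"
      using Y(1) by (metis open_Int open_ball open_contains_ball)
    define t where "t = r / (2 * norm v)"
    have t: "t > 0" using r False by (simp add: t_def)
    define w where "w = y + t *\<^sub>R v"
    have "w \<in> ball y r" using r False by (simp add: w_def t_def dist_norm)
    then have wm: "w \<in> closure Y \<inter> ball y0 d" using r closure_subset by blast
    have ym: "y \<in> closure Y \<inter> ball y0 d" using y closure_subset by blast
    have wy: "w - y = t *\<^sub>R v" by (simp add: w_def)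
    have "a * (norm (t *\<^sub>R v))\<^sup>2 \<le> (g w - g y) \<bullet> (t *\<^sub>R v)"
      using mono[of w y] wm ym unfolding wy by blast
    also have "\<dots> = (g w - g y - H (t *\<^sub>R v)) \<bullet> (t *\<^sub>R v) + H (t *\<^sub>R v) \<bullet> (t *\<^sub>R v)"
      by (simp only: inner_diff_left diff_add_cancel)
    also have "(g w - g y - H (t *\<^sub>R v)) \<bullet> (t *\<^sub>R v) \<le> norm (g w - g y - H (t *\<^sub>R v)) * norm (t *\<^sub>R v)"
      by (rule norm_cauchy_schwarz)
    also have "\<dots> \<le> (e' * norm (t *\<^sub>R v)) * norm (t *\<^sub>R v)"
      using d(2)[OF wm ym] unfolding wy by (rule mult_right_mono) simp
    finally have "t\<^sup>2 * (a * (norm v)\<^sup>2) \<le> t\<^sup>2 * (e' * (norm v)\<^sup>2 + v \<bullet> H v)"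
      using t by (simp add: linear_scale[OF H] power2_eq_square algebra_simps inner_commute)
    then have "a * (norm v)\<^sup>2 \<le> e' * (norm v)\<^sup>2 + v \<bullet> H v" using t by simp
    then show ?thesis using False by (simp add: e'_def)
  qed
  then show ?thesis by (rule field_le_epsilon)
qed

text \<open>\<open>B\<close> is given, and its differentiability is at stake. Monotonicity makes
  \<open>B\<close> Lipschitz with constant \<open>l / a\<close>; then the linearised equation
  \<open>A u + H (L u) = 0\<close> determines \<open>L\<close>. \<open>K\<close> may be any set, so
  values of \<open>B\<close> on a frontier are allowed.\<close>

lemma implicit_strict_derivative:
  fixes G :: "'a::euclidean_space \<Rightarrow> 'b::euclidean_space \<Rightarrow> 'b" and B :: "'a \<Rightarrow> 'b"
  assumes r: "r > 0" "ball x0 r \<subseteq> X" and B: "\<And>x. x \<in> X \<Longrightarrow> B x \<in> K" "\<And>x. x \<in> X \<Longrightarrow> G x (B x) = 0"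
    and a: "a > 0"
    and mono: "\<And>x y z. x \<in> X \<Longrightarrow> y \<in> K \<Longrightarrow> z \<in> K \<Longrightarrow> a * (norm (y - z))\<^sup>2 \<le> (G x y - G x z) \<bullet> (y - z)"
    and lip: "0 \<le> l" "\<And>x x' y. x \<in> ball x0 r \<Longrightarrow> x' \<in> ball x0 r \<Longrightarrow> y \<in> K \<Longrightarrow> norm (G x y - G x' y) \<le> l * norm (x - x')"
    and lin: "linear A" "linear H" and coercive: "\<And>v. a * (norm v)\<^sup>2 \<le> v \<bullet> H v"
    and strict: "\<And>e. e > 0 \<Longrightarrow> \<exists>d>0. \<forall>x\<in>ball x0 d. \<forall>x'\<in>ball x0 d. \<forall>y\<in>K \<inter> ball (B x0) d. \<forall>y'\<in>K \<inter> ball (B x0) d.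
        norm (G x y - G x' y' - (A (x - x') + H (y - y'))) \<le> e * (norm (x - x') + norm (y - y'))"
  obtains L where "linear L" "\<And>e. e > 0 \<Longrightarrow> \<exists>d>0. \<forall>x\<in>ball x0 d. \<forall>y\<in>ball x0 d.
                   norm (B x - B y - L (x - y)) \<le> e * norm (x - y)"
proof -
  have Hb: "a * norm v \<le> norm (H v)" for v
  proof (cases "v = 0")
    case False
    have "norm v * (a * norm v) \<le> v \<bullet> H v" using coercive[of v] by (simp add: power2_eq_square mult_ac)
    also have "\<dots> \<le> norm v * norm (H v)" by (rule norm_cauchy_schwarz)
    finally show ?thesis using False by simp
  qed simp
  have "inj H" unfolding linear_injective_0[OF lin(2)]
  proof (intro allI impI)
    fix v assume "H v = 0"
    then show "v = 0" using Hb[of v] a by (simp add: mult_le_0_iff)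
  qed
  then obtain H' where H': "linear H'" "\<And>v. H' (H v) = v" "\<And>v. H (H' v) = v"
    using linear_injective_isomorphism[OF lin(2)] by blast
  define L where "L u = - H' (A u)" for u
  have "linear (\<lambda>u. H' (A u))" using linear_compose[OF lin(1) H'(1)] by (simp add: o_def)
  then have linL: "linear L" unfolding L_def by (rule linear_compose_neg)
  have Blip: "norm (B x - B x') \<le> l / a * norm (x - x')" if x: "x \<in> ball x0 r" "x' \<in> ball x0 r" for x x'
  proof (cases "B x = B x'")
    case True then show ?thesis using lip(1) a by simp
  next
    case False
    have xX: "x \<in> X" "x' \<in> X" using x r by auto
    have "a * (norm (B x - B x'))\<^sup>2 \<le> (G x (B x) - G x (B x')) \<bullet> (B x - B x')"
      using xX by (intro mono B)
    also have "\<dots> = (G x' (B x') - G x (B x')) \<bullet> (B x - B x')" using xX B by simp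
    also have "\<dots> \<le> norm (G x' (B x') - G x (B x')) * norm (B x - B x')" by (rule norm_cauchy_schwarz)
    also have "\<dots> \<le> (l * norm (x' - x)) * norm (B x - B x')"
      using x xX by (intro mult_right_mono lip B) auto
    finally have "a * norm (B x - B x') \<le> l * norm (x - x')"
      using False by (simp add: power2_eq_square norm_minus_commute)
    then show ?thesis using a by (simp add: field_simps)
  qed
  have "\<exists>d>0. \<forall>x\<in>ball x0 d. \<forall>y\<in>ball x0 d. norm (B x - B y - L (x - y)) \<le> e * norm (x - y)"
    if e: "e > 0" for e
  proof -
    \<comment> \<open>Chosen so that the error in \<open>G\<close>, enlarged by the Lipschitz
      constant \<open>l / a\<close> of \<open>B\<close> and divided by the lower bound
      \<open>a\<close> of \<open>H\<close>, is exactly \<open>e\<close>.\<close>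
    define e' where "e' = e * a / (1 + l / a)"
    have pos: "1 + l / a > 0" using lip(1) a by (simp add: add_pos_nonneg)
    have "e' > 0" using e a pos by (simp add: e'_def)
    from strict[OF this] obtain d where d: "d > 0" and
      near: "\<And>x x' y y'. x \<in> ball x0 d \<Longrightarrow> x' \<in> ball x0 d \<Longrightarrow> y \<in> K \<inter> ball (B x0) d \<Longrightarrow> y' \<in> K \<inter> ball (B x0) d \<Longrightarrow>
        norm (G x y - G x' y' - (A (x - x') + H (y - y'))) \<le> e' * (norm (x - x') + norm (y - y'))"
      by blast
    \<comment> \<open>Small enough that points of this ball are sent by \<open>B\<close> within
      \<open>d\<close> of \<open>B x0\<close>.\<close>
    define d' where "d' = min r (d / (1 + l / a))"
    have d': "d' > 0" using r d pos by (simp add: d'_def)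
    have d'd: "d' \<le> d"
    proof -
      have "d / (1 + l / a) \<le> d / 1" using d lip(1) a pos by (intro divide_left_mono) auto
      then show ?thesis by (simp add: d'_def)
    qed
    have mem: "x \<in> ball x0 r" "x \<in> ball x0 d" "B x \<in> K \<inter> ball (B x0) d" if x: "x \<in> ball x0 d'" for x
    proof -
      show xr: "x \<in> ball x0 r" using x by (simp add: d'_def)
      show "x \<in> ball x0 d" using x d'd by simp
      have "norm (B x0 - B x) \<le> l / a * norm (x0 - x)" using xr r(1) by (intro Blip) auto
      also have "\<dots> \<le> l / a * d'" using x lip(1) a by (intro mult_left_mono) (auto simp: dist_norm)
      also have "\<dots> < (1 + l / a) * d'" using d' by (simp add: algebra_simps)
      also have "\<dots> \<le> (1 + l / a) * (d / (1 + l / a))" using pos by (intro mult_left_mono) (auto simp: d'_def)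
      also have "\<dots> = d" using pos by simp
      finally show "B x \<in> K \<inter> ball (B x0) d" using B(1)[of x] xr r(2) by (auto simp: dist_norm)
    qed
    have "norm (B x - B y - L (x - y)) \<le> e * norm (x - y)" if x: "x \<in> ball x0 d'" "y \<in> ball x0 d'" for x y
    proof -
      have xX: "x \<in> X" "y \<in> X" using mem(1)[OF x(1)] mem(1)[OF x(2)] r by auto
      have "a * norm (B x - B y - L (x - y)) \<le> norm (H (B x - B y - L (x - y)))" by (rule Hb)
      also have "H (B x - B y - L (x - y)) = A (x - y) + H (B x - B y)"
        by (simp add: L_def linear_add[OF lin(2)] H')
      also have "norm \<dots> = norm (G x (B x) - G y (B y) - (A (x - y) + H (B x - B y)))"
        unfolding B(2)[OF xX(1)] B(2)[OF xX(2)] by (simp only: diff_0_right diff_0 norm_minus_cancel)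
      also have "\<dots> \<le> e' * (norm (x - y) + norm (B x - B y))"
        using mem(2,3)[OF x(1)] mem(2,3)[OF x(2)] by (intro near)
      also have "\<dots> \<le> e' * (norm (x - y) + l / a * norm (x - y))"
        using Blip[OF mem(1)[OF x(1)] mem(1)[OF x(2)]] \<open>e' > 0\<close> by (intro mult_left_mono) auto
      also have "\<dots> = e' * (1 + l / a) * norm (x - y)" by (simp add: algebra_simps)
      also have "e' * (1 + l / a) = a * e" using pos by (simp add: e'_def)
      finally have "a * norm (B x - B y - L (x - y)) \<le> a * (e * norm (x - y))" by (simp add: mult.assoc)
      then show ?thesis using a by simp
    qed
    then show ?thesis using d' by blast
  qed
  with linL show thesis by (rule that)
qed

lemma interior_value_of_submersion:
  fixes B :: "real ^ 'm \<Rightarrow> real ^ 'n"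
  assumes X: "open X" "x \<in> X" and Y: "open Y" "convex Y" "Y \<noteq> {}"
    and B: "\<And>x. x \<in> X \<Longrightarrow> B x \<in> closure Y" and D: "(B has_derivative L) (at x)"
    and det: "det (matrix L ** transpose (matrix L)) \<noteq> 0"
  shows "B x \<in> Y"
proof (rule ccontr)
  assume nY: "B x \<notin> Y"
  then obtain a b where ab: "a \<noteq> 0" "\<And>y. y \<in> Y \<Longrightarrow> a \<bullet> y \<le> b" "a \<bullet> B x \<ge> b"
    using separating_hyperplane_sets[of Y "{B x}"] Y by auto
  have cl: "a \<bullet> y \<le> b" if "y \<in> closure Y" for y
    by (rule continuous_le_on_closure[OF _ that]) (auto intro!: continuous_intros ab)
  have "((\<lambda>z. a \<bullet> B z) has_derivative (\<lambda>v. a \<bullet> L v)) (at x)"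
    using D by (rule has_derivative_inner_right)
  moreover have "\<forall>y\<in>X. a \<bullet> B y \<le> a \<bullet> B x"
    using cl B ab(3) by (meson order_trans)
  ultimately have "(\<lambda>v. a \<bullet> L v) = (\<lambda>v. 0)"
    using differential_zero_maxmin[OF X(2,1)] by blast
  moreover have "matrix L *v v = L v" for v using D by (simp add: has_derivative_linear)
  ultimately have aL: "a \<bullet> (matrix L *v v) = 0" for v by (simp add: fun_eq_iff)
  \<comment> \<open>Invertibility of this product puts \<open>a\<close> itself in the range of
    \<open>L\<close>, so \<open>a\<close> would be orthogonal to itself.\<close>
  let ?S = "matrix L ** transpose (matrix L)"
  have "invertible ?S" using det by (simp add: invertible_det_nz)
  then obtain S' where "?S ** S' = mat 1" by (auto simp: invertible_def)
  then have "?S *v (S' *v a) = a" by (simp add: matrix_vector_mul_assoc)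
  then have "matrix L *v (transpose (matrix L) *v (S' *v a)) = a"
    by (simp only: matrix_vector_mul_assoc matrix_mul_assoc)
  with aL[of "transpose (matrix L) *v (S' *v a)"] have "a \<bullet> a = 0" by (simp only:)
  then show False using ab(1) by simp
qed

section \<open>Gradients, Hessians and derivative data of C2 functions\<close>

lemma gradient_closure_convex:
  fixes f :: "real ^ 'n \<Rightarrow> real"
  assumes Y: "open Y" "convex Y" "Y \<noteq> {}" and y: "y \<in> closure Y"
    and D: "(f has_derivative (\<lambda>v. g \<bullet> v)) (at y within closure Y)"
  shows "gradient f (at y within closure Y) = g"
  unfolding gradient_def frechet_derivative_closure_convex[OF Y y D]
  by (simp add: vec_eq_iff inner_axis)

lemma at_within_closure_open:
  fixes Y :: "'a::euclidean_space set"
  assumes "open Y" "y \<in> Y" shows "at y within closure Y = at y"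
proof (rule at_within_interior)
  show "y \<in> interior (closure Y)"
    using interior_maximal[OF closure_subset assms(1)] assms(2) by blast
qed

lemma hessian_of_derivative:
  fixes f :: "real ^ 'n \<Rightarrow> real"
  assumes Y: "open Y" "y \<in> Y"
    and f: "\<And>y. y \<in> Y \<Longrightarrow> (f has_derivative (\<lambda>v. g y \<bullet> v)) (at y)"
    and g: "(g has_derivative H) (at y)"
  shows "hessian f y *v v = H v"
proof -
  have grad: "gradient f (at z) = g z" if "z \<in> Y" for z
    unfolding gradient_def frechet_derivative_at[OF f[OF that], symmetric]
    by (simp add: vec_eq_iff inner_axis)
  have "((\<lambda>y'. gradient f (at y')) has_derivative H) (at y)"
    by (rule has_derivative_transform_within_open[OF g Y]) (simp add: grad)
  then have "frechet_derivative (\<lambda>y'. gradient f (at y')) (at y) = H"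
    by (rule frechet_derivative_at[symmetric])
  then show ?thesis
    using g by (simp add: hessian_def jacobian_def has_derivative_linear)
qed

lemma linear_functional_axis:
  fixes f :: "real ^ 'n \<Rightarrow> real"
  assumes "linear f" shows "f v = (\<chi> i. f (axis i 1)) \<bullet> v"
proof -
  have "f v = f (\<Sum>i\<in>UNIV. v $ i *\<^sub>R axis i 1)"
    using basis_expansion[of v] by (simp add: scalar_mult_eq_scaleR)
  also have "\<dots> = (\<Sum>i\<in>UNIV. v $ i * f (axis i 1))"
    by (simp add: linear_sum[OF assms] linear_scale[OF assms])
  finally show ?thesis by (simp add: inner_vec_def mult.commute)
qed

lemma bounded_linear_coordinates:
  fixes e :: "'n::finite \<Rightarrow> 'p::real_normed_vector"
  shows "bounded_linear (\<lambda>D :: 'p \<Rightarrow>\<^sub>L real. \<chi> i. blinfun_apply D (e i))"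
proof (rule bounded_linear_intro)
  fix D :: "'p \<Rightarrow>\<^sub>L real"
  have "norm (\<chi> i. blinfun_apply D (e i)) \<le> (\<Sum>i\<in>UNIV. \<bar>blinfun_apply D (e i)\<bar>)"
    using norm_le_l1_cart[of "\<chi> i. blinfun_apply D (e i)"] by simp
  also have "\<dots> \<le> (\<Sum>i\<in>UNIV. norm D * norm (e i))"
    using norm_blinfun[of D] by (intro sum_mono) simp
  finally show "norm (\<chi> i. blinfun_apply D (e i)) \<le> norm D * (\<Sum>i\<in>UNIV. norm (e i))"
    by (simp add: sum_distrib_left)
qed (simp_all add: vec_eq_iff blinfun.add_left blinfun.scaleR_left)

text \<open>\<open>j\<close> embeds the variable in which one differentiates, so \<open>g\<close> is
  a partial gradient and \<open>Dg\<close> its full derivative. The uniform statements are made for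
  convex subsets of \<open>U\<close>, because mean value estimates need convexity and
  \<open>X \<times> Y\<close> need not be convex. One constant \<open>l\<close> serves
  \<open>f\<close> and \<open>g\<close>; the factor \<open>C\<close> inside it is the price of
  passing from functionals to vectors.\<close>

lemma C2_closure_data:
  fixes f :: "'p::euclidean_space \<Rightarrow> real" and j :: "real ^ 'n \<Rightarrow> 'p"
  assumes f: "C2_closure f U" and U: "bounded U" and j: "linear j"
  obtains f' :: "'p \<Rightarrow> 'p \<Rightarrow> real" and g :: "'p \<Rightarrow> real ^ 'n" and Dg :: "'p \<Rightarrow> 'p \<Rightarrow> real ^ 'n" and l :: real
  where "continuous_on (closure U) f" "continuous_on (closure U) g"
    "\<And>v. continuous_on (closure U) (\<lambda>p. f' p v)"
    "\<And>v. continuous_on (closure U) (\<lambda>p. Dg p v)" "0 \<le> l"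
    "\<And>p v. f' p (j v) = g p \<bullet> v"
    "\<And>S. open S \<Longrightarrow> convex S \<Longrightarrow> S \<subseteq> U \<Longrightarrow> usd f f' (closure S)"
    "\<And>S. open S \<Longrightarrow> convex S \<Longrightarrow> S \<subseteq> U \<Longrightarrow> usd g Dg (closure S)"
    "\<And>S p q. open S \<Longrightarrow> convex S \<Longrightarrow> S \<subseteq> U \<Longrightarrow> p \<in> closure S \<Longrightarrow> q \<in> closure S \<Longrightarrow> \<bar>f p - f q\<bar> \<le> l * norm (p - q)"
    "\<And>S p q. open S \<Longrightarrow> convex S \<Longrightarrow> S \<subseteq> U \<Longrightarrow> p \<in> closure S \<Longrightarrow> q \<in> closure S \<Longrightarrow> norm (g p - g q) \<le> l * norm (p - q)"
proof -
  obtain F :: "'p \<Rightarrow> 'p \<Rightarrow>\<^sub>L real" and F2 :: "'p \<Rightarrow> 'p \<Rightarrow>\<^sub>L 'p \<Rightarrow>\<^sub>L real" where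
    c: "continuous_on (closure U) f" "continuous_on (closure U) F" "continuous_on (closure U) F2" and
    d: "\<forall>x\<in>U. (f has_derivative blinfun_apply (F x)) (at x)" "\<forall>x\<in>U. (F has_derivative blinfun_apply (F2 x)) (at x)"
    using f unfolding C2_closure_def by blast
  define G where "G D = (\<chi> i. blinfun_apply D (j (axis i 1)))" for D :: "'p \<Rightarrow>\<^sub>L real"
  have G: "bounded_linear G" unfolding G_def by (rule bounded_linear_coordinates)
  obtain C where C: "C > 0" "\<And>x. norm (G x) \<le> norm x * C" using bounded_linear.pos_bounded[OF G] by blast
  have cU: "compact (closure U)" using U by simp
  obtain b1 where b1: "\<And>p. p \<in> closure U \<Longrightarrow> norm (F p) \<le> b1"
    using compact_imp_bounded[OF compact_continuous_image[OF c(2) cU]] by (auto simp: bounded_iff)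
  obtain b2 where b2: "\<And>p. p \<in> closure U \<Longrightarrow> norm (F2 p) \<le> b2"
    using compact_imp_bounded[OF compact_continuous_image[OF c(3) cU]] by (auto simp: bounded_iff)
  define l where "l = max 0 (max b1 (C * b2))"
  have sub: "closure S \<subseteq> closure U" if "S \<subseteq> U" for S using that by (rule closure_mono)
  show thesis
  proof (rule that[of "\<lambda>p. G (F p)" "\<lambda>p. blinfun_apply (F p)" "\<lambda>p v. G (blinfun_apply (F2 p) v)" l])
    show "continuous_on (closure U) f" by (rule c(1))
    show "continuous_on (closure U) (\<lambda>p. G (F p))"
      using c(2) by (rule bounded_linear.continuous_on[OF G])
    show "continuous_on (closure U) (\<lambda>p. blinfun_apply (F p) v)" for v
      using c(2) by (intro continuous_intros)
    show "continuous_on (closure U) (\<lambda>p. G (blinfun_apply (F2 p) v))" for v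
      using c(3) by (intro bounded_linear.continuous_on[OF G] continuous_intros)
    show "0 \<le> l" by (simp add: l_def)
    show "blinfun_apply (F p) (j v) = G (F p) \<bullet> v" for p v
    proof -
      have "linear (\<lambda>v. blinfun_apply (F p) (j v))"
        using linear_compose[OF j bounded_linear.linear[OF blinfun.bounded_linear_right[of "F p"]]]
        by (simp add: o_def)
      from linear_functional_axis[OF this, of v] show ?thesis by (simp add: G_def)
    qed
    fix S assume S: "open S" "convex S" "S \<subseteq> U"
    have bS: "bounded S" using U S(3) by (rule bounded_subset)
    have dS: "(f has_derivative blinfun_apply (F x)) (at x)" "(F has_derivative blinfun_apply (F2 x)) (at x)" if "x \<in> S" for x
      using d S(3) that by auto
    have cS: "continuous_on (closure S) f" "continuous_on (closure S) F" "continuous_on (closure S) F2"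
      using c sub[OF S(3)] continuous_on_subset by blast+
    show "usd f (\<lambda>p. blinfun_apply (F p)) (closure S)"
      by (rule C1_closure_usd[OF S(1,2) bS cS(1,2) dS(1)])
    have "usd F (\<lambda>p. blinfun_apply (F2 p)) (closure S)"
      by (rule C1_closure_usd[OF S(1,2) bS cS(2,3) dS(2)])
    then show "usd (\<lambda>p. G (F p)) (\<lambda>p v. G (blinfun_apply (F2 p) v)) (closure S)"
      by (rule usd_bounded_linear_compose[OF G])
    fix p q assume pq: "p \<in> closure S" "q \<in> closure S"
    have inU: "x \<in> closure U" if "x \<in> S" for x using that S(3) closure_subset by blast
    have "norm (f p - f q - blinfun_apply 0 (p - q)) \<le> l * norm (p - q)"
      using b1[OF inU] by (intro near_linear_closure[OF S(2) cS(1) dS(1) _ pq]) (auto simp: l_def intro: max.coboundedI1 max.coboundedI2)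
    then show "\<bar>f p - f q\<bar> \<le> l * norm (p - q)" by simp
    have "norm (F p - F q - blinfun_apply 0 (p - q)) \<le> b2 * norm (p - q)"
      using b2[OF inU] by (intro near_linear_closure[OF S(2) cS(2) dS(2) _ pq]) auto
    then have b: "norm (F p - F q) \<le> b2 * norm (p - q)" by simp
    have "norm (G (F p) - G (F q)) = norm (G (F p - F q))" using G by (simp add: linear_simps)
    also have "\<dots> \<le> norm (F p - F q) * C" by (rule C(2))
    also have "\<dots> \<le> b2 * norm (p - q) * C" using b C(1) by (intro mult_right_mono) auto
    also have "\<dots> = (C * b2) * norm (p - q)" by simp
    also have "\<dots> \<le> l * norm (p - q)" by (intro mult_right_mono) (auto simp: l_def)
    finally show "norm (G (F p) - G (F q)) \<le> l * norm (p - q)" .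
  qed
qed

section \<open>Couplings and mixtures\<close>

lemma Prob_iff: "\<nu> \<in> Prob S \<longleftrightarrow> prob_space \<nu> \<and> sets \<nu> = sets (restrict_space borel S)"
  by (auto simp: space_prob_algebra)

lemma space_Prob: "\<nu> \<in> Prob S \<Longrightarrow> space \<nu> = S"
  using sets_eq_imp_space_eq[of \<nu> "restrict_space borel S"] by (simp add: Prob_iff space_restrict_space)

lemma measurable_Prob:
  assumes "\<nu> \<in> Prob S" "continuous_on S f"
  shows "f \<in> borel_measurable \<nu>"
  using borel_measurable_continuous_on_restrict[OF assms(2)] assms(1) measurable_cong_sets[of \<nu> "restrict_space borel S"]
  by (auto simp: Prob_iff)

lemma couplingsI_maps:
  assumes f: "f \<in> measurable \<rho> \<mu>" and g: "g \<in> measurable \<rho> \<nu>"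
    and "distr \<rho> \<mu> f = \<mu>" "distr \<rho> \<nu> g = \<nu>"
  shows "distr \<rho> (\<mu> \<Otimes>\<^sub>M \<nu>) (\<lambda>w. (f w, g w)) \<in> couplings \<mu> \<nu>"
  unfolding couplings_def using assms by (auto simp: distr_distr o_def)

lemma couplings_measurable:
  assumes "\<gamma> \<in> couplings \<mu> \<nu>"
  shows "fst \<in> measurable \<gamma> \<mu>" "snd \<in> measurable \<gamma> \<nu>" "space \<gamma> = space \<mu> \<times> space \<nu>"
proof -
  have s: "sets \<gamma> = sets (\<mu> \<Otimes>\<^sub>M \<nu>)" using assms by (simp add: couplings_def)
  show "fst \<in> measurable \<gamma> \<mu>" "snd \<in> measurable \<gamma> \<nu>"
    using measurable_cong_sets[OF s refl] measurable_fst measurable_snd by blast+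
  show "space \<gamma> = space \<mu> \<times> space \<nu>" using sets_eq_imp_space_eq[OF s] by (simp add: space_pair_measure)
qed

lemma couplings_prob_space:
  assumes \<gamma>: "\<gamma> \<in> couplings \<mu> \<nu>" and "prob_space \<mu>"
  shows "prob_space \<gamma>"
proof -
  have "prob_space (distr \<gamma> \<mu> fst)" using assms by (simp add: couplings_def)
  then show ?thesis by (rule prob_space_distrD[OF couplings_measurable(1)[OF \<gamma>]])
qed

lemma couplings_integral_fst:
  fixes f :: "'a \<Rightarrow> real"
  assumes \<gamma>: "\<gamma> \<in> couplings \<mu> \<nu>" and f: "f \<in> borel_measurable \<mu>"
  shows "(\<integral>p. f (fst p) \<partial>\<gamma>) = (\<integral>x. f x \<partial>\<mu>)"
proof -
  have "(\<integral>x. f x \<partial>(distr \<gamma> \<mu> fst)) = (\<integral>p. f (fst p) \<partial>\<gamma>)"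
    by (rule integral_distr[OF couplings_measurable(1)[OF \<gamma>] f])
  then show ?thesis using \<gamma> by (simp add: couplings_def)
qed

lemma couplings_nonempty:
  assumes "prob_space \<mu>" "prob_space \<nu>" shows "couplings \<mu> \<nu> \<noteq> {}"
proof -
  interpret pair_prob_space \<mu> \<nu> using assms by (simp add: pair_prob_space_def pair_sigma_finite_def prob_space_imp_sigma_finite)
  have "distr (\<mu> \<Otimes>\<^sub>M \<nu>) \<mu> fst = \<mu>" using M2.distr_pair_fst .
  moreover have "distr (\<mu> \<Otimes>\<^sub>M \<nu>) \<nu> snd = \<nu>"
  proof -
    have "distr (\<mu> \<Otimes>\<^sub>M \<nu>) \<nu> snd = distr (distr (\<nu> \<Otimes>\<^sub>M \<mu>) (\<mu> \<Otimes>\<^sub>M \<nu>) (\<lambda>(x, y). (y, x))) \<nu> snd"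
      by (simp add: distr_pair_swap[symmetric])
    also have "\<dots> = distr (\<nu> \<Otimes>\<^sub>M \<mu>) \<nu> fst"
      by (subst distr_distr) (auto simp: o_def case_prod_beta measurable_pair_swap')
    also have "\<dots> = \<nu>" using M1.distr_pair_fst .
    finally show ?thesis .
  qed
  ultimately have "\<mu> \<Otimes>\<^sub>M \<nu> \<in> couplings \<mu> \<nu>" by (simp add: couplings_def)
  then show ?thesis by blast
qed

lemma transport_cost_bdd_below:
  fixes c :: "'a \<Rightarrow> 'b \<Rightarrow> real"
  assumes \<mu>: "prob_space \<mu>" and bd: "\<And>x y. x \<in> space \<mu> \<Longrightarrow> y \<in> space \<nu> \<Longrightarrow> \<bar>c x y\<bar> \<le> b"
  shows "bdd_below ((\<lambda>\<gamma>. \<integral>p. c (fst p) (snd p) \<partial>\<gamma>) ` couplings \<mu> \<nu>)"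
proof (rule bdd_belowI2)
  fix \<gamma> assume \<gamma>: "\<gamma> \<in> couplings \<mu> \<nu>"
  interpret prob_space \<gamma> using couplings_prob_space[OF \<gamma> \<mu>] .
  have bd': "\<bar>c (fst p) (snd p)\<bar> \<le> b" if "p \<in> space \<gamma>" for p
    using that bd couplings_measurable(3)[OF \<gamma>] by auto
  \<comment> \<open>A non-integrable cost has integral zero by convention, so the bound is stated
    with \<open>\<bar>b\<bar>\<close> to hold in both cases.\<close>
  show "- \<bar>b\<bar> \<le> (\<integral>p. c (fst p) (snd p) \<partial>\<gamma>)"
  proof (cases "integrable \<gamma> (\<lambda>p. c (fst p) (snd p))")
    case True
    show ?thesis
    proof (rule integral_ge_const[OF True], rule AE_I2)
      show "- \<bar>b\<bar> \<le> c (fst p) (snd p)" if "p \<in> space \<gamma>" for p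
        using bd'[OF that] by linarith
    qed
  qed (simp add: not_integrable_integral_eq)
qed

lemma transport_cost_le:
  assumes "prob_space \<mu>" "\<And>x y. x \<in> space \<mu> \<Longrightarrow> y \<in> space \<nu> \<Longrightarrow> \<bar>c x y\<bar> \<le> b" "\<gamma> \<in> couplings \<mu> \<nu>"
  shows "transport_cost c \<mu> \<nu> \<le> (\<integral>p. c (fst p) (snd p) \<partial>\<gamma>)"
  unfolding transport_cost_def using transport_cost_bdd_below[OF assms(1,2)] assms(3) by (rule cINF_lower)

lemma transport_cost_approx:
  assumes "prob_space \<mu>" "prob_space \<nu>" "\<And>x y. x \<in> space \<mu> \<Longrightarrow> y \<in> space \<nu> \<Longrightarrow> \<bar>c x y\<bar> \<le> b" "e > 0"
  obtains \<gamma> where "\<gamma> \<in> couplings \<mu> \<nu>" "(\<integral>p. c (fst p) (snd p) \<partial>\<gamma>) < transport_cost c \<mu> \<nu> + e"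
proof -
  have bdd: "bdd_below ((\<lambda>\<gamma>. \<integral>p. c (fst p) (snd p) \<partial>\<gamma>) ` couplings \<mu> \<nu>)"
    using assms(1,3) by (rule transport_cost_bdd_below)
  have "transport_cost c \<mu> \<nu> < transport_cost c \<mu> \<nu> + e" using assms(4) by simp
  then have "(INF \<gamma>\<in>couplings \<mu> \<nu>. \<integral>p. c (fst p) (snd p) \<partial>\<gamma>) < transport_cost c \<mu> \<nu> + e"
    by (simp only: transport_cost_def)
  then have "\<exists>\<gamma>\<in>couplings \<mu> \<nu>. (\<integral>p. c (fst p) (snd p) \<partial>\<gamma>) < transport_cost c \<mu> \<nu> + e"
    by (rule iffD1[OF cINF_less_iff[OF couplings_nonempty[OF assms(1,2)] bdd]])
  then show thesis using that by blast
qed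

lemma wasserstein1_nonneg:
  assumes "prob_space \<mu>" "prob_space \<nu>" shows "0 \<le> wasserstein1 \<mu> \<nu>"
  unfolding wasserstein1_def transport_cost_def using couplings_nonempty[OF assms]
  by (intro cINF_greatest) auto

text \<open>Two maps on one probability space jointly push it forward to a coupling of their
  laws.\<close>

lemma wasserstein1_le_maps:
  assumes \<rho>: "prob_space \<rho>" and S: "bounded S"
    and f: "f \<in> measurable \<rho> (restrict_space borel S)" and g: "g \<in> measurable \<rho> (restrict_space borel S)"
  shows "wasserstein1 (distr \<rho> (restrict_space borel S) f) (distr \<rho> (restrict_space borel S) g)
     \<le> (\<integral>w. dist (f w) (g w :: 'a::euclidean_space) \<partial>\<rho>)"
proof -
  let ?R = "restrict_space borel S :: 'a measure"
  let ?F = "distr \<rho> ?R f" and ?G = "distr \<rho> ?R g"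
  have sp: "space ?R = S" by (simp add: space_restrict_space)
  obtain b where b: "\<And>x y. x \<in> S \<Longrightarrow> y \<in> S \<Longrightarrow> dist x y \<le> b"
    using S unfolding bounded_two_points by blast
  have f': "f \<in> measurable \<rho> ?F" and g': "g \<in> measurable \<rho> ?G"
    using f g by simp_all
  have "distr \<rho> ?F f = ?F" "distr \<rho> ?G g = ?G" by (intro measure_eqI; simp add: emeasure_distr f' g' f g)+
  then have \<gamma>: "distr \<rho> (?F \<Otimes>\<^sub>M ?G) (\<lambda>w. (f w, g w)) \<in> couplings ?F ?G"
    by (rule couplingsI_maps[OF f' g'])
  have "wasserstein1 ?F ?G \<le> (\<integral>p. dist (fst p) (snd p) \<partial>distr \<rho> (?F \<Otimes>\<^sub>M ?G) (\<lambda>w. (f w, g w)))"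
    unfolding wasserstein1_def
    by (rule transport_cost_le[OF prob_space.prob_space_distr[OF \<rho> f] _ \<gamma>, of _ b]) (auto simp: sp b)
  also have "\<dots> = (\<integral>w. dist (f w) (g w) \<partial>\<rho>)"
  proof (subst integral_distr)
    show "(\<lambda>w. (f w, g w)) \<in> measurable \<rho> (?F \<Otimes>\<^sub>M ?G)" using f' g' by (rule measurable_Pair)
    have "(\<lambda>p. p) \<in> measurable (?F \<Otimes>\<^sub>M ?G) (borel \<Otimes>\<^sub>M borel)"
    proof -
      have id: "(\<lambda>x. x) \<in> measurable ?R borel" by (simp add: measurable_restrict_space1)
      have "fst \<in> measurable (?F \<Otimes>\<^sub>M ?G) ?F" "snd \<in> measurable (?F \<Otimes>\<^sub>M ?G) ?G" by simp_all
      then have 1: "fst \<in> measurable (?F \<Otimes>\<^sub>M ?G) ?R" and 2: "snd \<in> measurable (?F \<Otimes>\<^sub>M ?G) ?R" by simp_all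
      have "(\<lambda>p. (fst p, snd p)) \<in> measurable (?F \<Otimes>\<^sub>M ?G) (borel \<Otimes>\<^sub>M borel)"
        using measurable_compose[OF 1 id] measurable_compose[OF 2 id] by (rule measurable_Pair)
      then show ?thesis by simp
    qed
    then show "(\<lambda>p. dist (fst p) (snd p)) \<in> borel_measurable (?F \<Otimes>\<^sub>M ?G)"
      by (rule measurable_compose) measurable
  qed simp
  finally show ?thesis .
qed

text \<open>For \<open>t\<close> in the unit interval this is the convex combination with weight
  \<open>1 - t\<close> on \<open>A\<close> and \<open>t\<close> on \<open>B\<close>. Written as a
  random choice followed by a draw, it lets push-forwards and integrals be computed by the rules for
  \<open>bind\<close>.\<close>

definition mixture :: "real \<Rightarrow> 'a measure \<Rightarrow> 'a measure \<Rightarrow> 'a measure" where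
  "mixture t A B = measure_pmf (bernoulli_pmf t) \<bind> (\<lambda>b. if b then B else A)"

lemma
  assumes A: "prob_space A" "sets A = sets N" and B: "prob_space B" "sets B = sets N"
  shows sets_mixture: "sets (mixture t A B) = sets N"
    and prob_space_mixture: "prob_space (mixture t A B)"
    and distr_mixture: "f \<in> measurable N R \<Longrightarrow> distr (mixture t A B) R f = mixture t (distr A R f) (distr B R f)"
proof -
  have K: "(\<lambda>b. if b then B else A) \<in> measurable (measure_pmf (bernoulli_pmf t)) (subprob_algebra N)"
    using A B by (auto simp: space_subprob_algebra prob_space_imp_subprob_space)
  show s: "sets (mixture t A B) = sets N"
    unfolding mixture_def using K by (rule sets_bind_measurable) simp
  show "prob_space (mixture t A B)"
    unfolding mixture_def by (rule prob_space.prob_space_bind[OF _ _ K]) (use A B in \<open>auto simp: prob_space_measure_pmf\<close>)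
  assume "f \<in> measurable N R"
  then show "distr (mixture t A B) R f = mixture t (distr A R f) (distr B R f)"
    unfolding mixture_def by (subst distr_bind[OF K]) (auto intro!: bind_cong)
qed

lemma mixture_same: "prob_space A \<Longrightarrow> mixture t A A = A"
  unfolding mixture_def using bind_const'[OF prob_space_measure_pmf prob_space_imp_subprob_space, of A] by simp

lemma integral_mixture:
  fixes f :: "'a \<Rightarrow> real"
  assumes A: "prob_space A" "sets A = sets N" and B: "prob_space B" "sets B = sets N"
    and t: "0 \<le> t" "t \<le> 1" and f: "f \<in> borel_measurable N" and bd: "\<And>x. x \<in> space N \<Longrightarrow> \<bar>f x\<bar> \<le> b"
  shows "(\<integral>x. f x \<partial>mixture t A B) = (1 - t) * (\<integral>x. f x \<partial>A) + t * (\<integral>x. f x \<partial>B)"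
proof -
  have K: "(\<lambda>b. if b then B else A) \<in> measurable (measure_pmf (bernoulli_pmf t)) (subprob_algebra N)"
    using A B by (auto simp: space_subprob_algebra prob_space_imp_subprob_space)
  have "(\<integral>x. f x \<partial>mixture t A B) = (\<integral>b. (\<integral>x. f x \<partial>(if b then B else A)) \<partial>measure_pmf (bernoulli_pmf t))"
    unfolding mixture_def
    by (rule integral_bind[OF f, where B' = 1 and B = b])
      (use K A B bd in \<open>auto simp: prob_space.emeasure_space_1 prob_space_measure_pmf prob_space.finite_measure\<close>)
  also have "\<dots> = (1 - t) * (\<integral>x. f x \<partial>A) + t * (\<integral>x. f x \<partial>B)"
    using t by simp
  finally show ?thesis .
qed

section \<open>Best replies\<close>

lemma usd_cong: "(\<And>p v. p \<in> K \<Longrightarrow> D p v = D' p v) \<Longrightarrow> usd f D K \<Longrightarrow> usd f D' K"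
proof -
  assume eq: "\<And>p v. p \<in> K \<Longrightarrow> D p v = D' p v" and u: "usd f D K"
  have "D p = D' p" if "p \<in> K" for p using eq[OF that] by (rule ext)
  then show ?thesis using u unfolding usd_def by simp
qed

lemma usd_slice_snd:
  assumes u: "usd f D (A \<times> K)" and x: "x \<in> A"
  shows "usd (\<lambda>y. f (x, y)) (\<lambda>y v. D (x, y) (0, v)) K"
proof (rule usdI)
  show "bounded_linear (\<lambda>v. D (x, y) (0, v))" if "y \<in> K" for y
  proof -
    have 1: "bounded_linear (D (x, y))" using usd_bounded_linear[OF u, of "(x, y)"] x that by simp
    have 2: "bounded_linear (\<lambda>v. (0, v))"
      by (intro bounded_linear_Pair bounded_linear_zero bounded_linear_ident)
    show ?thesis by (rule bounded_linear_compose[OF 1 2])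
  qed
  fix e :: real assume "e > 0"
  from usdD[OF u this] obtain d where d: "d > 0" "\<And>p0 p q. p0 \<in> A \<times> K \<Longrightarrow> p \<in> A \<times> K \<Longrightarrow> q \<in> A \<times> K \<Longrightarrow>
    dist p0 p < d \<Longrightarrow> dist p0 q < d \<Longrightarrow> norm (f p - f q - D p0 (p - q)) \<le> e * norm (p - q)" by blast
  have "norm (f (x, p) - f (x, q) - D (x, p0) (0, p - q)) \<le> e * norm (p - q)"
    if "p0 \<in> K" "p \<in> K" "q \<in> K" "dist p0 p < d" "dist p0 q < d" for p0 p q
    using d(2)[of "(x, p0)" "(x, p)" "(x, q)"] that x by (simp add: dist_Pair_Pair norm_Pair)
  then show "\<exists>d>0. \<forall>p0\<in>K. \<forall>p\<in>K. \<forall>q\<in>K. dist p0 p < d \<longrightarrow> dist p0 q < d \<longrightarrow>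
        norm (f (x, p) - f (x, q) - D (x, p0) (0, p - q)) \<le> e * norm (p - q)"
    using d(1) by blast
qed

lemma usd_slice_fst:
  assumes u: "usd f D (A \<times> K)" and x: "x \<in> K"
  shows "usd (\<lambda>y. f (y, x)) (\<lambda>y v. D (y, x) (v, 0)) A"
proof (rule usdI)
  show "bounded_linear (\<lambda>v. D (y, x) (v, 0))" if "y \<in> A" for y
  proof -
    have 1: "bounded_linear (D (y, x))" using usd_bounded_linear[OF u, of "(y, x)"] x that by simp
    have 2: "bounded_linear (\<lambda>v. (v, 0))"
      by (intro bounded_linear_Pair bounded_linear_zero bounded_linear_ident)
    show ?thesis by (rule bounded_linear_compose[OF 1 2])
  qed
  fix e :: real assume "e > 0"
  from usdD[OF u this] obtain d where d: "d > 0" "\<And>p0 p q. p0 \<in> A \<times> K \<Longrightarrow> p \<in> A \<times> K \<Longrightarrow> q \<in> A \<times> K \<Longrightarrow>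
    dist p0 p < d \<Longrightarrow> dist p0 q < d \<Longrightarrow> norm (f p - f q - D p0 (p - q)) \<le> e * norm (p - q)" by blast
  have "norm (f (p, x) - f (q, x) - D (p0, x) (p - q, 0)) \<le> e * norm (p - q)"
    if "p0 \<in> A" "p \<in> A" "q \<in> A" "dist p0 p < d" "dist p0 q < d" for p0 p q
    using d(2)[of "(p0, x)" "(p, x)" "(q, x)"] that x by (simp add: dist_Pair_Pair norm_Pair)
  then show "\<exists>d>0. \<forall>p0\<in>A. \<forall>p\<in>A. \<forall>q\<in>A. dist p0 p < d \<longrightarrow> dist p0 q < d \<longrightarrow>
        norm (f (p, x) - f (q, x) - D (p0, x) (p - q, 0)) \<le> e * norm (p - q)"
    using d(1) by blast
qed

text \<open>The C2 hypotheses enter through the derivative data extracted from them: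
  \<open>gc\<close>, \<open>gV\<close>, \<open>gW\<close> are gradients in the reply variable,
  \<open>Dgc\<close>, \<open>HV\<close>, \<open>DgW\<close> their derivatives, and
  \<open>lc\<close>, \<open>lV\<close>, \<open>lW\<close> Lipschitz constants. For \<open>c\<close>
  the data live on convex subsets of \<open>X \<times> Y\<close>, for \<open>V\<close> and
  \<open>W\<close> on whole closures, since \<open>Y\<close> is convex.\<close>

locale best_reply_game =
  fixes X :: "(real ^ 'm) set" and Y :: "(real ^ 'n) set"
    and c :: "real ^ 'm \<Rightarrow> real ^ 'n \<Rightarrow> real"
    and V :: "real ^ 'n \<Rightarrow> real" and W :: "real ^ 'n \<Rightarrow> real ^ 'n \<Rightarrow> real"
    and \<mu> :: "(real ^ 'm) measure" and \<eta> \<kappa> M k C :: real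
    and Dc and gc and Dgc and lc :: real and gV and HV and lV :: real and DW and gW and DgW and lW :: real
  assumes card: "CARD('n) < CARD('m)"
    and X: "bounded X" "open X" and Y: "bounded Y" "open Y" "convex Y" "Y \<noteq> {}"
    and c_cont: "continuous_on (closure X \<times> closure Y) (\<lambda>p. c (fst p) (snd p))"
    and c_usd: "\<And>S. open S \<Longrightarrow> convex S \<Longrightarrow> S \<subseteq> X \<times> Y \<Longrightarrow> usd (\<lambda>p. c (fst p) (snd p)) Dc (closure S)"
    and gc_usd: "\<And>S. open S \<Longrightarrow> convex S \<Longrightarrow> S \<subseteq> X \<times> Y \<Longrightarrow> usd gc Dgc (closure S)"
    and Dc: "\<And>p v. Dc p (0, v) = gc p \<bullet> v" and lc: "0 \<le> lc"
    and c_lip: "\<And>S p q. open S \<Longrightarrow> convex S \<Longrightarrow> S \<subseteq> X \<times> Y \<Longrightarrow> p \<in> closure S \<Longrightarrow> q \<in> closure S \<Longrightarrow>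
        \<bar>c (fst p) (snd p) - c (fst q) (snd q)\<bar> \<le> lc * norm (p - q)"
    and gc_lip: "\<And>S p q. open S \<Longrightarrow> convex S \<Longrightarrow> S \<subseteq> X \<times> Y \<Longrightarrow> p \<in> closure S \<Longrightarrow> q \<in> closure S \<Longrightarrow>
        norm (gc p - gc q) \<le> lc * norm (p - q)"
    and V_usd: "usd V (\<lambda>y v. gV y \<bullet> v) (closure Y)" and gV_usd: "usd gV HV (closure Y)"
    and lV: "0 \<le> lV"
    and V_lip: "\<And>y z. y \<in> closure Y \<Longrightarrow> z \<in> closure Y \<Longrightarrow> \<bar>V y - V z\<bar> \<le> lV * norm (y - z)"
    and W_cont: "continuous_on (closure Y \<times> closure Y) (\<lambda>p. W (fst p) (snd p))"
    and gW_cont: "continuous_on (closure Y \<times> closure Y) gW"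
    and DgW_cont: "\<And>v. continuous_on (closure Y \<times> closure Y) (\<lambda>p. DgW p v)"
    and W_usd: "usd (\<lambda>p. W (fst p) (snd p)) DW (closure Y \<times> closure Y)"
    and gW_usd: "usd gW DgW (closure Y \<times> closure Y)"
    and DW: "\<And>p v. DW p (v, 0) = gW p \<bullet> v" and lW: "0 \<le> lW"
    and W_lip: "\<And>p q. p \<in> closure Y \<times> closure Y \<Longrightarrow> q \<in> closure Y \<times> closure Y \<Longrightarrow>
        \<bar>W (fst p) (snd p) - W (fst q) (snd q)\<bar> \<le> lW * norm (p - q)"
    and W_sym: "\<forall>y\<in>closure Y. \<forall>z\<in>closure Y. W y z = W z y"
    and boundary: "\<forall>x\<in>X. \<forall>z\<in>Y. \<forall>y\<in>frontier Y. \<forall>n\<in>outward_unit_normals Y y.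
           (gradient (c x) (at y within closure Y) + gradient V (at y within closure Y) +
            gradient (\<lambda>y'. W y' z) (at y within closure Y)) \<bullet> n \<ge> 0"
    and \<mu>: "\<mu> \<in> Prob X" "absolutely_continuous (restrict_space lborel X) \<mu>"
    and Linf: "Linf_density X \<mu> < \<infinity>"
    and \<eta>: "\<eta> > 0" "\<forall>x\<in>X. \<forall>y\<in>Y. matrix_ge (hessian (c x) y) \<eta>"
    and \<kappa>: "\<kappa> > 0" and k: "k > 0"
    and F_hessian: "\<forall>\<nu>\<in>Prob (closure Y). \<forall>y\<in>Y. matrix_ge (hessian (first_variation V W \<nu>) y) \<kappa>"
    and fibres: "\<forall>\<nu>\<in>Prob (closure Y). \<forall>y\<in>Y.
           enn2ereal (hausdorff_measure (CARD('m) - CARD('n)) {x \<in> X. best_reply c V W Y \<nu> x = y})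
             \<le> ereal M"
    and jac: "\<forall>\<nu>\<in>Prob (closure Y). \<forall>x\<in>X. jacobian_factor (best_reply c V W Y \<nu>) x \<ge> k"
    and F_lip: "\<forall>\<nu>\<^sub>0\<in>Prob (closure Y). \<forall>\<nu>\<^sub>1\<in>Prob (closure Y).
           (LINT y:Y|lborel. norm (gradient (first_variation V W \<nu>\<^sub>1) (at y)
                                   - gradient (first_variation V W \<nu>\<^sub>0) (at y)))
             \<le> C * wasserstein1 \<nu>\<^sub>1 \<nu>\<^sub>0"
    and small: "enn2real (Linf_density X \<mu>) * M * C < k * (\<eta> + \<kappa>)"
begin

abbreviation "K \<equiv> closure Y"

abbreviation "F \<equiv> first_variation V W"

text \<open>\<open>gF\<close> and \<open>HF\<close> are the first variation differentiated under the
  integral; \<open>Gr\<close> is the gradient of the cost that a point \<open>x\<close> faces, whose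
  zero is the best reply, and \<open>HG\<close> its derivative in the reply.\<close>

definition "gF \<nu> y = gV y + (\<integral>z. gW (y, z) \<partial>\<nu>)"

definition "HF \<nu> y v = HV y v + (\<integral>z. DgW (y, z) (v, 0) \<partial>\<nu>)"

definition "Gr \<nu> x y = gc (x, y) + gF \<nu> y"

definition "HG \<nu> x y v = Dgc (x, y) (0, v) + HF \<nu> y v"

abbreviation "B \<equiv> best_reply c V W Y"

section \<open>Regularity of the first variation and of the reply cost\<close>

lemma compact_K: "compact K"
  using Y(1) by simp

lemma convex_K: "convex K"
  using Y(3) by (rule convex_closure)

lemma integrable_K:
  fixes f :: "real ^ 'n \<Rightarrow> 'b::euclidean_space"
  assumes "\<nu> \<in> Prob K" "continuous_on K f" shows "integrable \<nu> f"
proof -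
  interpret prob_space \<nu> using assms(1) by (simp add: Prob_iff)
  have "bounded (f ` K)" using assms(2) compact_K by (intro compact_imp_bounded compact_continuous_image)
  then obtain b where "\<And>z. z \<in> K \<Longrightarrow> norm (f z) \<le> b" by (auto simp: bounded_iff)
  then show ?thesis
    using measurable_Prob[OF assms] by (intro integrable_const_bound[of _ b]) (auto simp: space_Prob[OF assms(1)])
qed

lemma continuous_on_section:
  assumes f: "continuous_on (K \<times> K) f" and y: "y \<in> K" shows "continuous_on K (\<lambda>z. f (y, z))"
proof (rule continuous_on_compose2[OF f])
  show "continuous_on K (\<lambda>z. (y, z))" by (intro continuous_on_Pair continuous_on_const continuous_on_id)
  show "(\<lambda>z. (y, z)) ` K \<subseteq> K \<times> K" using y by blast
qed

lemma F_usd: "\<nu> \<in> Prob K \<Longrightarrow> usd (F \<nu>) (\<lambda>y v. gF \<nu> y \<bullet> v) K"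
  and gF_usd: "\<nu> \<in> Prob K \<Longrightarrow> usd (gF \<nu>) (HF \<nu>) K"
proof -
  assume \<nu>: "\<nu> \<in> Prob K"
  have p: "prob_space \<nu>" "sets \<nu> = sets (restrict_space borel K)" using \<nu> by (auto simp: Prob_iff)
  have "usd (\<lambda>y. \<integral>z. W y z \<partial>\<nu>) (\<lambda>y v. \<integral>z. DW (y, z) (v, 0) \<partial>\<nu>) K"
  proof (rule usd_integral[OF W_usd compact_K p])
    show "continuous_on K (W y)" if "y \<in> K" for y
      using continuous_on_section[OF W_cont that] by simp
    show "continuous_on K (\<lambda>z. DW (y, z) (v, 0))" if "y \<in> K" for y v
      unfolding DW by (intro continuous_intros continuous_on_section[OF gW_cont that])
  qed
  from usd_add[OF V_usd this] show "usd (F \<nu>) (\<lambda>y v. gF \<nu> y \<bullet> v) K"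
    unfolding first_variation_def
  proof (rule usd_cong[rotated])
    fix y v assume y: "y \<in> K"
    have "(\<integral>z. DW (y, z) (v, 0) \<partial>\<nu>) = (\<integral>z. gW (y, z) \<partial>\<nu>) \<bullet> v"
      unfolding DW using integrable_K[OF \<nu> continuous_on_section[OF gW_cont y]] by simp
    then show "gV y \<bullet> v + (\<integral>z. DW (y, z) (v, 0) \<partial>\<nu>) = gF \<nu> y \<bullet> v"
      by (simp add: gF_def inner_add_left)
  qed
  have "usd (\<lambda>y. \<integral>z. gW (y, z) \<partial>\<nu>) (\<lambda>y v. \<integral>z. DgW (y, z) (v, 0) \<partial>\<nu>) K"
  proof (rule usd_integral[OF _ compact_K p])
    show "usd (\<lambda>p. gW (fst p, snd p)) DgW (K \<times> K)" using gW_usd by simp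
    show "continuous_on K (\<lambda>z. gW (y, z))" if "y \<in> K" for y
      by (rule continuous_on_section[OF gW_cont that])
    show "continuous_on K (\<lambda>z. DgW (y, z) (v, 0))" if "y \<in> K" for y v
      by (rule continuous_on_section[OF DgW_cont that])
  qed
  from usd_add[OF gV_usd this] show "usd (gF \<nu>) (HF \<nu>) K"
    unfolding gF_def[abs_def] HF_def[abs_def] .
qed

lemma X_ball: "x \<in> X \<Longrightarrow> \<exists>r>0. ball x r \<subseteq> X"
  using X(2) by (simp add: open_contains_ball)

lemma c_usd_snd: "x \<in> X \<Longrightarrow> usd (c x) (\<lambda>y v. gc (x, y) \<bullet> v) K"
  and gc_usd_snd: "x \<in> X \<Longrightarrow> usd (\<lambda>y. gc (x, y)) (\<lambda>y v. Dgc (x, y) (0, v)) K"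
proof -
  assume x: "x \<in> X"
  from X_ball[OF x] obtain r where r: "r > 0" "ball x r \<subseteq> X" by blast
  \<comment> \<open>A ball times \<open>Y\<close> is convex and inside \<open>X \<times> Y\<close>,
    and its closure contains all pairs of \<open>x\<close> with points of \<open>K\<close>.\<close>
  let ?S = "ball x r \<times> Y"
  have S: "open ?S" "convex ?S" "?S \<subseteq> X \<times> Y"
    using r(2) Y(2,3) by (simp_all add: open_Times convex_Times Sigma_mono)
  have cl: "closure ?S = closure (ball x r) \<times> K" by (rule closure_Times)
  have xc: "x \<in> closure (ball x r)" using r(1) by (intro subsetD[OF closure_subset]) simp
  from usd_slice_snd[OF c_usd[OF S, unfolded cl] xc] show "usd (c x) (\<lambda>y v. gc (x, y) \<bullet> v) K"
    by (simp add: Dc)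
  from usd_slice_snd[OF gc_usd[OF S, unfolded cl] xc]
  show "usd (\<lambda>y. gc (x, y)) (\<lambda>y v. Dgc (x, y) (0, v)) K" .
qed

lemma Gr_usd:
  assumes \<nu>: "\<nu> \<in> Prob K" and x: "x \<in> X" shows "usd (Gr \<nu> x) (HG \<nu> x) K"
proof -
  have 1: "Gr \<nu> x = (\<lambda>y. gc (x, y) + gF \<nu> y)" and 2: "HG \<nu> x = (\<lambda>y v. Dgc (x, y) (0, v) + HF \<nu> y v)"
    by (simp_all only: fun_eq_iff Gr_def HG_def simp_thms)
  have 3: "usd (\<lambda>y. gc (x, y)) (\<lambda>y v. Dgc (x, y) (0, v)) K" using x by (rule gc_usd_snd)
  have 4: "usd (gF \<nu>) (HF \<nu>) K" using \<nu> by (rule gF_usd)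
  show ?thesis unfolding 1 2 by (rule usd_add[OF 3 4])
qed

lemma total_usd:
  assumes \<nu>: "\<nu> \<in> Prob K" and x: "x \<in> X" shows "usd (\<lambda>y. c x y + F \<nu> y) (\<lambda>y v. Gr \<nu> x y \<bullet> v) K"
proof -
  have 1: "usd (c x) (\<lambda>y v. gc (x, y) \<bullet> v) K" using x by (rule c_usd_snd)
  have 2: "usd (F \<nu>) (\<lambda>y v. gF \<nu> y \<bullet> v) K" using \<nu> by (rule F_usd)
  show ?thesis unfolding Gr_def inner_add_left by (rule usd_add[OF 1 2])
qed

lemma gradient_K:
  assumes f: "usd f (\<lambda>y v. g y \<bullet> v) K" and y: "y \<in> K" shows "gradient f (at y within K) = g y"
proof (rule gradient_closure_convex[OF Y(2,3,4) y])
  show "(f has_derivative (\<lambda>v. g y \<bullet> v)) (at y within K)" by (rule usd_has_derivative[OF f y])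
qed

lemma Y_K: "y \<in> Y \<Longrightarrow> y \<in> K"
  by (rule subsetD[OF closure_subset])

lemma has_derivative_Y:
  assumes "usd f D K" "y \<in> Y" shows "(f has_derivative D y) (at y)"
  using usd_has_derivative[OF assms(1) Y_K[OF assms(2)]]
  unfolding at_within_closure_open[OF Y(2) assms(2)] .

lemma gradient_Y:
  assumes "usd f (\<lambda>y v. g y \<bullet> v) K" "y \<in> Y" shows "gradient f (at y) = g y"
  using gradient_K[OF assms(1) Y_K[OF assms(2)]]
  unfolding at_within_closure_open[OF Y(2) assms(2)] .

lemma hessian_Y:
  assumes f: "usd f (\<lambda>y v. g y \<bullet> v) K" and g: "usd g H K" and y: "y \<in> Y"
  shows "hessian f y *v v = H y v"
proof (rule hessian_of_derivative[where g = g, OF Y(2) y])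
  show "(f has_derivative (\<lambda>v. g y \<bullet> v)) (at y)" if "y \<in> Y" for y
    by (rule has_derivative_Y[OF f that])
  show "(g has_derivative H y) (at y)" by (rule has_derivative_Y[OF g y])
qed

text \<open>The Hessian bounds for \<open>c\<close> and for the first variation add up. Both hold
  inside \<open>Y\<close>; their consequence for \<open>Gr\<close> is what extends to
  \<open>K\<close>.\<close>

lemma Gr_mono:
  assumes "\<nu> \<in> Prob K" "x \<in> X" "y \<in> K" "z \<in> K"
  shows "(\<eta> + \<kappa>) * (norm (y - z))\<^sup>2 \<le> (Gr \<nu> x y - Gr \<nu> x z) \<bullet> (y - z)"
proof (rule strongly_monotone_closure[OF Y(3) usd_continuous_on[OF Gr_usd[OF assms(1,2)]] _ _ assms(3,4)])
  show "(Gr \<nu> x has_derivative HG \<nu> x y) (at y)" if "y \<in> Y" for y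
    by (rule has_derivative_Y[OF Gr_usd[OF assms(1,2)] that])
  show "(\<eta> + \<kappa>) * (v \<bullet> v) \<le> v \<bullet> HG \<nu> x y v" if y: "y \<in> Y" for y v
  proof -
    have "\<eta> * (v \<bullet> v) \<le> v \<bullet> Dgc (x, y) (0, v)"
      unfolding hessian_Y[OF c_usd_snd[OF assms(2)] gc_usd_snd[OF assms(2)] y, of v, symmetric]
      using \<eta>(2)[THEN bspec, OF assms(2), THEN bspec, OF y] by (simp add: matrix_ge_def)
    moreover have "\<kappa> * (v \<bullet> v) \<le> v \<bullet> HF \<nu> y v"
      unfolding hessian_Y[OF F_usd[OF assms(1)] gF_usd[OF assms(1)] y, of v, symmetric]
      using F_hessian[THEN bspec, OF assms(1), THEN bspec, OF y] by (simp add: matrix_ge_def)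
    ultimately show ?thesis by (simp add: HG_def inner_add_right algebra_simps)
  qed
qed

text \<open>The boundary condition is given for a single \<open>z \<in> Y\<close>; it extends to
  \<open>z \<in> K\<close> by continuity and is then averaged over \<open>z\<close> with respect to
  \<open>\<nu>\<close>.\<close>

lemma Gr_boundary:
  assumes \<nu>: "\<nu> \<in> Prob K" and x: "x \<in> X" and y: "y \<in> frontier Y" and n: "n \<in> outward_unit_normals Y y"
  shows "0 \<le> Gr \<nu> x y \<bullet> n"
proof -
  interpret prob_space \<nu> using \<nu> by (simp add: Prob_iff)
  have yK: "y \<in> K" using y by (simp add: frontier_def)
  have W1: "gradient (\<lambda>y'. W y' z) (at y within K) = gW (y, z)" if "z \<in> K" for z
  proof -
    have "usd (\<lambda>y'. W y' z) (\<lambda>y v. gW (y, z) \<bullet> v) K"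
      using usd_slice_fst[OF W_usd that] by (simp add: DW)
    then show ?thesis by (rule gradient_K[OF _ yK])
  qed
  have "- ((gc (x, y) + gV y + gW (y, z)) \<bullet> n) \<le> 0" if "z \<in> K" for z
  proof (rule continuous_le_on_closure[OF _ that])
    show "continuous_on K (\<lambda>z. - ((gc (x, y) + gV y + gW (y, z)) \<bullet> n))"
      by (intro continuous_intros continuous_on_section[OF gW_cont yK])
    fix z assume z: "z \<in> Y"
    then have zK: "z \<in> K" using closure_subset by blast
    show "- ((gc (x, y) + gV y + gW (y, z)) \<bullet> n) \<le> 0"
      using boundary[THEN bspec, OF x, THEN bspec, OF z, THEN bspec, OF y, THEN bspec, OF n]
      by (simp add: W1[OF zK] gradient_K[OF c_usd_snd[OF x] yK] gradient_K[OF V_usd yK])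
  qed
  then have "0 \<le> (\<integral>z. (gc (x, y) + gV y + gW (y, z)) \<bullet> n \<partial>\<nu>)"
    by (intro Bochner_Integration.integral_nonneg) (auto simp: space_Prob[OF \<nu>])
  also have "\<dots> = Gr \<nu> x y \<bullet> n"
    using integrable_K[OF \<nu> continuous_on_section[OF gW_cont yK]]
    by (simp add: Gr_def gF_def inner_add_left prob_space)
  finally show ?thesis .
qed

text \<open>Existence comes from minimising over \<open>K\<close>, uniqueness from strong
  monotonicity. The gradients in the definite description agree with \<open>Gr\<close> on
  \<open>K\<close>, which is enough because the description restricts to \<open>K\<close>.\<close>

lemma B_exists_unique:
  assumes \<nu>: "\<nu> \<in> Prob K" and x: "x \<in> X"
  shows "B \<nu> x \<in> K" "Gr \<nu> x (B \<nu> x) = 0"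
proof -
  have ex: "\<exists>y. y \<in> K \<and> Gr \<nu> x y = 0"
  proof (rule exists_critical_point[where h = "\<lambda>y. c x y + F \<nu> y" and g = "Gr \<nu> x", OF Y(2,3,4,1)])
    show "((\<lambda>y. c x y + F \<nu> y) has_derivative (\<lambda>v. Gr \<nu> x y \<bullet> v)) (at y within K)" if "y \<in> K" for y
      by (rule usd_has_derivative[OF total_usd[OF \<nu> x] that])
    show "0 \<le> Gr \<nu> x y \<bullet> n" if "y \<in> frontier Y" "n \<in> outward_unit_normals Y y" for y n
      by (rule Gr_boundary[OF \<nu> x that])
    show "\<exists>y. y \<in> K \<and> Gr \<nu> x y = 0" if "y \<in> K" "Gr \<nu> x y = 0" for y
      using that by (intro exI[of _ y] conjI)
  qed
  have uniq: "y = z" if "y \<in> K" "Gr \<nu> x y = 0" "z \<in> K" "Gr \<nu> x z = 0" for y z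
  proof -
    have "(\<eta> + \<kappa>) * (norm (y - z))\<^sup>2 \<le> 0" using Gr_mono[OF \<nu> x that(1,3)] that(2,4) by simp
    then show ?thesis using \<eta>(1) \<kappa> by (simp add: mult_le_0_iff)
  qed
  have "B \<nu> x = (THE y. y \<in> K \<and> Gr \<nu> x y = 0)"
    unfolding best_reply_def
  proof (rule arg_cong[where f = The], rule ext)
    show "(y \<in> K \<and> gradient (c x) (at y within K) + gradient (F \<nu>) (at y within K) = 0)
      = (y \<in> K \<and> Gr \<nu> x y = 0)" for y
      using gradient_K[OF c_usd_snd[OF x], of y] gradient_K[OF F_usd[OF \<nu>], of y]
      by (cases "y \<in> K") (simp_all add: Gr_def)
  qed
  moreover have "(THE y. y \<in> K \<and> Gr \<nu> x y = 0) \<in> K \<and> Gr \<nu> x (THE y. y \<in> K \<and> Gr \<nu> x y = 0) = 0"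
  proof (rule theI')
    obtain y where y: "y \<in> K \<and> Gr \<nu> x y = 0" using ex ..
    show "\<exists>!y. y \<in> K \<and> Gr \<nu> x y = 0"
      by (rule ex1I[where a = y]) (use uniq y in \<open>simp_all only: simp_thms\<close>)
  qed
  ultimately show "B \<nu> x \<in> K" "Gr \<nu> x (B \<nu> x) = 0" by (simp_all only: simp_thms)
qed

text \<open>Strong convexity of the cost faced by \<open>x\<close>, in the form that later turns a
  small energy gap into closeness to the best reply.\<close>

lemma B_growth:
  assumes \<nu>: "\<nu> \<in> Prob K" and x: "x \<in> X" and y: "y \<in> K"
  shows "c x (B \<nu> x) + F \<nu> (B \<nu> x) + (\<eta> + \<kappa>) / 2 * (norm (y - B \<nu> x))\<^sup>2 \<le> c x y + F \<nu> y"
proof (rule strongly_convex_growth[where h = "\<lambda>y. c x y + F \<nu> y" and g = "Gr \<nu> x", OF convex_K])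
  show "((\<lambda>y. c x y + F \<nu> y) has_derivative (\<lambda>v. Gr \<nu> x y \<bullet> v)) (at y within K)" if "y \<in> K" for y
    by (rule usd_has_derivative[OF total_usd[OF \<nu> x] that])
  show "(\<eta> + \<kappa>) * (norm (y - z))\<^sup>2 \<le> (Gr \<nu> x y - Gr \<nu> x z) \<bullet> (y - z)" if "y \<in> K" "z \<in> K" for y z
    by (rule Gr_mono[OF \<nu> x that])
qed (fact B_exists_unique[OF \<nu> x] y)+

text \<open>The value of \<open>B \<nu>\<close> at \<open>x0\<close> may still be a frontier point
  here, so coercivity of \<open>HG\<close> is deduced from monotonicity of \<open>Gr\<close> and not
  from a Hessian bound at that point.\<close>

lemma B_strict_derivative:
  assumes \<nu>: "\<nu> \<in> Prob K" and x0: "x0 \<in> X"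
  obtains L where "linear L" "\<And>e. e > 0 \<Longrightarrow> \<exists>d>0. \<forall>x\<in>ball x0 d. \<forall>y\<in>ball x0 d.
                   norm (B \<nu> x - B \<nu> y - L (x - y)) \<le> e * norm (x - y)"
proof -
  from X_ball[OF x0] obtain r where r: "r > 0" "ball x0 r \<subseteq> X" by (elim exE conjE)
  let ?S = "ball x0 r \<times> Y" and ?y0 = "B \<nu> x0"
  have S: "open ?S" "convex ?S" "?S \<subseteq> X \<times> Y"
    using r(2) Y(2,3) by (simp_all add: open_Times convex_Times Sigma_mono)
  have inS: "(x, y) \<in> closure ?S" if "x \<in> ball x0 r" "y \<in> K" for x y
    unfolding closure_Times by (rule SigmaI[OF subsetD[OF closure_subset that(1)] that(2)])
  have y0: "?y0 \<in> K" by (rule B_exists_unique[OF \<nu> x0])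
  have p0: "(x0, ?y0) \<in> closure ?S" using r y0 by (intro inS) auto
  have blD: "bounded_linear (Dgc (x0, ?y0))" by (rule usd_bounded_linear[OF gc_usd[OF S] p0])
  then have linD: "linear (Dgc (x0, ?y0))" by (rule bounded_linear.linear)
  have linA: "linear (\<lambda>u. Dgc (x0, ?y0) (u, 0))"
  proof (rule linearI)
    show "Dgc (x0, ?y0) (u + w, 0) = Dgc (x0, ?y0) (u, 0) + Dgc (x0, ?y0) (w, 0)" for u w
      using linear_add[OF linD, of "(u, 0)" "(w, 0)"] by simp
    show "Dgc (x0, ?y0) (r *\<^sub>R u, 0) = r *\<^sub>R Dgc (x0, ?y0) (u, 0)" for r u
      using linear_scale[OF linD, of r "(u, 0)"] by simp
  qed
  have linH: "linear (HG \<nu> x0 ?y0)"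
    using usd_bounded_linear[OF Gr_usd[OF \<nu> x0] y0] by (rule bounded_linear.linear)
  have strict0: "\<exists>d>0. \<forall>y\<in>K \<inter> ball ?y0 d. \<forall>z\<in>K \<inter> ball ?y0 d.
        norm (Gr \<nu> x0 y - Gr \<nu> x0 z - HG \<nu> x0 ?y0 (y - z)) \<le> e * norm (y - z)" if e: "e > 0" for e
  proof -
    obtain d where "d > 0" "\<And>p0 p q. p0 \<in> K \<Longrightarrow> p \<in> K \<Longrightarrow> q \<in> K \<Longrightarrow> dist p0 p < d \<Longrightarrow> dist p0 q < d \<Longrightarrow>
        norm (Gr \<nu> x0 p - Gr \<nu> x0 q - HG \<nu> x0 p0 (p - q)) \<le> e * norm (p - q)"
      by (rule usdD[OF Gr_usd[OF \<nu> x0] e]) blast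
    then show ?thesis using y0 by (intro exI[of _ d]) auto
  qed
  have coercive: "(\<eta> + \<kappa>) * (norm v)\<^sup>2 \<le> v \<bullet> HG \<nu> x0 ?y0 v" for v
    by (rule coercive_strict_derivative[OF Y(2) y0 linH Gr_mono[OF \<nu> x0] strict0])
  show thesis
  proof (rule implicit_strict_derivative[OF r B_exists_unique[OF \<nu>] _ Gr_mono[OF \<nu>] lc _ linA linH coercive])
    show "0 < \<eta> + \<kappa>" using \<eta>(1) \<kappa> by simp
    show "norm (Gr \<nu> x y - Gr \<nu> x' y) \<le> lc * norm (x - x')"
      if "x \<in> ball x0 r" "x' \<in> ball x0 r" "y \<in> K" for x x' y
      using gc_lip[OF S inS[OF that(1,3)] inS[OF that(2,3)]] by (simp add: Gr_def norm_Pair)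
    fix e :: real assume e: "e > 0"
    then have e2: "e / 2 > 0" by simp
    obtain d1 where d1: "d1 > 0" "\<And>p0 p q. p0 \<in> closure ?S \<Longrightarrow> p \<in> closure ?S \<Longrightarrow> q \<in> closure ?S \<Longrightarrow>
        dist p0 p < d1 \<Longrightarrow> dist p0 q < d1 \<Longrightarrow> norm (gc p - gc q - Dgc p0 (p - q)) \<le> e / 2 * norm (p - q)"
      by (rule usdD[OF gc_usd[OF S] e2]) blast
    obtain d2 where d2: "d2 > 0" "\<And>p0 p q. p0 \<in> K \<Longrightarrow> p \<in> K \<Longrightarrow> q \<in> K \<Longrightarrow> dist p0 p < d2 \<Longrightarrow> dist p0 q < d2 \<Longrightarrow>
        norm (gF \<nu> p - gF \<nu> q - HF \<nu> p0 (p - q)) \<le> e / 2 * norm (p - q)"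
      by (rule usdD[OF gF_usd[OF \<nu>] e2]) blast
    \<comment> \<open>Half of \<open>d1\<close>, because distance in the product is bounded by the
      sum of the two distances; \<open>r\<close> keeps the first coordinate in the ball on which
      \<open>gc\<close> is controlled.\<close>
    define d where "d = min r (min (d1 / 2) d2)"
    have "norm (Gr \<nu> x y - Gr \<nu> x' y' - (Dgc (x0, ?y0) (x - x', 0) + HG \<nu> x0 ?y0 (y - y')))
        \<le> e * (norm (x - x') + norm (y - y'))"
      if x: "x \<in> ball x0 d" "x' \<in> ball x0 d" and y: "y \<in> K \<inter> ball ?y0 d" "y' \<in> K \<inter> ball ?y0 d" for x x' y y'
    proof -
      have dd: "dist (x0, ?y0) (u, v) < d1" if "u \<in> ball x0 d" "v \<in> ball ?y0 d" for u v
      proof -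
        have "dist (x0, ?y0) (u, v) \<le> dist x0 u + dist ?y0 v"
          using norm_Pair_le[of "x0 - u" "?y0 - v"] by (simp add: dist_norm)
        also have "\<dots> < d1 / 2 + d1 / 2" using that by (intro add_strict_mono) (auto simp: d_def)
        finally show ?thesis by simp
      qed
      have "norm (gc (x, y) - gc (x', y') - Dgc (x0, ?y0) ((x, y) - (x', y'))) \<le> e / 2 * norm ((x, y) - (x', y'))"
        using x y by (intro d1 p0 inS dd) (auto simp: d_def)
      also have "\<dots> \<le> e / 2 * (norm (x - x') + norm (y - y'))"
        using e norm_Pair_le[of "x - x'" "y - y'"] by (intro mult_left_mono) auto
      finally have 1: "norm (gc (x, y) - gc (x', y') - Dgc (x0, ?y0) ((x, y) - (x', y'))) \<le> e / 2 * (norm (x - x') + norm (y - y'))" .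
      have "norm (gF \<nu> y - gF \<nu> y' - HF \<nu> ?y0 (y - y')) \<le> e / 2 * norm (y - y')"
        using y y0 by (intro d2) (auto simp: d_def)
      also have "\<dots> \<le> e / 2 * (norm (x - x') + norm (y - y'))" using e by (intro mult_left_mono) auto
      finally have 2: "norm (gF \<nu> y - gF \<nu> y' - HF \<nu> ?y0 (y - y')) \<le> e / 2 * (norm (x - x') + norm (y - y'))" .
      have "Dgc (x0, ?y0) ((x - x', 0) + (0, y - y')) = Dgc (x0, ?y0) (x - x', 0) + Dgc (x0, ?y0) (0, y - y')"
        by (rule linear_add[OF linD])
      then have "Gr \<nu> x y - Gr \<nu> x' y' - (Dgc (x0, ?y0) (x - x', 0) + HG \<nu> x0 ?y0 (y - y'))
        = (gc (x, y) - gc (x', y') - Dgc (x0, ?y0) ((x, y) - (x', y'))) + (gF \<nu> y - gF \<nu> y' - HF \<nu> ?y0 (y - y'))"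
        by (simp add: Gr_def HG_def)
      also have "norm \<dots> \<le> e / 2 * (norm (x - x') + norm (y - y')) + e / 2 * (norm (x - x') + norm (y - y'))"
        by (intro norm_triangle_mono 1 2)
      finally show ?thesis by (simp add: algebra_simps)
    qed
    then show "\<exists>d>0. \<forall>x\<in>ball x0 d. \<forall>x'\<in>ball x0 d. \<forall>y\<in>K \<inter> ball ?y0 d. \<forall>y'\<in>K \<inter> ball ?y0 d.
        norm (Gr \<nu> x y - Gr \<nu> x' y' - (Dgc (x0, ?y0) (x - x', 0) + HG \<nu> x0 ?y0 (y - y')))
          \<le> e * (norm (x - x') + norm (y - y'))"
      using r(1) d1(1) d2(1) by (intro exI[of _ d]) (auto simp: d_def)
  qed (use that in blast)+
qed

lemma M_bound: "\<nu> \<in> Prob K \<Longrightarrow> y \<in> Y \<Longrightarrow> hausdorff_measure (CARD('m) - CARD('n)) {x \<in> X. B \<nu> x = y} \<le> ennreal M"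
  and M_nonneg: "0 \<le> M"
proof -
  have *: "0 \<le> M \<and> h \<le> ennreal M" if "enn2ereal h \<le> ereal M" for h
  proof -
    have "0 \<le> ereal M" using enn2ereal_nonneg that by (rule order_trans)
    then have 0: "0 \<le> M" by simp
    have "e2ennreal (enn2ereal h) \<le> e2ennreal (ereal M)" using that by (rule e2ennreal_mono)
    then show ?thesis using 0 by (simp add: e2ennreal_ereal)
  qed
  show "\<nu> \<in> Prob K \<Longrightarrow> y \<in> Y \<Longrightarrow> hausdorff_measure (CARD('m) - CARD('n)) {x \<in> X. B \<nu> x = y} \<le> ennreal M"
    using *[OF fibres[THEN bspec, THEN bspec]] by blast
  \<comment> \<open>A Dirac mass is an admissible measure, and nonnegativity of the Hausdorff
    measure of one of its fibres forces \<open>0 \<le> M\<close>.\<close>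
  obtain y where y: "y \<in> Y" using Y(4) by blast
  have "return (restrict_space borel K) y \<in> Prob K"
    using y Y_K by (auto simp: Prob_iff space_restrict_space intro!: prob_space_return)
  from *[OF fibres[THEN bspec, OF this, THEN bspec, OF y]] show "0 \<le> M" ..
qed

text \<open>The facts build on one another: once the derivative exists, the hypothesis on the
  Jacobian becomes a bound on \<open>L\<close>, and this bound puts the value of
  \<open>B \<nu>\<close> in \<open>Y\<close>.\<close>

lemma B_derivative:
  assumes \<nu>: "\<nu> \<in> Prob K"
  obtains L where "\<And>x. x \<in> X \<Longrightarrow> linear (L x)"
    "\<And>x. x \<in> X \<Longrightarrow> k \<le> sqrt (det (matrix (L x) ** transpose (matrix (L x))))"
    "\<And>x0 e. x0 \<in> X \<Longrightarrow> e > 0 \<Longrightarrow> \<exists>d>0. \<forall>x\<in>ball x0 d. \<forall>y\<in>ball x0 d.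
                   norm (B \<nu> x - B \<nu> y - L x0 (x - y)) \<le> e * norm (x - y)"
    "\<And>x. x \<in> X \<Longrightarrow> B \<nu> x \<in> Y"
proof -
  define good where "good x0 L \<longleftrightarrow> linear L \<and> k \<le> sqrt (det (matrix L ** transpose (matrix L))) \<and>
      (\<forall>e>0. \<exists>d>0. \<forall>x\<in>ball x0 d. \<forall>y\<in>ball x0 d. norm (B \<nu> x - B \<nu> y - L (x - y)) \<le> e * norm (x - y)) \<and> B \<nu> x0 \<in> Y"
    for x0 L
  have "\<forall>x\<in>X. \<exists>L. good x L"
  proof
    fix x assume x: "x \<in> X"
    show "\<exists>L. good x L"
    proof (rule B_strict_derivative[OF \<nu> x])
      fix L assume L: "linear L" "\<And>e. e > 0 \<Longrightarrow> \<exists>d>0. \<forall>z\<in>ball x d. \<forall>y\<in>ball x d.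
                   norm (B \<nu> z - B \<nu> y - L (z - y)) \<le> e * norm (z - y)"
      have D: "(B \<nu> has_derivative L) (at x)"
        using L(1) by (intro strict_derivative_has_derivative L(2)) (simp_all add: linear_conv_bounded_linear)
      have "jacobian (B \<nu>) (at x) = matrix L"
        unfolding jacobian_def frechet_derivative_at[OF D, symmetric] ..
      then have J: "k \<le> sqrt (det (matrix L ** transpose (matrix L)))"
        using jac[THEN bspec, OF \<nu>, THEN bspec, OF x] by (simp add: jacobian_factor_def)
      then have "det (matrix L ** transpose (matrix L)) \<noteq> 0" using k by auto
      then have "B \<nu> x \<in> Y"
        using B_exists_unique(1)[OF \<nu>] by (intro interior_value_of_submersion[OF X(2) x Y(2,3,4) _ D])
      then have "good x L" unfolding good_def using L J by blast
      then show "\<exists>L. good x L" by (rule exI[of "good x"])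
    qed
  qed
  then obtain L where L: "\<forall>x\<in>X. good x (L x)" by (rule bchoice[THEN exE])
  show thesis
  proof (rule that[of L])
    show "\<exists>d>0. \<forall>x\<in>ball x0 d. \<forall>y\<in>ball x0 d. norm (B \<nu> x - B \<nu> y - L x0 (x - y)) \<le> e * norm (x - y)"
      if "x0 \<in> X" "e > 0" for x0 e
      using L[THEN bspec, OF that(1)] that(2) unfolding good_def by blast
  qed (use L in \<open>auto simp: good_def\<close>)
qed

lemma B_Y: "\<nu> \<in> Prob K \<Longrightarrow> x \<in> X \<Longrightarrow> B \<nu> x \<in> Y"
  by (rule B_derivative) assumption

lemma B_continuous:
  assumes \<nu>: "\<nu> \<in> Prob K" shows "continuous_on X (B \<nu>)"
proof (rule B_derivative[OF \<nu>])
  fix L assume L: "\<And>x. x \<in> X \<Longrightarrow> linear (L x)" "\<And>x0 e. x0 \<in> X \<Longrightarrow> e > 0 \<Longrightarrow> \<exists>d>0. \<forall>x\<in>ball x0 d. \<forall>y\<in>ball x0 d.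
                   norm (B \<nu> x - B \<nu> y - L x0 (x - y)) \<le> e * norm (x - y)"
  show "continuous_on X (B \<nu>)" by (rule continuous_on_strict_derivative[OF X(2) L])
qed

section \<open>Volume bounds for preimages under the best reply\<close>

lemma B_borel:
  assumes "\<nu> \<in> Prob K" shows "B \<nu> \<in> borel_measurable (restrict_space lborel X)"
  using borel_measurable_continuous_on_restrict[OF B_continuous[OF assms]]
  by (simp add: measurable_def space_restrict_space sets_restrict_space)

text \<open>Replacing \<open>E\<close> by \<open>E \<inter> Y\<close> does not change the preimage,
  and over \<open>Y\<close> the fibre bound is available.\<close>

lemma B_preimage_bound:
  assumes \<nu>: "\<nu> \<in> Prob K" and E: "E \<in> sets borel"
  shows "ennreal k * emeasure lborel {x\<in>X. B \<nu> x \<in> E} \<le> ennreal M * emeasure lborel (E \<inter> Y)"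
proof -
  have EY: "E \<inter> Y \<in> sets borel" using E Y(2) by simp
  have "B \<nu> -` (E \<inter> Y) \<inter> X \<in> sets (restrict_space borel X)"
    using measurable_sets[OF borel_measurable_continuous_on_restrict[OF B_continuous[OF \<nu>]] EY]
    by (simp add: space_restrict_space)
  then have "B \<nu> -` (E \<inter> Y) \<inter> X \<in> sets borel"
    using X(2) by (subst (asm) sets_restrict_space_iff) auto
  moreover have "B \<nu> -` (E \<inter> Y) \<inter> X = {x\<in>X. B \<nu> x \<in> E \<inter> Y}" by blast
  ultimately have XE: "{x\<in>X. B \<nu> x \<in> E \<inter> Y} \<in> sets borel" by (simp only:)
  have fib: "hausdorff_measure (CARD('m) - CARD('n)) {x\<in>X. B \<nu> x = y} \<le> ennreal M" if "y \<in> B \<nu> ` X" for y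
  proof -
    from that obtain x where "x \<in> X" "y = B \<nu> x" by (rule imageE)
    then have "y \<in> Y" using B_Y[OF \<nu>] by (simp only:)
    then show ?thesis by (rule M_bound[OF \<nu>])
  qed
  have "ennreal k * emeasure lborel {x\<in>X. B \<nu> x \<in> E \<inter> Y} \<le> ennreal M * emeasure lborel (E \<inter> Y)"
  proof (rule B_derivative[OF \<nu>])
    fix L assume L: "\<And>x. x \<in> X \<Longrightarrow> linear (L x)"
      "\<And>x. x \<in> X \<Longrightarrow> k \<le> sqrt (det (matrix (L x) ** transpose (matrix (L x))))"
      "\<And>x0 e. x0 \<in> X \<Longrightarrow> e > 0 \<Longrightarrow> \<exists>d>0. \<forall>x\<in>ball x0 d. \<forall>y\<in>ball x0 d.
                   norm (B \<nu> x - B \<nu> y - L x0 (x - y)) \<le> e * norm (x - y)"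
    show ?thesis
      by (rule coarea_inequality[OF card X(2,1) L(1) k L(2,3) fib EY XE])
  qed
  moreover have "{x\<in>X. B \<nu> x \<in> E \<inter> Y} = {x\<in>X. B \<nu> x \<in> E}"
    using B_Y[OF \<nu>] by blast
  ultimately show ?thesis by (simp only:)
qed

text \<open>Read as an inequality between measures, the bound on preimages extends to all
  nonnegative Borel integrands at once.\<close>

lemma B_pushforward_bound:
  assumes \<nu>: "\<nu> \<in> Prob K" and g: "g \<in> borel_measurable borel"
  shows "ennreal k * (\<integral>\<^sup>+x. g (B \<nu> x) \<partial>restrict_space lborel X) \<le> ennreal M * (\<integral>\<^sup>+y. g y * indicator Y y \<partial>lborel)"
proof -
  let ?R = "restrict_space lborel X"
  let ?N1 = "scale_measure (ennreal k) (distr ?R borel (B \<nu>))"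
  let ?N2 = "scale_measure (ennreal M) (density lborel (indicator Y))"
  have Ym: "indicator Y \<in> borel_measurable lborel" using Y(2) by simp
  have "?N1 \<le> ?N2"
  proof (subst le_measure)
    show "sets ?N1 = sets ?N2" by simp
    show "\<forall>E\<in>sets ?N1. emeasure ?N1 E \<le> emeasure ?N2 E"
    proof
      fix E assume "E \<in> sets ?N1"
      then have E: "E \<in> sets borel" by simp
      have "emeasure (distr ?R borel (B \<nu>)) E = emeasure ?R (B \<nu> -` E \<inter> X)"
        using B_borel[OF \<nu>] E by (subst emeasure_distr) (auto simp: space_restrict_space)
      also have "\<dots> = emeasure lborel (B \<nu> -` E \<inter> X)"
        using X(2) by (intro emeasure_restrict_space) auto
      also have "B \<nu> -` E \<inter> X = {x\<in>X. B \<nu> x \<in> E}" by blast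
      finally have 1: "emeasure ?N1 E = ennreal k * emeasure lborel {x\<in>X. B \<nu> x \<in> E}" by simp
      have "emeasure (density lborel (indicator Y)) E = emeasure lborel (E \<inter> Y)"
        using E Y(2) Ym by (subst emeasure_density)
          (auto simp: Int_commute indicator_inter_arith[symmetric] simp flip: nn_integral_indicator)
      then have 2: "emeasure ?N2 E = ennreal M * emeasure lborel (E \<inter> Y)" by simp
      show "emeasure ?N1 E \<le> emeasure ?N2 E"
        unfolding 1 2 by (rule B_preimage_bound[OF \<nu> E])
    qed
  qed
  then have "(\<integral>\<^sup>+y. g y \<partial>?N1) \<le> (\<integral>\<^sup>+y. g y \<partial>?N2)"
    by (intro nn_integral_mono_measure) simp_all
  moreover have "(\<integral>\<^sup>+y. g y \<partial>density lborel (indicator Y)) = (\<integral>\<^sup>+y. indicator Y y * g y \<partial>lborel)"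
    using g Ym by (intro nn_integral_density) simp_all
  ultimately show ?thesis
    using g B_borel[OF \<nu>]
    by (simp add: nn_integral_scale_measure nn_integral_distr mult.commute[of _ "indicator Y _"])
qed

text \<open>The density is almost everywhere at most its essential supremum; boundedness of
  \<open>X\<close> makes the reference measure finite.\<close>

lemma mu_bound:
  assumes f: "f \<in> borel_measurable (restrict_space lborel X)"
  shows "(\<integral>\<^sup>+x. f x \<partial>\<mu>) \<le> Linf_density X \<mu> * (\<integral>\<^sup>+x. f x \<partial>restrict_space lborel X)"
proof -
  let ?R = "restrict_space lborel X"
  have "emeasure ?R (space ?R) = emeasure lborel X"
    using X(2) by (subst emeasure_restrict_space) (auto simp: space_restrict_space)
  then interpret R: finite_measure ?R
    using emeasure_bounded_finite[OF X(1)] by (intro finite_measureI) auto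
  have sets: "sets \<mu> = sets ?R"
    using \<mu>(1) by (simp add: Prob_iff sets_restrict_space)
  have "(\<integral>\<^sup>+x. f x \<partial>\<mu>) = (\<integral>\<^sup>+x. RN_deriv ?R \<mu> x * f x \<partial>?R)"
    by (rule R.RN_deriv_nn_integral[OF \<mu>(2) sets f])
  also have "\<dots> \<le> (\<integral>\<^sup>+x. Linf_density X \<mu> * f x \<partial>?R)"
  proof (rule nn_integral_mono_AE)
    have "AE x in ?R. RN_deriv ?R \<mu> x \<le> Linf_density X \<mu>"
      unfolding Linf_density_def by (rule esssup_AE)
    then show "AE x in ?R. RN_deriv ?R \<mu> x * f x \<le> Linf_density X \<mu> * f x"
      by eventually_elim (rule mult_right_mono, simp_all)
  qed
  also have "\<dots> = Linf_density X \<mu> * (\<integral>\<^sup>+x. f x \<partial>?R)"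
    using f by (rule nn_integral_cmult)
  finally show ?thesis .
qed

sublocale \<mu>: prob_space \<mu>
  using \<mu>(1) by (simp add: Prob_iff)

abbreviation "RK \<equiv> restrict_space borel K"

lemma B_measurable:
  assumes "\<nu> \<in> Prob K" shows "B \<nu> \<in> measurable \<mu> RK"
  using measurable_Prob[OF \<mu>(1) B_continuous[OF assms]] B_exists_unique(1)[OF assms]
  by (intro measurable_restrict_space2) (auto simp: space_Prob[OF \<mu>(1)])

lemma Prob_distr:
  assumes "f \<in> measurable \<mu> RK" shows "distr \<mu> RK f \<in> Prob K"
  using assms by (simp add: Prob_iff \<mu>.prob_space_distr)

text \<open>No sign of \<open>C\<close> is assumed; the \<open>max 0\<close> allows inequalities to
  be multiplied by \<open>q\<close>.\<close>

definition q :: real where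
  "q = max 0 (enn2real (Linf_density X \<mu>) * M * C / (k * (\<eta> + \<kappa>)))"

lemma q: "0 \<le> q" "q < 1"
  using small k \<eta>(1) \<kappa> by (simp_all add: q_def)

lemma B_dist_pointwise:
  assumes \<nu>: "\<nu>\<^sub>0 \<in> Prob K" "\<nu>\<^sub>1 \<in> Prob K" and x: "x \<in> X"
  shows "(\<eta> + \<kappa>) * norm (B \<nu>\<^sub>1 x - B \<nu>\<^sub>0 x) \<le> norm (gF \<nu>\<^sub>1 (B \<nu>\<^sub>0 x) - gF \<nu>\<^sub>0 (B \<nu>\<^sub>0 x))"
proof (cases "B \<nu>\<^sub>1 x = B \<nu>\<^sub>0 x")
  case False
  let ?y0 = "B \<nu>\<^sub>0 x" and ?y1 = "B \<nu>\<^sub>1 x"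
  have "(\<eta> + \<kappa>) * (norm (?y1 - ?y0))\<^sup>2 \<le> (Gr \<nu>\<^sub>1 x ?y1 - Gr \<nu>\<^sub>1 x ?y0) \<bullet> (?y1 - ?y0)"
    by (rule Gr_mono[OF \<nu>(2) x B_exists_unique(1)[OF \<nu>(2) x] B_exists_unique(1)[OF \<nu>(1) x]])
  \<comment> \<open>Both replies are zeros of their own \<open>Gr\<close>, and after the exchange
    the part coming from \<open>c\<close> cancels.\<close>
  also have "Gr \<nu>\<^sub>1 x ?y1 - Gr \<nu>\<^sub>1 x ?y0 = Gr \<nu>\<^sub>0 x ?y0 - Gr \<nu>\<^sub>1 x ?y0"
    using B_exists_unique(2)[OF \<nu>(1) x] B_exists_unique(2)[OF \<nu>(2) x] by simp
  also have "\<dots> = gF \<nu>\<^sub>0 ?y0 - gF \<nu>\<^sub>1 ?y0" by (simp add: Gr_def)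
  also have "\<dots> \<bullet> (?y1 - ?y0) \<le> norm (gF \<nu>\<^sub>0 ?y0 - gF \<nu>\<^sub>1 ?y0) * norm (?y1 - ?y0)" by (rule norm_cauchy_schwarz)
  finally show ?thesis using False by (simp add: power2_eq_square norm_minus_commute)
qed simp

lemma B_dist_bound:
  assumes \<nu>: "\<nu>\<^sub>0 \<in> Prob K" "\<nu>\<^sub>1 \<in> Prob K"
  shows "(\<integral>x. norm (B \<nu>\<^sub>1 x - B \<nu>\<^sub>0 x) \<partial>\<mu>) \<le> q * wasserstein1 \<nu>\<^sub>1 \<nu>\<^sub>0"
proof -
  let ?w = "wasserstein1 \<nu>\<^sub>1 \<nu>\<^sub>0" and ?l = "enn2real (Linf_density X \<mu>)" and ?R = "restrict_space lborel X"
  have w: "0 \<le> ?w" using \<nu> by (intro wasserstein1_nonneg) (auto simp: Prob_iff)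
  \<comment> \<open>Cut off outside \<open>Y\<close> to be Borel on the whole space, as the
    push-forward bound requires; replies lie in \<open>Y\<close>, so nothing is lost.\<close>
  define D where "D y = indicator Y y * norm (gF \<nu>\<^sub>1 y - gF \<nu>\<^sub>0 y)" for y
  have D0: "0 \<le> D y" for y by (simp add: D_def)
  have cont: "continuous_on K (\<lambda>y. norm (gF \<nu>\<^sub>1 y - gF \<nu>\<^sub>0 y))"
    by (intro continuous_intros usd_continuous_on[OF gF_usd] \<nu>)
  have YK: "Y \<subseteq> K" by (rule closure_subset)
  have Dm: "D \<in> borel_measurable borel"
    using borel_measurable_continuous_on_indicator[OF borel_open[OF Y(2)] continuous_on_subset[OF cont YK]]
    by (simp add: D_def[abs_def])
  obtain b where b: "\<And>y. y \<in> K \<Longrightarrow> norm (gF \<nu>\<^sub>1 y - gF \<nu>\<^sub>0 y) \<le> b"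
    using compact_imp_bounded[OF compact_continuous_image[OF cont compact_K]] by (auto simp: bounded_iff)
  have Db: "D y \<le> b * indicator Y y" for y
    using b[OF Y_K, of y] by (simp add: D_def indicator_def)
  have intY: "integrable lborel (\<lambda>y. b * indicator Y y :: real)"
    using Y(2) emeasure_bounded_finite[OF Y(1)] by simp
  have intD: "integrable lborel D"
    by (rule Bochner_Integration.integrable_bound[OF intY]) (use Dm D0 Db in \<open>auto intro!: AE_I2 order_trans[OF Db abs_ge_self]\<close>)
  have "(LINT y:Y|lborel. norm (gradient (F \<nu>\<^sub>1) (at y) - gradient (F \<nu>\<^sub>0) (at y))) = (\<integral>y. D y \<partial>lborel)"
    unfolding set_lebesgue_integral_def
    using gradient_Y[OF F_usd[OF \<nu>(1)]] gradient_Y[OF F_usd[OF \<nu>(2)]]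
    by (intro Bochner_Integration.integral_cong) (auto simp: D_def indicator_def)
  then have ID: "(\<integral>y. D y \<partial>lborel) \<le> C * ?w"
    using F_lip[THEN bspec, OF \<nu>(1), THEN bspec, OF \<nu>(2)] by simp
  have nnD: "(\<integral>\<^sup>+y. ennreal (D y) * indicator Y y \<partial>lborel) \<le> ennreal (C * ?w)"
  proof -
    have "(\<integral>\<^sup>+y. ennreal (D y) * indicator Y y \<partial>lborel) = (\<integral>\<^sup>+y. ennreal (D y) \<partial>lborel)"
      by (intro nn_integral_cong) (auto simp: D_def indicator_def)
    also have "\<dots> = ennreal (\<integral>y. D y \<partial>lborel)"
      using intD D0 by (intro nn_integral_eq_integral) auto
    finally show ?thesis using ID by (simp add: ennreal_leI)
  qed
  have DB: "(\<lambda>x. ennreal (D (B \<nu>\<^sub>0 x))) \<in> borel_measurable ?R"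
    using measurable_compose[OF B_borel[OF \<nu>(1)] Dm] by simp
  let ?I = "\<integral>\<^sup>+x. ennreal (D (B \<nu>\<^sub>0 x)) \<partial>?R"
  have "ennreal k * ?I \<le> ennreal M * (\<integral>\<^sup>+y. ennreal (D y) * indicator Y y \<partial>lborel)"
    using Dm by (intro B_pushforward_bound[OF \<nu>(1)]) simp
  also have "\<dots> \<le> ennreal M * ennreal (C * ?w)" using nnD by (rule mult_left_mono) simp
  finally have kI: "ennreal k * ?I \<le> ennreal (M * (C * ?w))" using M_nonneg by (simp add: ennreal_mult')
  have "?I = ennreal (1 / k) * (ennreal k * ?I)" using k by (simp flip: mult.assoc ennreal_mult)
  also have "\<dots> \<le> ennreal (1 / k) * ennreal (M * (C * ?w))" using kI by (rule mult_left_mono) simp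
  also have "\<dots> = ennreal (M * (C * ?w) / k)" using k by (simp flip: ennreal_mult')
  finally have I: "?I \<le> ennreal (M * (C * ?w) / k)" .
  have "(\<integral>\<^sup>+x. ennreal ((\<eta> + \<kappa>) * norm (B \<nu>\<^sub>1 x - B \<nu>\<^sub>0 x)) \<partial>\<mu>) \<le> (\<integral>\<^sup>+x. ennreal (D (B \<nu>\<^sub>0 x)) \<partial>\<mu>)"
  proof (rule nn_integral_mono)
    fix x assume "x \<in> space \<mu>"
    then have x: "x \<in> X" by (simp add: space_Prob[OF \<mu>(1)])
    show "ennreal ((\<eta> + \<kappa>) * norm (B \<nu>\<^sub>1 x - B \<nu>\<^sub>0 x)) \<le> ennreal (D (B \<nu>\<^sub>0 x))"
      using B_dist_pointwise[OF \<nu> x] B_Y[OF \<nu>(1) x] by (intro ennreal_leI) (simp add: D_def)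
  qed
  also have "\<dots> \<le> Linf_density X \<mu> * ?I" by (rule mu_bound[OF DB])
  also have "Linf_density X \<mu> = ennreal ?l" using Linf by (simp add: less_top)
  also have "ennreal ?l * ?I \<le> ennreal ?l * ennreal (M * (C * ?w) / k)" using I by (rule mult_left_mono) simp
  also have "\<dots> = ennreal (?l * (M * (C * ?w) / k))" by (rule ennreal_mult'[symmetric]) simp
  also have "?l * (M * (C * ?w) / k) = (\<eta> + \<kappa>) * (?l * M * C / (k * (\<eta> + \<kappa>)) * ?w)"
  proof -
    have "a * (b * (d * w) / k) = s * (a * b * d / (k * s) * w)" if "s \<noteq> 0" for a b d w s :: real
      using k that by (simp add: field_simps)
    then show ?thesis using \<eta>(1) \<kappa> by simp
  qed
  \<comment> \<open>\<open>q\<close> is the maximum of zero and the quotient before it; enlarging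
    the factor is allowed because \<open>?w\<close> is nonnegative.\<close>
  also have "\<dots> \<le> (\<eta> + \<kappa>) * (q * ?w)"
    using \<eta>(1) \<kappa> w by (intro mult_left_mono mult_right_mono) (auto simp: q_def)
  finally have "(\<integral>\<^sup>+x. ennreal ((\<eta> + \<kappa>) * norm (B \<nu>\<^sub>1 x - B \<nu>\<^sub>0 x)) \<partial>\<mu>) \<le> ennreal ((\<eta> + \<kappa>) * (q * ?w))"
    by (simp add: ennreal_leI)
  moreover have "B \<nu>\<^sub>1 \<in> borel_measurable \<mu>" "B \<nu>\<^sub>0 \<in> borel_measurable \<mu>"
    using measurable_Prob[OF \<mu>(1) B_continuous] \<nu> by simp_all
  ultimately have "(\<integral>x. (\<eta> + \<kappa>) * norm (B \<nu>\<^sub>1 x - B \<nu>\<^sub>0 x) \<partial>\<mu>) \<le> (\<eta> + \<kappa>) * (q * ?w)"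
    using \<eta>(1) \<kappa> w q(1) by (intro integral_real_bounded) auto
  then show ?thesis using \<eta>(1) \<kappa> by simp
qed

end

section \<open>The contraction\<close>

lemma measurable_pair_restrict:
  fixes f :: "'a::second_countable_topology \<times> 'b::second_countable_topology \<Rightarrow> 'c::topological_space"
  assumes A: "sets A = sets (restrict_space borel S)" and B: "sets B = sets (restrict_space borel S')"
    and f: "continuous_on (S \<times> S') f"
  shows "f \<in> borel_measurable (A \<Otimes>\<^sub>M B)"
proof -
  have sp: "space A = S" "space B = S'"
    using sets_eq_imp_space_eq[OF A] sets_eq_imp_space_eq[OF B] by (simp_all add: space_restrict_space)
  have "(\<lambda>x. x) \<in> measurable (restrict_space borel S) borel" "(\<lambda>x. x) \<in> measurable (restrict_space borel S') borel"
    by (simp_all add: measurable_restrict_space1)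
  then have 1: "(\<lambda>x. x) \<in> measurable A borel" and 2: "(\<lambda>x. x) \<in> measurable B borel"
    using measurable_cong_sets[OF A refl] measurable_cong_sets[OF B refl] by blast+
  have "(\<lambda>p. (fst p, snd p)) \<in> measurable (A \<Otimes>\<^sub>M B) (borel \<Otimes>\<^sub>M borel)"
    using measurable_compose[OF measurable_fst 1] measurable_compose[OF measurable_snd 2] by (rule measurable_Pair)
  then have "(\<lambda>p. p) \<in> measurable (A \<Otimes>\<^sub>M B) borel" by (simp add: borel_prod)
  then have "(\<lambda>p. p) \<in> measurable (A \<Otimes>\<^sub>M B) (restrict_space borel (S \<times> S'))"
    by (rule measurable_restrict_space2[rotated]) (auto simp: space_pair_measure sp)
  from measurable_compose[OF this borel_measurable_continuous_on_restrict[OF f]] show ?thesis by simp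
qed

context best_reply_game
begin

abbreviation "T \<equiv> best_reply_measure c V W Y \<mu>"

lemma T_Prob: "\<nu> \<in> Prob K \<Longrightarrow> T \<nu> \<in> Prob K"
  unfolding best_reply_measure_def by (intro Prob_distr B_measurable)

lemma bounded_K: "\<exists>b. \<forall>y\<in>K. \<forall>z\<in>K. norm (y - z) \<le> b"
  using bounded_closure[OF Y(1)] unfolding bounded_two_points dist_norm by blast

lemma norm_diff_integrable:
  assumes f: "f \<in> measurable \<rho> RK" and g: "g \<in> measurable \<rho> RK" and \<rho>: "prob_space \<rho>"
  shows "integrable \<rho> (\<lambda>x. norm (f x - g x))"
proof -
  interpret prob_space \<rho> by fact
  from bounded_K obtain b where b: "\<forall>y\<in>K. \<forall>z\<in>K. norm (y - z) \<le> b" ..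
  have "f x \<in> K" "g x \<in> K" if "x \<in> space \<rho>" for x
    using measurable_space[OF f that] measurable_space[OF g that] by (simp_all add: space_restrict_space)
  moreover have "f \<in> borel_measurable \<rho>" "g \<in> borel_measurable \<rho>"
    using f g by (simp_all add: measurable_restrict_space2_iff)
  ultimately show ?thesis using b by (intro integrable_const_bound[of _ b]) auto
qed

lemma wasserstein1_distr_le:
  assumes f: "f \<in> measurable \<rho> RK" and g: "g \<in> measurable \<rho> RK" and \<rho>: "prob_space \<rho>"
  shows "wasserstein1 (distr \<rho> RK f) (distr \<rho> RK g) \<le> (\<integral>x. norm (f x - g x) \<partial>\<rho>)"
  using wasserstein1_le_maps[OF \<rho> bounded_closure[OF Y(1)] f g] by (simp add: dist_norm)

lemma distr_eq_of_L1:
  assumes f: "f \<in> measurable \<mu> RK" and g: "g \<in> measurable \<mu> RK" and le: "(\<integral>x. norm (f x - g x) \<partial>\<mu>) \<le> 0"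
  shows "distr \<mu> RK f = distr \<mu> RK g"
proof -
  have int: "integrable \<mu> (\<lambda>x. norm (f x - g x))" by (rule norm_diff_integrable[OF f g \<mu>.prob_space_axioms])
  have "(\<integral>x. norm (f x - g x) \<partial>\<mu>) = 0" using le by (intro antisym Bochner_Integration.integral_nonneg) auto
  then have "AE x in \<mu>. norm (f x - g x) = 0"
    by (subst (asm) integral_nonneg_eq_0_iff_AE[OF int]) auto
  then have "AE x in \<mu>. f x = g x" by eventually_elim simp
  then show ?thesis by (intro distr_cong_AE) (auto simp: f g)
qed

lemma T_contraction:
  assumes "\<nu>\<^sub>0 \<in> Prob K" "\<nu>\<^sub>1 \<in> Prob K"
  shows "wasserstein1 (T \<nu>\<^sub>1) (T \<nu>\<^sub>0) \<le> q * wasserstein1 \<nu>\<^sub>1 \<nu>\<^sub>0"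
  unfolding best_reply_measure_def
  using wasserstein1_distr_le[OF B_measurable[OF assms(2)] B_measurable[OF assms(1)] \<mu>.prob_space_axioms]
    B_dist_bound[OF assms] by (rule order_trans)

text \<open>The distance of two fixed points is at most the \<open>L1\<close> distance
  \<open>?D\<close> of their replies, while \<open>?D\<close> is at most \<open>q\<close> times that
  distance. Hence \<open>?D\<close> vanishes, the replies agree almost everywhere, and they push
  \<open>\<mu>\<close> to the same measure.\<close>

lemma fixed_point_unique:
  assumes \<nu>: "\<nu> \<in> Prob K" "T \<nu> = \<nu>" and \<nu>': "\<nu>' \<in> Prob K" "T \<nu>' = \<nu>'"
  shows "\<nu> = \<nu>'"
proof -
  let ?D = "\<integral>x. norm (B \<nu> x - B \<nu>' x) \<partial>\<mu>"
  have "wasserstein1 \<nu> \<nu>' = wasserstein1 (T \<nu>) (T \<nu>')" using \<nu>(2) \<nu>'(2) by simp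
  also have "\<dots> \<le> ?D"
    unfolding best_reply_measure_def
    by (rule wasserstein1_distr_le[OF B_measurable[OF \<nu>(1)] B_measurable[OF \<nu>'(1)] \<mu>.prob_space_axioms])
  finally have "q * wasserstein1 \<nu> \<nu>' \<le> q * ?D" using q(1) by (rule mult_left_mono)
  then have "?D \<le> q * ?D" using B_dist_bound[OF \<nu>'(1) \<nu>(1)] by simp
  then have "(1 - q) * ?D \<le> 0" by (simp add: algebra_simps)
  then have "?D \<le> 0" using q(2) by (simp add: mult_le_0_iff)
  then have "T \<nu> = T \<nu>'"
    unfolding best_reply_measure_def by (rule distr_eq_of_L1[OF B_measurable[OF \<nu>(1)] B_measurable[OF \<nu>'(1)]])
  then show ?thesis using \<nu>(2) \<nu>'(2) by simp
qed

text \<open>Iterating at the level of the maps \<open>B \<nu>\<close> in \<open>L\<^sup>1(\<mu>)\<close> needs neither the completeness of the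
  Wasserstein space nor the triangle inequality for \<open>\<W>\<^sub>1\<close>.\<close>

lemma fixed_point_exists: "\<exists>\<nu>\<in>Prob K. T \<nu> = \<nu>"
proof -
  obtain y0 where y0: "y0 \<in> Y" using Y(4) by blast
  from bounded_K obtain b where b: "\<forall>y\<in>K. \<forall>z\<in>K. norm (y - z) \<le> b" ..
  define s where "s n = (T ^^ n) (return RK y0)" for n
  have s: "s n \<in> Prob K" for n
  proof (induction n)
    case 0
    show ?case using y0 Y_K by (auto simp: s_def Prob_iff space_restrict_space intro!: prob_space_return)
  next
    case (Suc n)
    then show ?case using T_Prob by (simp add: s_def)
  qed
  define f where "f n = B (s n)" for n
  have f: "f n \<in> measurable \<mu> RK" for n unfolding f_def by (rule B_measurable[OF s])
  have fb: "f n \<in> borel_measurable \<mu>" for n using f[of n] by (simp add: measurable_restrict_space2_iff)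
  have fK: "f n x \<in> K" if "x \<in> space \<mu>" for n x
    using measurable_space[OF f that] by (simp add: space_restrict_space)
  have s_Suc: "s (Suc n) = distr \<mu> RK (f n)" for n
    by (simp add: s_def f_def best_reply_measure_def)
  \<comment> \<open>These successive distances decay geometrically, so the summed increments have
    finite integral and converge absolutely almost everywhere.\<close>
  define a where "a n = (\<integral>x. norm (f (Suc n) x - f n x) \<partial>\<mu>)" for n
  have int: "integrable \<mu> (\<lambda>x. norm (f i x - f j x))" for i j
    by (rule norm_diff_integrable[OF f f \<mu>.prob_space_axioms])
  have a_Suc: "a (Suc n) \<le> q * a n" for n
  proof -
    have "a (Suc n) \<le> q * wasserstein1 (s (Suc (Suc n))) (s (Suc n))"
      unfolding a_def f_def by (rule B_dist_bound[OF s s])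
    also have "\<dots> \<le> q * a n"
      unfolding a_def s_Suc using q(1) by (intro mult_left_mono wasserstein1_distr_le f \<mu>.prob_space_axioms)
    finally show ?thesis .
  qed
  have a: "a n \<le> q ^ n * a 0" for n
  proof (induction n)
    case (Suc n)
    have "q * a n \<le> q * (q ^ n * a 0)" using Suc q(1) by (rule mult_left_mono)
    then show ?case using a_Suc[of n] by simp
  qed simp
  have a0: "0 \<le> a n" for n unfolding a_def by (intro Bochner_Integration.integral_nonneg) simp
  have "(\<integral>\<^sup>+x. (\<Sum>n. ennreal (norm (f (Suc n) x - f n x))) \<partial>\<mu>) = (\<Sum>n. \<integral>\<^sup>+x. ennreal (norm (f (Suc n) x - f n x)) \<partial>\<mu>)"
    using fb by (intro nn_integral_suminf) measurable
  also have "\<dots> = (\<Sum>n. ennreal (a n))"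
    unfolding a_def by (intro suminf_cong nn_integral_eq_integral int) simp
  also have "\<dots> \<le> (\<Sum>n. ennreal (q ^ n * a 0))"
    using a by (intro suminf_le ennreal_leI) auto
  also have "\<dots> = ennreal (\<Sum>n. q ^ n * a 0)"
    using q a0 by (intro suminf_ennreal2 summable_mult2 summable_geometric mult_nonneg_nonneg) auto
  finally have "(\<integral>\<^sup>+x. (\<Sum>n. ennreal (norm (f (Suc n) x - f n x))) \<partial>\<mu>) \<noteq> \<infinity>"
    by (auto simp: top_unique)
  then have "AE x in \<mu>. (\<Sum>n. ennreal (norm (f (Suc n) x - f n x))) \<noteq> \<infinity>"
    using fb by (intro nn_integral_noteq_infinite) measurable
  then have conv: "AE x in \<mu>. convergent (\<lambda>n. f n x)"
  proof eventually_elim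
    fix x assume "(\<Sum>n. ennreal (norm (f (Suc n) x - f n x))) \<noteq> \<infinity>"
    then have "summable (\<lambda>n. norm (f (Suc n) x - f n x))"
      by (intro summable_suminf_not_top) auto
    then have "summable (\<lambda>n. f (Suc n) x - f n x)" by (rule summable_norm_cancel)
    then obtain l where "(\<lambda>n. \<Sum>i<n. f (Suc i) x - f i x) \<longlonglongrightarrow> l"
      by (auto simp: summable_def sums_def)
    then have "(\<lambda>n. f n x - f 0 x) \<longlonglongrightarrow> l" by (simp only: sum_lessThan_telescope[of "\<lambda>n. f n x"])
    then have "(\<lambda>n. f n x - f 0 x + f 0 x) \<longlonglongrightarrow> l + f 0 x" by (intro tendsto_add tendsto_const)
    then show "convergent (\<lambda>n. f n x)" by (auto simp: convergent_def)
  qed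
  \<comment> \<open>The fallback \<open>y0\<close> matters on a null set only; with it
    \<open>h\<close> maps everything into \<open>K\<close>, so that its law is in
    \<open>Prob K\<close>.\<close>
  define h where "h x = (if lim (\<lambda>n. f n x) \<in> K then lim (\<lambda>n. f n x) else y0)" for x
  have lm: "(\<lambda>x. lim (\<lambda>n. f n x)) \<in> borel_measurable \<mu>"
    using fb by (rule borel_measurable_lim_metric)
  have hb: "h \<in> borel_measurable \<mu>"
  proof -
    have [measurable]: "K \<in> sets borel" by simp
    note lm[measurable]
    show ?thesis unfolding h_def by measurable
  qed
  have hK: "h x \<in> K" for x using Y_K[OF y0] by (simp add: h_def)
  have h: "h \<in> measurable \<mu> RK" using hb hK by (intro measurable_restrict_space2) auto
  define d where "d n = (\<integral>x. norm (f n x - h x) \<partial>\<mu>)" for n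
  have fh: "AE x in \<mu>. (\<lambda>n. norm (f n x - h x)) \<longlonglongrightarrow> 0"
    using conv AE_space
  proof eventually_elim
    fix x assume x: "convergent (\<lambda>n. f n x)" "x \<in> space \<mu>"
    then have L: "(\<lambda>n. f n x) \<longlonglongrightarrow> lim (\<lambda>n. f n x)" by (simp add: convergent_LIMSEQ_iff)
    have "lim (\<lambda>n. f n x) \<in> K"
      by (rule closed_sequentially[OF closed_closure _ L]) (rule fK[OF x(2)])
    then have "(\<lambda>n. f n x) \<longlonglongrightarrow> h x" using L by (simp add: h_def)
    then show "(\<lambda>n. norm (f n x - h x)) \<longlonglongrightarrow> 0"
      by (intro tendsto_norm_zero) (simp add: LIM_zero)
  qed
  have "d \<longlonglongrightarrow> (\<integral>x. 0 \<partial>\<mu>)"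
    unfolding d_def
  proof (rule integral_dominated_convergence[where w = "\<lambda>_. b"])
    show "AE x in \<mu>. norm (norm (f n x - h x)) \<le> b" for n
      using AE_space by eventually_elim (use b fK hK in simp)
  qed (use fh fb hb in auto)
  then have d0: "d \<longlonglongrightarrow> 0" by simp
  let ?\<nu> = "distr \<mu> RK h"
  have \<nu>: "?\<nu> \<in> Prob K" by (rule Prob_distr[OF h])
  let ?D = "\<integral>x. norm (B ?\<nu> x - h x) \<partial>\<mu>"
  have Bm: "B ?\<nu> \<in> measurable \<mu> RK" by (rule B_measurable[OF \<nu>])
  \<comment> \<open>The reply to the law of \<open>h\<close> is compared with \<open>h\<close>
    through the iterate \<open>f (Suc n)\<close>, which is the reply to the law of
    \<open>f n\<close>.\<close>
  have "?D \<le> q * d n + d (Suc n)" for n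
  proof -
    have i1: "integrable \<mu> (\<lambda>x. norm (B ?\<nu> x - f (Suc n) x))" and i2: "integrable \<mu> (\<lambda>x. norm (f (Suc n) x - h x))"
      and i3: "integrable \<mu> (\<lambda>x. norm (B ?\<nu> x - h x))"
      by (rule norm_diff_integrable[OF _ _ \<mu>.prob_space_axioms]; fact Bm f h)+
    have tri: "norm (u - w) \<le> norm (u - v) + norm (v - w)" for u v w :: "real ^ 'n"
      using norm_triangle_ineq[of "u - v" "v - w"] by simp
    have "?D \<le> (\<integral>x. norm (B ?\<nu> x - f (Suc n) x) + norm (f (Suc n) x - h x) \<partial>\<mu>)"
      using i1 i2 i3 by (intro Bochner_Integration.integral_mono Bochner_Integration.integrable_add) (auto intro: tri)
    also have "\<dots> = (\<integral>x. norm (B ?\<nu> x - f (Suc n) x) \<partial>\<mu>) + d (Suc n)"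
      unfolding d_def using i1 i2 by (rule Bochner_Integration.integral_add)
    also have "(\<integral>x. norm (B ?\<nu> x - f (Suc n) x) \<partial>\<mu>) \<le> q * wasserstein1 ?\<nu> (s (Suc n))"
      unfolding f_def by (rule B_dist_bound[OF s \<nu>])
    also have "wasserstein1 ?\<nu> (s (Suc n)) \<le> (\<integral>x. norm (h x - f n x) \<partial>\<mu>)"
      unfolding s_Suc by (rule wasserstein1_distr_le[OF h f \<mu>.prob_space_axioms])
    also have "\<dots> = d n" unfolding d_def by (simp add: norm_minus_commute)
    finally show ?thesis using q(1) by (simp add: mult_left_mono)
  qed
  moreover have "(\<lambda>n. q * d n + d (Suc n)) \<longlonglongrightarrow> q * 0 + 0"
    using d0 LIMSEQ_Suc[OF d0] by (intro tendsto_intros)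
  ultimately have "?D \<le> q * 0 + 0" by (intro LIMSEQ_le_const) auto
  then have "T ?\<nu> = ?\<nu>"
    unfolding best_reply_measure_def by (intro distr_eq_of_L1[OF Bm h]) simp
  with \<nu> show ?thesis by blast
qed

end

section \<open>Minimality of the fixed point\<close>

text \<open>Push-forward commutes with mixing, and both plans have the same first marginal, which
  mixing leaves alone.\<close>

lemma mixture_coupling:
  assumes \<gamma>: "\<gamma> \<in> couplings \<mu> \<nu>" and \<gamma>': "\<gamma>' \<in> couplings \<mu> \<nu>'" and \<mu>: "prob_space \<mu>"
    and \<nu>: "prob_space \<nu>" and \<nu>': "prob_space \<nu>'" "sets \<nu>' = sets \<nu>"
  shows "mixture t \<gamma> \<gamma>' \<in> couplings \<mu> (mixture t \<nu> \<nu>')"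
proof -
  let ?N = "\<mu> \<Otimes>\<^sub>M \<nu>" and ?\<nu> = "mixture t \<nu> \<nu>'"
  have s: "sets \<gamma> = sets ?N" using \<gamma> by (simp add: couplings_def)
  have "sets (\<mu> \<Otimes>\<^sub>M \<nu>') = sets ?N" by (rule sets_pair_measure_cong[OF refl \<nu>'(2)])
  then have s': "sets \<gamma>' = sets ?N" using \<gamma>' by (simp add: couplings_def)
  have p: "prob_space \<gamma>" "prob_space \<gamma>'"
    using couplings_prob_space[OF \<gamma> \<mu>] couplings_prob_space[OF \<gamma>' \<mu>] .
  have sn: "sets ?\<nu> = sets \<nu>" by (rule sets_mixture[OF \<nu> refl \<nu>'])
  have "sets (\<mu> \<Otimes>\<^sub>M ?\<nu>) = sets ?N" by (rule sets_pair_measure_cong[OF refl sn])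
  then have 1: "sets (mixture t \<gamma> \<gamma>') = sets (\<mu> \<Otimes>\<^sub>M ?\<nu>)"
    using sets_mixture[OF p(1) s p(2) s'] by simp
  have "distr (mixture t \<gamma> \<gamma>') \<mu> fst = mixture t (distr \<gamma> \<mu> fst) (distr \<gamma>' \<mu> fst)"
    by (rule distr_mixture[OF p(1) s p(2) s' measurable_fst])
  then have 2: "distr (mixture t \<gamma> \<gamma>') \<mu> fst = \<mu>"
    using \<gamma> \<gamma>' mixture_same[OF \<mu>] by (simp add: couplings_def)
  have "snd \<in> measurable ?N ?\<nu>"
    using measurable_snd[of \<mu> \<nu>] measurable_cong_sets[OF refl sn] by blast
  then have "distr (mixture t \<gamma> \<gamma>') ?\<nu> snd = mixture t (distr \<gamma> ?\<nu> snd) (distr \<gamma>' ?\<nu> snd)"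
    by (rule distr_mixture[OF p(1) s p(2) s'])
  also have "distr \<gamma> ?\<nu> snd = distr \<gamma> \<nu> snd" by (rule distr_cong[OF refl sn refl])
  also have "\<dots> = \<nu>" using \<gamma> by (simp add: couplings_def)
  also have "distr \<gamma>' ?\<nu> snd = distr \<gamma>' \<nu>' snd"
    using sn \<nu>'(2) by (intro distr_cong) simp_all
  also have "\<dots> = \<nu>'" using \<gamma>' by (simp add: couplings_def)
  finally have 3: "distr (mixture t \<gamma> \<gamma>') ?\<nu> snd = ?\<nu>" .
  show ?thesis unfolding couplings_def using 1 2 3 by simp
qed

section \<open>The energy, its interaction term and transport plans\<close>

context best_reply_game
begin

abbreviation "J \<equiv> total_cost c V W \<mu>"

definition "w \<nu> y = (\<integral>z. W y z \<partial>\<nu>)"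

text \<open>Taken with two arguments so that mixtures expand bilinearly and the symmetry of
  \<open>W\<close> merges the cross terms.\<close>

definition "I \<nu> \<nu>' = (\<integral>y. w \<nu>' y \<partial>\<nu>)"

lemma J_eq: "J \<nu> = transport_cost c \<mu> \<nu> + (\<integral>y. V y \<partial>\<nu>) + 1 / 2 * I \<nu> \<nu>"
  by (simp add: total_cost_def I_def w_def)

lemma F_eq: "F \<nu> y = V y + w \<nu> y"
  by (simp add: first_variation_def w_def)

lemma V_cont: "continuous_on K V"
  by (rule usd_continuous_on[OF V_usd])

lemma w_cont:
  assumes "\<nu> \<in> Prob K" shows "continuous_on K (w \<nu>)"
proof -
  have "w \<nu> = (\<lambda>y. F \<nu> y - V y)" by (simp add: F_eq fun_eq_iff)
  then show ?thesis
    using usd_continuous_on[OF F_usd[OF assms]] V_cont by (simp add: continuous_on_diff)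
qed

lemma W_cont_section: "y \<in> K \<Longrightarrow> continuous_on K (W y)"
  using continuous_on_section[OF W_cont] by simp

lemma c_bound: "\<exists>b. \<forall>x\<in>X. \<forall>y\<in>K. \<bar>c x y\<bar> \<le> b"
proof -
  have "compact (closure X \<times> K)" using X(1) compact_K by (intro compact_Times) auto
  then have "bounded ((\<lambda>p. c (fst p) (snd p)) ` (closure X \<times> K))"
    by (intro compact_imp_bounded compact_continuous_image[OF c_cont])
  then obtain b where b: "\<forall>z\<in>(\<lambda>p. c (fst p) (snd p)) ` (closure X \<times> K). norm z \<le> b"
    unfolding bounded_iff ..
  have "\<bar>c x y\<bar> \<le> b" if "x \<in> X" "y \<in> K" for x y
    using b[THEN bspec, OF imageI[of "(x, y)"]] that closure_subset[of X] by auto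
  then show ?thesis by blast
qed

lemma bound_K:
  fixes f :: "real ^ 'n \<Rightarrow> real"
  assumes "continuous_on K f" shows "\<exists>b. \<forall>y\<in>K. \<bar>f y\<bar> \<le> b"
  using compact_imp_bounded[OF compact_continuous_image[OF assms compact_K]] by (auto simp: bounded_iff)

lemma W_bound: "\<exists>b. \<forall>y\<in>K. \<forall>z\<in>K. \<bar>W y z\<bar> \<le> b"
proof -
  have "bounded ((\<lambda>p. W (fst p) (snd p)) ` (K \<times> K))"
    by (intro compact_imp_bounded compact_continuous_image[OF W_cont] compact_Times compact_K)
  then obtain b where b: "\<forall>z\<in>(\<lambda>p. W (fst p) (snd p)) ` (K \<times> K). norm z \<le> b"
    unfolding bounded_iff ..
  have "\<bar>W y z\<bar> \<le> b" if "y \<in> K" "z \<in> K" for y z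
    using b[THEN bspec, OF imageI[of "(y, z)"]] that by auto
  then show ?thesis by blast
qed

lemma abs_integral_Prob_le:
  fixes f :: "real ^ 'n \<Rightarrow> real"
  assumes \<nu>: "\<nu> \<in> Prob K" and f: "continuous_on K f" and b: "\<And>y. y \<in> K \<Longrightarrow> \<bar>f y\<bar> \<le> b"
  shows "\<bar>\<integral>y. f y \<partial>\<nu>\<bar> \<le> b"
proof -
  interpret prob_space \<nu> using \<nu> by (simp add: Prob_iff)
  have "norm (\<integral>y. f y \<partial>\<nu>) \<le> (\<integral>y. b \<partial>\<nu>)"
    using b by (intro Bochner_Integration.integral_norm_bound_integral integrable_K[OF \<nu> f]) (auto simp: space_Prob[OF \<nu>])
  then show ?thesis by (simp add: prob_space)
qed

lemma w_bound:
  assumes "\<nu> \<in> Prob K" "\<And>y z. y \<in> K \<Longrightarrow> z \<in> K \<Longrightarrow> \<bar>W y z\<bar> \<le> b" "y \<in> K" shows "\<bar>w \<nu> y\<bar> \<le> b"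
  unfolding w_def by (rule abs_integral_Prob_le[OF assms(1) W_cont_section[OF assms(3)] assms(2)[OF assms(3)]])

lemma I_bound:
  assumes "\<nu> \<in> Prob K" "\<nu>' \<in> Prob K" "\<And>y z. y \<in> K \<Longrightarrow> z \<in> K \<Longrightarrow> \<bar>W y z\<bar> \<le> b" shows "\<bar>I \<nu> \<nu>'\<bar> \<le> b"
  unfolding I_def by (rule abs_integral_Prob_le[OF assms(1) w_cont[OF assms(2)] w_bound[OF assms(2,3)]])

lemma w_lipschitz:
  assumes \<nu>: "\<nu> \<in> Prob K" and y: "y \<in> K" "y' \<in> K"
  shows "\<bar>w \<nu> y - w \<nu> y'\<bar> \<le> lW * norm (y - y')"
proof -
  have i: "integrable \<nu> (W y)" "integrable \<nu> (W y')"
    by (rule integrable_K[OF \<nu> W_cont_section[OF y(1)]], rule integrable_K[OF \<nu> W_cont_section[OF y(2)]])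
  then have "w \<nu> y - w \<nu> y' = (\<integral>z. W y z - W y' z \<partial>\<nu>)" by (simp add: w_def)
  also have "\<bar>\<dots>\<bar> \<le> lW * norm (y - y')"
  proof (rule abs_integral_Prob_le[OF \<nu>])
    show "continuous_on K (\<lambda>z. W y z - W y' z)" using W_cont_section y by (intro continuous_on_diff) auto
    show "\<bar>W y z - W y' z\<bar> \<le> lW * norm (y - y')" if "z \<in> K" for z
      using W_lip[of "(y, z)" "(y', z)"] y that by (simp add: norm_Pair)
  qed
  finally show ?thesis .
qed

lemma I_sym:
  assumes \<nu>: "\<nu> \<in> Prob K" and \<nu>': "\<nu>' \<in> Prob K" shows "I \<nu> \<nu>' = I \<nu>' \<nu>"
proof -
  interpret \<nu>: prob_space \<nu> using \<nu> by (simp add: Prob_iff)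
  interpret \<nu>': prob_space \<nu>' using \<nu>' by (simp add: Prob_iff)
  interpret pair_prob_space \<nu> \<nu>' ..
  obtain b where b: "\<forall>y\<in>K. \<forall>z\<in>K. \<bar>W y z\<bar> \<le> b" using W_bound ..
  have "(\<lambda>p. W (fst p) (snd p)) \<in> borel_measurable (\<nu> \<Otimes>\<^sub>M \<nu>')"
    using \<nu> \<nu>' by (intro measurable_pair_restrict[OF _ _ W_cont]) (auto simp: Prob_iff)
  then have "integrable (\<nu> \<Otimes>\<^sub>M \<nu>') (\<lambda>p. W (fst p) (snd p))"
    using b by (intro P.integrable_const_bound[of _ b]) (auto simp: space_pair_measure space_Prob[OF \<nu>] space_Prob[OF \<nu>'])
  then have "integrable (\<nu> \<Otimes>\<^sub>M \<nu>') (\<lambda>(y, z). W y z)" by (simp only: case_prod_unfold)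
  from Fubini_integral[OF this] have "I \<nu> \<nu>' = (\<integral>z. (\<integral>y. W y z \<partial>\<nu>) \<partial>\<nu>')"
    by (simp add: I_def w_def)
  also have "\<dots> = I \<nu>' \<nu>"
    unfolding I_def w_def
  proof (intro Bochner_Integration.integral_cong refl)
    show "W y z = W z y" if "z \<in> space \<nu>'" "y \<in> space \<nu>" for y z
      using W_sym that space_Prob[OF \<nu>] space_Prob[OF \<nu>'] by simp
  qed
  finally show ?thesis .
qed

text \<open>A plan \<open>\<gamma>\<close> serves as common probability space: \<open>snd\<close>
  has law \<open>\<nu>\<close>, and \<open>B \<nu>'\<close> after \<open>fst\<close> has law
  \<open>T \<nu>'\<close>. A competitor and a best reply are thus compared by integrals over
  \<open>\<gamma>\<close>.\<close>

context
  fixes \<nu> \<gamma>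
  assumes \<nu>: "\<nu> \<in> Prob K" and \<gamma>: "\<gamma> \<in> couplings \<mu> \<nu>"
begin

lemma \<gamma>_prob: "prob_space \<gamma>"
  by (rule couplings_prob_space[OF \<gamma> \<mu>.prob_space_axioms])

lemma space_\<gamma>: "space \<gamma> = X \<times> K"
  using couplings_measurable(3)[OF \<gamma>] space_Prob[OF \<nu>] space_Prob[OF \<mu>(1)] by simp

lemma snd_\<gamma>: "snd \<in> measurable \<gamma> RK"
  using couplings_measurable(2)[OF \<gamma>] \<nu> measurable_cong_sets[of \<gamma> \<gamma> \<nu> RK] by (simp add: Prob_iff)

lemma distr_snd_\<gamma>: "distr \<gamma> RK snd = \<nu>"
proof -
  have "distr \<gamma> RK snd = distr \<gamma> \<nu> snd" using \<nu> by (intro distr_cong) (auto simp: Prob_iff)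
  then show ?thesis using \<gamma> by (simp add: couplings_def)
qed

lemma B_fst_\<gamma>:
  assumes "\<nu>' \<in> Prob K"
  shows "(\<lambda>p. B \<nu>' (fst p)) \<in> measurable \<gamma> RK" "distr \<gamma> RK (\<lambda>p. B \<nu>' (fst p)) = T \<nu>'"
proof -
  show "(\<lambda>p. B \<nu>' (fst p)) \<in> measurable \<gamma> RK"
    by (rule measurable_compose[OF couplings_measurable(1)[OF \<gamma>] B_measurable[OF assms]])
  have "distr \<gamma> RK (\<lambda>p. B \<nu>' (fst p)) = distr (distr \<gamma> \<mu> fst) RK (B \<nu>')"
    by (subst distr_distr[OF B_measurable[OF assms] couplings_measurable(1)[OF \<gamma>]]) (simp add: o_def)
  also have "distr \<gamma> \<mu> fst = \<mu>" using \<gamma> by (simp add: couplings_def)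
  finally show "distr \<gamma> RK (\<lambda>p. B \<nu>' (fst p)) = T \<nu>'" by (simp add: best_reply_measure_def)
qed

lemma integrable_\<gamma>:
  fixes f :: "(real ^ 'm) \<times> (real ^ 'n) \<Rightarrow> real"
  assumes f: "continuous_on (X \<times> K) f" and b: "\<And>x y. x \<in> X \<Longrightarrow> y \<in> K \<Longrightarrow> \<bar>f (x, y)\<bar> \<le> b"
  shows "integrable \<gamma> f"
proof -
  interpret prob_space \<gamma> by (rule \<gamma>_prob)
  have s: "sets \<gamma> = sets (\<mu> \<Otimes>\<^sub>M \<nu>)" using \<gamma> by (simp add: couplings_def)
  have "f \<in> borel_measurable (\<mu> \<Otimes>\<^sub>M \<nu>)"
    using \<mu>(1) \<nu> by (intro measurable_pair_restrict[OF _ _ f]) (auto simp: Prob_iff)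
  then have "f \<in> borel_measurable \<gamma>" using measurable_cong_sets[OF s refl] by blast
  then show ?thesis using b by (intro integrable_const_bound[of _ b]) (auto simp: space_\<gamma>)
qed

lemma c_integrable_\<gamma>: "integrable \<gamma> (\<lambda>p. c (fst p) (snd p))"
proof -
  obtain b where b: "\<forall>x\<in>X. \<forall>y\<in>K. \<bar>c x y\<bar> \<le> b" using c_bound ..
  have "continuous_on (X \<times> K) (\<lambda>p. c (fst p) (snd p))"
    using c_cont by (rule continuous_on_subset) (use closure_subset in blast)
  then show ?thesis using b by (intro integrable_\<gamma>[of _ b]) auto
qed

lemma K_integrable_\<gamma>:
  fixes g :: "real ^ 'n \<Rightarrow> real"
  assumes g: "continuous_on K g" and h: "h \<in> measurable \<gamma> RK"
  shows "integrable \<gamma> (\<lambda>p. g (h p))"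
proof -
  interpret prob_space \<gamma> by (rule \<gamma>_prob)
  obtain b where b: "\<forall>y\<in>K. \<bar>g y\<bar> \<le> b" using bound_K[OF g] ..
  have "(\<lambda>p. g (h p)) \<in> borel_measurable \<gamma>"
    by (rule measurable_compose[OF h borel_measurable_continuous_on_restrict[OF g]])
  moreover have "h p \<in> K" if "p \<in> space \<gamma>" for p
    using measurable_space[OF h that] by (simp add: space_restrict_space)
  ultimately show ?thesis using b by (intro integrable_const_bound[of _ b]) auto
qed

lemma integral_distr_RK:
  fixes g :: "real ^ 'n \<Rightarrow> real"
  assumes g: "continuous_on K g" and h: "h \<in> measurable \<gamma> RK"
  shows "(\<integral>y. g y \<partial>distr \<gamma> RK h) = (\<integral>p. g (h p) \<partial>\<gamma>)"
  by (rule integral_distr[OF h borel_measurable_continuous_on_restrict[OF g]])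

text \<open>Along the graph of \<open>B \<nu>'\<close> the cost is a function of the first
  coordinate alone, so it can be integrated against any plan with first marginal
  \<open>\<mu>\<close>, in particular against \<open>\<gamma>\<close>.\<close>

lemma c_B_\<gamma>:
  assumes \<nu>': "\<nu>' \<in> Prob K"
  shows "integrable \<gamma> (\<lambda>p. c (fst p) (B \<nu>' (fst p)))"
    "transport_cost c \<mu> (T \<nu>') \<le> (\<integral>p. c (fst p) (B \<nu>' (fst p)) \<partial>\<gamma>)"
    "distr \<mu> (\<mu> \<Otimes>\<^sub>M T \<nu>') (\<lambda>x. (x, B \<nu>' x)) \<in> couplings \<mu> (T \<nu>')"
    "(\<integral>p. c (fst p) (snd p) \<partial>distr \<mu> (\<mu> \<Otimes>\<^sub>M T \<nu>') (\<lambda>x. (x, B \<nu>' x))) = (\<integral>p. c (fst p) (B \<nu>' (fst p)) \<partial>\<gamma>)"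
proof -
  obtain b where b: "\<forall>x\<in>X. \<forall>y\<in>K. \<bar>c x y\<bar> \<le> b" using c_bound ..
  have cXK: "continuous_on (X \<times> K) (\<lambda>p. c (fst p) (snd p))"
    using c_cont by (rule continuous_on_subset) (use closure_subset in blast)
  have cB: "continuous_on X (\<lambda>x. c x (B \<nu>' x))"
  proof -
    have "continuous_on X (\<lambda>x. (x, B \<nu>' x))" by (intro continuous_on_Pair continuous_on_id B_continuous[OF \<nu>'])
    from continuous_on_compose2[OF cXK this] show ?thesis using B_exists_unique(1)[OF \<nu>'] by auto
  qed
  have "continuous_on (X \<times> K) (\<lambda>p. c (fst p) (B \<nu>' (fst p)))"
    by (rule continuous_on_compose2[OF cB continuous_on_fst[OF continuous_on_id]]) auto
  then show "integrable \<gamma> (\<lambda>p. c (fst p) (B \<nu>' (fst p)))"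
    using b B_exists_unique(1)[OF \<nu>'] by (intro integrable_\<gamma>[of _ b]) auto
  have TP: "T \<nu>' \<in> Prob K" by (rule T_Prob[OF \<nu>'])
  have Bm: "B \<nu>' \<in> measurable \<mu> (T \<nu>')"
    using B_measurable[OF \<nu>'] measurable_cong_sets[of \<mu> \<mu> "T \<nu>'" RK] TP by (simp add: Prob_iff)
  have "distr \<mu> (T \<nu>') (B \<nu>') = T \<nu>'"
    using TP unfolding best_reply_measure_def by (intro distr_cong) (auto simp: Prob_iff)
  then show cpl: "distr \<mu> (\<mu> \<Otimes>\<^sub>M T \<nu>') (\<lambda>x. (x, B \<nu>' x)) \<in> couplings \<mu> (T \<nu>')"
    by (intro couplingsI_maps Bm measurable_ident) (simp_all add: distr_id2)
  have "(\<lambda>p. c (fst p) (snd p)) \<in> borel_measurable (\<mu> \<Otimes>\<^sub>M T \<nu>')"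
    using \<mu>(1) TP by (intro measurable_pair_restrict[OF _ _ cXK]) (auto simp: Prob_iff)
  then have "(\<integral>p. c (fst p) (snd p) \<partial>distr \<mu> (\<mu> \<Otimes>\<^sub>M T \<nu>') (\<lambda>x. (x, B \<nu>' x))) = (\<integral>x. c x (B \<nu>' x) \<partial>\<mu>)"
    using Bm by (subst integral_distr) auto
  also have "\<dots> = (\<integral>p. c (fst p) (B \<nu>' (fst p)) \<partial>\<gamma>)"
    by (rule couplings_integral_fst[OF \<gamma> measurable_Prob[OF \<mu>(1) cB], symmetric])
  finally show eq: "(\<integral>p. c (fst p) (snd p) \<partial>distr \<mu> (\<mu> \<Otimes>\<^sub>M T \<nu>') (\<lambda>x. (x, B \<nu>' x))) = (\<integral>p. c (fst p) (B \<nu>' (fst p)) \<partial>\<gamma>)" .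
  have "transport_cost c \<mu> (T \<nu>') \<le> (\<integral>p. c (fst p) (snd p) \<partial>distr \<mu> (\<mu> \<Otimes>\<^sub>M T \<nu>') (\<lambda>x. (x, B \<nu>' x)))"
    using b by (intro transport_cost_le[OF \<mu>.prob_space_axioms _ cpl, of _ b]) (auto simp: space_Prob[OF \<mu>(1)] space_Prob[OF TP])
  then show "transport_cost c \<mu> (T \<nu>') \<le> (\<integral>p. c (fst p) (B \<nu>' (fst p)) \<partial>\<gamma>)" unfolding eq .
qed

end

section \<open>Comparing energies along mixtures and couplings\<close>

lemma J_le:
  assumes \<nu>: "\<nu> \<in> Prob K" and \<gamma>: "\<gamma> \<in> couplings \<mu> \<nu>"
  shows "J \<nu> \<le> (\<integral>p. c (fst p) (snd p) \<partial>\<gamma>) + (\<integral>y. V y \<partial>\<nu>) + 1 / 2 * I \<nu> \<nu>"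
proof -
  obtain b where b: "\<forall>x\<in>X. \<forall>y\<in>K. \<bar>c x y\<bar> \<le> b" using c_bound ..
  have "transport_cost c \<mu> \<nu> \<le> (\<integral>p. c (fst p) (snd p) \<partial>\<gamma>)"
    using b by (intro transport_cost_le[OF \<mu>.prob_space_axioms _ \<gamma>, of _ b]) (auto simp: space_Prob[OF \<mu>(1)] space_Prob[OF \<nu>])
  then show ?thesis by (simp add: J_eq)
qed

lemma F_integral:
  assumes \<nu>: "\<nu> \<in> Prob K" and \<nu>': "\<nu>' \<in> Prob K"
  shows "(\<integral>y. F \<nu>' y \<partial>\<nu>) = (\<integral>y. V y \<partial>\<nu>) + I \<nu> \<nu>'"
  unfolding F_eq I_def using integrable_K[OF \<nu> V_cont] integrable_K[OF \<nu> w_cont[OF \<nu>']]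
  by (rule Bochner_Integration.integral_add)

lemma mixture_Prob:
  assumes \<nu>: "\<nu> \<in> Prob K" and \<nu>': "\<nu>' \<in> Prob K"
  shows "mixture t \<nu> \<nu>' \<in> Prob K"
  using sets_mixture[of \<nu> RK \<nu>' t] prob_space_mixture[of \<nu> RK \<nu>' t] assms by (simp add: Prob_iff)

lemma integral_mixture_K:
  assumes \<nu>: "\<nu> \<in> Prob K" and \<nu>': "\<nu>' \<in> Prob K" and t: "0 \<le> t" "t \<le> 1" and f: "continuous_on K f"
  shows "(\<integral>y. f y \<partial>mixture t \<nu> \<nu>') = (1 - t) * (\<integral>y. f y \<partial>\<nu>) + t * (\<integral>y. f y \<partial>\<nu>')"
proof -
  obtain b where b: "\<forall>y\<in>K. \<bar>f y\<bar> \<le> b" using bound_K[OF f] ..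
  show ?thesis
    by (rule integral_mixture[OF _ _ _ _ t borel_measurable_continuous_on_restrict[OF f], of _ _ b])
      (use \<nu> \<nu>' b in \<open>auto simp: Prob_iff space_restrict_space\<close>)
qed

text \<open>A mixture of plans is an admissible plan, so the transport part is bounded by an
  expression affine in \<open>t\<close>; the interaction part is an exact quadratic polynomial in
  \<open>t\<close>.\<close>

lemma J_mixture_le:
  assumes \<nu>: "\<nu> \<in> Prob K" and \<gamma>: "\<gamma> \<in> couplings \<mu> \<nu>" and \<nu>': "\<nu>' \<in> Prob K" and \<gamma>': "\<gamma>' \<in> couplings \<mu> \<nu>'"
    and t: "0 \<le> t" "t \<le> 1"
  shows "J (mixture t \<nu> \<nu>') \<le>
      ((1 - t) * (\<integral>p. c (fst p) (snd p) \<partial>\<gamma>) + t * (\<integral>p. c (fst p) (snd p) \<partial>\<gamma>')) +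
      ((1 - t) * (\<integral>y. V y \<partial>\<nu>) + t * (\<integral>y. V y \<partial>\<nu>')) +
      1 / 2 * ((1 - t) * ((1 - t) * I \<nu> \<nu> + t * I \<nu>' \<nu>) + t * ((1 - t) * I \<nu>' \<nu> + t * I \<nu>' \<nu>'))"
proof -
  let ?\<nu> = "mixture t \<nu> \<nu>'" and ?\<gamma> = "mixture t \<gamma> \<gamma>'"
  have p: "prob_space \<nu>" "prob_space \<nu>'" "sets \<nu>' = sets \<nu>" using \<nu> \<nu>' by (auto simp: Prob_iff)
  have P: "?\<nu> \<in> Prob K" by (rule mixture_Prob[OF \<nu> \<nu>'])
  have cpl: "?\<gamma> \<in> couplings \<mu> ?\<nu>" by (rule mixture_coupling[OF \<gamma> \<gamma>' \<mu>.prob_space_axioms p])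
  obtain b where b: "\<forall>x\<in>X. \<forall>y\<in>K. \<bar>c x y\<bar> \<le> b" using c_bound ..
  have s: "sets \<gamma> = sets (\<mu> \<Otimes>\<^sub>M \<nu>)" using \<gamma> by (simp add: couplings_def)
  have "sets (\<mu> \<Otimes>\<^sub>M \<nu>') = sets (\<mu> \<Otimes>\<^sub>M \<nu>)" by (rule sets_pair_measure_cong[OF refl p(3)])
  then have s': "sets \<gamma>' = sets (\<mu> \<Otimes>\<^sub>M \<nu>)" using \<gamma>' by (simp add: couplings_def)
  have cXK: "continuous_on (X \<times> K) (\<lambda>p. c (fst p) (snd p))"
    using c_cont by (rule continuous_on_subset) (use closure_subset in blast)
  have cm: "(\<lambda>p. c (fst p) (snd p)) \<in> borel_measurable (\<mu> \<Otimes>\<^sub>M \<nu>)"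
    using \<mu>(1) \<nu> by (intro measurable_pair_restrict[OF _ _ cXK]) (auto simp: Prob_iff)
  have c: "(\<integral>p. c (fst p) (snd p) \<partial>?\<gamma>) = (1 - t) * (\<integral>p. c (fst p) (snd p) \<partial>\<gamma>) + t * (\<integral>p. c (fst p) (snd p) \<partial>\<gamma>')"
    by (rule integral_mixture[OF couplings_prob_space[OF \<gamma> \<mu>.prob_space_axioms] s
          couplings_prob_space[OF \<gamma>' \<mu>.prob_space_axioms] s' t cm, of b])
      (use b in \<open>auto simp: space_pair_measure space_Prob[OF \<nu>] space_Prob[OF \<mu>(1)]\<close>)
  have w: "w ?\<nu> y = (1 - t) * w \<nu> y + t * w \<nu>' y" if "y \<in> K" for y
    unfolding w_def by (rule integral_mixture_K[OF \<nu> \<nu>' t W_cont_section[OF that]])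
  have I: "I \<rho> ?\<nu> = (1 - t) * I \<rho> \<nu> + t * I \<rho> \<nu>'" if \<rho>: "\<rho> \<in> Prob K" for \<rho>
  proof -
    have "I \<rho> ?\<nu> = (\<integral>y. (1 - t) * w \<nu> y + t * w \<nu>' y \<partial>\<rho>)"
      unfolding I_def by (intro Bochner_Integration.integral_cong refl w) (simp add: space_Prob[OF \<rho>])
    also have "\<dots> = (1 - t) * I \<rho> \<nu> + t * I \<rho> \<nu>'"
      unfolding I_def using integrable_K[OF \<rho> w_cont[OF \<nu>]] integrable_K[OF \<rho> w_cont[OF \<nu>']]
      by (subst Bochner_Integration.integral_add) auto
    finally show ?thesis .
  qed
  have "I ?\<nu> ?\<nu> = (1 - t) * I \<nu> ?\<nu> + t * I \<nu>' ?\<nu>"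
    unfolding I_def[of _ ?\<nu>] by (rule integral_mixture_K[OF \<nu> \<nu>' t w_cont[OF P]])
  then have II: "I ?\<nu> ?\<nu> = (1 - t) * ((1 - t) * I \<nu> \<nu> + t * I \<nu>' \<nu>) + t * ((1 - t) * I \<nu>' \<nu> + t * I \<nu>' \<nu>')"
    unfolding I[OF \<nu>] I[OF \<nu>'] I_sym[OF \<nu> \<nu>'] .
  show ?thesis
    using J_le[OF P cpl] unfolding c integral_mixture_K[OF \<nu> \<nu>' t V_cont] II .
qed

text \<open>An approximate Euler--Lagrange equation: testing an almost minimiser \<open>\<nu>\<close> against
  mixtures with its best reply forces an almost optimal plan to lie close to the graph of \<open>B \<nu>\<close>.\<close>

lemma near_minimizer_near_graph:
  assumes \<nu>: "\<nu> \<in> Prob K" and \<gamma>: "\<gamma> \<in> couplings \<mu> \<nu>" and t: "0 < t" "t \<le> 1"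
    and near: "\<And>\<nu>'. \<nu>' \<in> Prob K \<Longrightarrow> J \<nu> \<le> J \<nu>' + t\<^sup>2"
    and opt: "(\<integral>p. c (fst p) (snd p) \<partial>\<gamma>) \<le> transport_cost c \<mu> \<nu> + t\<^sup>2"
    and bW: "\<And>y z. y \<in> K \<Longrightarrow> z \<in> K \<Longrightarrow> \<bar>W y z\<bar> \<le> bW"
  shows "(\<eta> + \<kappa>) / 2 * (\<integral>p. (norm (snd p - B \<nu> (fst p)))\<^sup>2 \<partial>\<gamma>) \<le> (2 + 2 * bW) * t"
proof -
  interpret \<gamma>: prob_space \<gamma> by (rule \<gamma>_prob[OF \<nu> \<gamma>])
  let ?\<nu>' = "T \<nu>" and ?\<gamma>' = "distr \<mu> (\<mu> \<Otimes>\<^sub>M T \<nu>) (\<lambda>x. (x, B \<nu> x))"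
  have \<nu>': "?\<nu>' \<in> Prob K" by (rule T_Prob[OF \<nu>])
  have \<gamma>': "?\<gamma>' \<in> couplings \<mu> ?\<nu>'" by (rule c_B_\<gamma>(3)[OF \<nu> \<gamma> \<nu>])
  define P where "P = (\<integral>p. c (fst p) (snd p) \<partial>\<gamma>)"
  define P' where "P' = (\<integral>p. c (fst p) (snd p) \<partial>?\<gamma>')"
  define v where "v = (\<integral>y. V y \<partial>\<nu>)"
  define v' where "v' = (\<integral>y. V y \<partial>?\<nu>')"
  define a where "a = I \<nu> \<nu>"
  define b where "b = I ?\<nu>' \<nu>"
  define d where "d = I ?\<nu>' ?\<nu>'"
  have mix: "J \<nu> \<le> ((1 - t) * P + t * P') + ((1 - t) * v + t * v') +
      1 / 2 * ((1 - t) * ((1 - t) * a + t * b) + t * ((1 - t) * b + t * d)) + t\<^sup>2"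
    using near[OF mixture_Prob[OF \<nu> \<nu>', of t]] J_mixture_le[OF \<nu> \<gamma> \<nu>' \<gamma>', of t] t
    unfolding P_def P'_def v_def v'_def a_def b_def d_def by linarith
  have "J \<nu> = transport_cost c \<mu> \<nu> + v + 1 / 2 * a" by (simp add: J_eq v_def a_def)
  with opt have low: "P - t\<^sup>2 + v + 1 / 2 * a \<le> J \<nu>" by (simp add: P_def)
  have "\<bar>a\<bar> \<le> bW" "\<bar>b\<bar> \<le> bW" "\<bar>d\<bar> \<le> bW"
    unfolding a_def b_def d_def by (rule I_bound[OF \<nu> \<nu> bW] I_bound[OF \<nu>' \<nu> bW] I_bound[OF \<nu>' \<nu>' bW]; assumption)+
  \<comment> \<open>Twice the coefficient of \<open>t\<^sup>2\<close> in the energy bound along the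
    mixture. Its sign is unknown, as the energy need not be convex, but it is bounded.\<close>
  then have "a - 2 * b + d \<le> 4 * bW" by linarith
  then have abd: "t\<^sup>2 * (a - 2 * b + d) \<le> t\<^sup>2 * (4 * bW)" by (rule mult_left_mono) simp
  \<comment> \<open>Up to sign the left-hand side is the first-order change of the energy bound
    towards the best reply. All errors are of order \<open>t\<^sup>2\<close>, so division by
    \<open>t\<close> leaves order \<open>t\<close>; this is why the slack in the hypotheses is
    \<open>t\<^sup>2\<close>.\<close>
  have "t * ((P + v + a) - (P' + v' + b)) =
      (P + v + 1 / 2 * a) - (((1 - t) * P + t * P') + ((1 - t) * v + t * v') +
      1 / 2 * ((1 - t) * ((1 - t) * a + t * b) + t * ((1 - t) * b + t * d))) + 1 / 2 * (t\<^sup>2 * (a - 2 * b + d))"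
    by (simp add: field_simps power2_eq_square)
  also have "\<dots> \<le> 2 * t\<^sup>2 + 1 / 2 * (t\<^sup>2 * (4 * bW))" using mix low abd by linarith
  also have "\<dots> = t * ((2 + 2 * bW) * t)" by (simp add: algebra_simps power2_eq_square)
  finally have gap: "(P + v + a) - (P' + v' + b) \<le> (2 + 2 * bW) * t" using t(1) by simp
  have Fc: "continuous_on K (F \<nu>)" by (rule usd_continuous_on[OF F_usd[OF \<nu>]])
  note Bm = B_fst_\<gamma>[OF \<nu> \<gamma> \<nu>]
  have i1: "integrable \<gamma> (\<lambda>p. c (fst p) (snd p))" by (rule c_integrable_\<gamma>[OF \<nu> \<gamma>])
  have i2: "integrable \<gamma> (\<lambda>p. F \<nu> (snd p))" by (rule K_integrable_\<gamma>[OF \<nu> \<gamma> Fc snd_\<gamma>[OF \<nu> \<gamma>]])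
  have i3: "integrable \<gamma> (\<lambda>p. c (fst p) (B \<nu> (fst p)))" by (rule c_B_\<gamma>(1)[OF \<nu> \<gamma> \<nu>])
  have i4: "integrable \<gamma> (\<lambda>p. F \<nu> (B \<nu> (fst p)))" by (rule K_integrable_\<gamma>[OF \<nu> \<gamma> Fc Bm(1)])
  have "(\<integral>p. F \<nu> (snd p) \<partial>\<gamma>) = v + a"
    using integral_distr_RK[OF \<nu> \<gamma> Fc snd_\<gamma>[OF \<nu> \<gamma>]] unfolding distr_snd_\<gamma>[OF \<nu> \<gamma>] F_integral[OF \<nu> \<nu>] v_def a_def ..
  moreover have "(\<integral>p. F \<nu> (B \<nu> (fst p)) \<partial>\<gamma>) = v' + b"
    using integral_distr_RK[OF \<nu> \<gamma> Fc Bm(1)] unfolding Bm(2) F_integral[OF \<nu>' \<nu>] v'_def b_def ..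
  moreover have "(\<integral>p. c (fst p) (B \<nu> (fst p)) \<partial>\<gamma>) = P'"
    unfolding P'_def by (rule c_B_\<gamma>(4)[OF \<nu> \<gamma> \<nu>, symmetric])
  ultimately have total: "(\<integral>p. (c (fst p) (snd p) + F \<nu> (snd p)) - (c (fst p) (B \<nu> (fst p)) + F \<nu> (B \<nu> (fst p))) \<partial>\<gamma>)
      = (P + v + a) - (P' + v' + b)"
    using i1 i2 i3 i4 by (simp add: P_def)
  have "(\<integral>p. (\<eta> + \<kappa>) / 2 * (norm (snd p - B \<nu> (fst p)))\<^sup>2 \<partial>\<gamma>)
    \<le> (\<integral>p. (c (fst p) (snd p) + F \<nu> (snd p)) - (c (fst p) (B \<nu> (fst p)) + F \<nu> (B \<nu> (fst p))) \<partial>\<gamma>)"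
  proof (rule integral_mono')
    show "integrable \<gamma> (\<lambda>p. (c (fst p) (snd p) + F \<nu> (snd p)) - (c (fst p) (B \<nu> (fst p)) + F \<nu> (B \<nu> (fst p))))"
      using i1 i2 i3 i4 by simp
    fix p assume "p \<in> space \<gamma>"
    then have "fst p \<in> X" "snd p \<in> K" by (auto simp: space_\<gamma>[OF \<nu> \<gamma>])
    from B_growth[OF \<nu> this]
    show le: "(\<eta> + \<kappa>) / 2 * (norm (snd p - B \<nu> (fst p)))\<^sup>2
        \<le> (c (fst p) (snd p) + F \<nu> (snd p)) - (c (fst p) (B \<nu> (fst p)) + F \<nu> (B \<nu> (fst p)))" by simp
    have "0 \<le> (\<eta> + \<kappa>) / 2 * (norm (snd p - B \<nu> (fst p)))\<^sup>2" using \<eta>(1) \<kappa> by simp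
    then show "0 \<le> (c (fst p) (snd p) + F \<nu> (snd p)) - (c (fst p) (B \<nu> (fst p)) + F \<nu> (B \<nu> (fst p)))"
      using le by (rule order_trans)
  qed
  then show ?thesis using total gap by simp
qed

text \<open>As a fixed point, \<open>\<nu>'\<close> is the law of \<open>B \<nu>'\<close> after
  \<open>fst\<close> under \<open>\<gamma>\<close>, so both integrals become integrals over
  \<open>\<gamma>\<close>.\<close>

lemma lipschitz_integral_le:
  assumes \<nu>: "\<nu> \<in> Prob K" and \<gamma>: "\<gamma> \<in> couplings \<mu> \<nu>" and \<nu>': "\<nu>' \<in> Prob K" "T \<nu>' = \<nu>'"
    and g: "continuous_on K g" and lip: "\<And>y y'. y \<in> K \<Longrightarrow> y' \<in> K \<Longrightarrow> \<bar>g y - g y'\<bar> \<le> l * norm (y - y')"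
  shows "(\<integral>y. g y \<partial>\<nu>') \<le> (\<integral>y. g y \<partial>\<nu>) + l * (\<integral>p. norm (snd p - B \<nu>' (fst p)) \<partial>\<gamma>)"
proof -
  note Bm = B_fst_\<gamma>[OF \<nu> \<gamma> \<nu>'(1)] and Sm = snd_\<gamma>[OF \<nu> \<gamma>]
  have n: "integrable \<gamma> (\<lambda>p. norm (snd p - B \<nu>' (fst p)))"
    by (rule norm_diff_integrable[OF Sm Bm(1) \<gamma>_prob[OF \<nu> \<gamma>]])
  have i: "integrable \<gamma> (\<lambda>p. g (snd p))" "integrable \<gamma> (\<lambda>p. g (B \<nu>' (fst p)))"
    by (rule K_integrable_\<gamma>[OF \<nu> \<gamma> g Sm], rule K_integrable_\<gamma>[OF \<nu> \<gamma> g Bm(1)])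
  have "(\<integral>y. g y \<partial>\<nu>') = (\<integral>p. g (B \<nu>' (fst p)) \<partial>\<gamma>)"
    using integral_distr_RK[OF \<nu> \<gamma> g Bm(1)] unfolding Bm(2) \<nu>'(2) .
  also have "\<dots> \<le> (\<integral>p. g (snd p) + l * norm (snd p - B \<nu>' (fst p)) \<partial>\<gamma>)"
  proof (rule Bochner_Integration.integral_mono[OF i(2)])
    show "integrable \<gamma> (\<lambda>p. g (snd p) + l * norm (snd p - B \<nu>' (fst p)))" using i n by simp
    fix p assume "p \<in> space \<gamma>"
    then have "fst p \<in> X" "snd p \<in> K" by (auto simp: space_\<gamma>[OF \<nu> \<gamma>])
    then show "g (B \<nu>' (fst p)) \<le> g (snd p) + l * norm (snd p - B \<nu>' (fst p))"
      using lip[of "snd p" "B \<nu>' (fst p)"] B_exists_unique(1)[OF \<nu>'(1)] by (simp add: abs_le_iff)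
  qed
  also have "\<dots> = (\<integral>p. g (snd p) \<partial>\<gamma>) + l * (\<integral>p. norm (snd p - B \<nu>' (fst p)) \<partial>\<gamma>)"
    using i n by simp
  also have "(\<integral>p. g (snd p) \<partial>\<gamma>) = (\<integral>y. g y \<partial>\<nu>)"
    using integral_distr_RK[OF \<nu> \<gamma> g Sm] unfolding distr_snd_\<gamma>[OF \<nu> \<gamma>] ..
  finally show ?thesis .
qed

lemma c_lip_snd:
  assumes x: "x \<in> X" and y: "y \<in> K" "y' \<in> K" shows "\<bar>c x y - c x y'\<bar> \<le> lc * norm (y - y')"
proof -
  from X_ball[OF x] obtain r where r: "r > 0" "ball x r \<subseteq> X" by (elim exE conjE)
  let ?S = "ball x r \<times> Y"
  have S: "open ?S" "convex ?S" "?S \<subseteq> X \<times> Y"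
    using r(2) Y(2,3) by (simp_all add: open_Times convex_Times Sigma_mono)
  have "x \<in> closure (ball x r)" using r(1) by (intro subsetD[OF closure_subset]) simp
  then have "(x, y) \<in> closure ?S" "(x, y') \<in> closure ?S" using y by (simp_all add: closure_Times)
  from c_lip[OF S this] show ?thesis by (simp add: norm_Pair)
qed

lemma J_fixed_point_le:
  assumes \<nu>: "\<nu> \<in> Prob K" and \<gamma>: "\<gamma> \<in> couplings \<mu> \<nu>" and \<nu>': "\<nu>' \<in> Prob K" "T \<nu>' = \<nu>'"
  shows "J \<nu>' \<le> (\<integral>p. c (fst p) (snd p) \<partial>\<gamma>) + (\<integral>y. V y \<partial>\<nu>) + 1 / 2 * I \<nu> \<nu>
      + (lc + lV + lW) * (\<integral>p. norm (snd p - B \<nu>' (fst p)) \<partial>\<gamma>)"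
proof -
  let ?D = "\<integral>p. norm (snd p - B \<nu>' (fst p)) \<partial>\<gamma>"
  note Bm = B_fst_\<gamma>[OF \<nu> \<gamma> \<nu>'(1)] and Sm = snd_\<gamma>[OF \<nu> \<gamma>]
  have n: "integrable \<gamma> (\<lambda>p. norm (snd p - B \<nu>' (fst p)))"
    by (rule norm_diff_integrable[OF Sm Bm(1) \<gamma>_prob[OF \<nu> \<gamma>]])
  have "transport_cost c \<mu> \<nu>' \<le> (\<integral>p. c (fst p) (B \<nu>' (fst p)) \<partial>\<gamma>)"
    using c_B_\<gamma>(2)[OF \<nu> \<gamma> \<nu>'(1)] unfolding \<nu>'(2) .
  also have "\<dots> \<le> (\<integral>p. c (fst p) (snd p) + lc * norm (snd p - B \<nu>' (fst p)) \<partial>\<gamma>)"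
  proof (rule Bochner_Integration.integral_mono[OF c_B_\<gamma>(1)[OF \<nu> \<gamma> \<nu>'(1)]])
    show "integrable \<gamma> (\<lambda>p. c (fst p) (snd p) + lc * norm (snd p - B \<nu>' (fst p)))"
      using c_integrable_\<gamma>[OF \<nu> \<gamma>] n by simp
    fix p assume "p \<in> space \<gamma>"
    then have p: "fst p \<in> X" "snd p \<in> K" by (auto simp: space_\<gamma>[OF \<nu> \<gamma>])
    then show "c (fst p) (B \<nu>' (fst p)) \<le> c (fst p) (snd p) + lc * norm (snd p - B \<nu>' (fst p))"
      using c_lip_snd[OF p B_exists_unique(1)[OF \<nu>'(1) p(1)]] by (simp add: abs_le_iff)
  qed
  also have "\<dots> = (\<integral>p. c (fst p) (snd p) \<partial>\<gamma>) + lc * ?D"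
    using c_integrable_\<gamma>[OF \<nu> \<gamma>] n by simp
  finally have 1: "transport_cost c \<mu> \<nu>' \<le> (\<integral>p. c (fst p) (snd p) \<partial>\<gamma>) + lc * ?D" .
  have 2: "(\<integral>y. V y \<partial>\<nu>') \<le> (\<integral>y. V y \<partial>\<nu>) + lV * ?D"
    by (rule lipschitz_integral_le[OF \<nu> \<gamma> \<nu>' V_cont V_lip])
  \<comment> \<open>The two slots of the interaction are moved one after the other, each at the
    price \<open>lW * ?D\<close>; the factor one half in the energy compensates for the two
    moves.\<close>
  have "I \<nu>' \<nu>' \<le> I \<nu> \<nu>' + lW * ?D"
    unfolding I_def by (rule lipschitz_integral_le[OF \<nu> \<gamma> \<nu>' w_cont[OF \<nu>'(1)] w_lipschitz[OF \<nu>'(1)]])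
  moreover have "I \<nu>' \<nu> \<le> I \<nu> \<nu> + lW * ?D"
    unfolding I_def by (rule lipschitz_integral_le[OF \<nu> \<gamma> \<nu>' w_cont[OF \<nu>] w_lipschitz[OF \<nu>]])
  ultimately have 3: "I \<nu>' \<nu>' \<le> I \<nu> \<nu> + 2 * (lW * ?D)" using I_sym[OF \<nu> \<nu>'(1)] by simp
  show ?thesis using 1 2 3 by (simp add: J_eq algebra_simps)
qed

lemma J_bdd_below: "bdd_below (J ` Prob K)"
proof -
  obtain bc where bc: "\<forall>x\<in>X. \<forall>y\<in>K. \<bar>c x y\<bar> \<le> bc" using c_bound ..
  obtain bV where bV: "\<forall>y\<in>K. \<bar>V y\<bar> \<le> bV" using bound_K[OF V_cont] ..
  obtain bW where bW: "\<forall>y\<in>K. \<forall>z\<in>K. \<bar>W y z\<bar> \<le> bW" using W_bound ..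
  show ?thesis
  proof (rule bdd_belowI2)
    fix \<nu> assume \<nu>: "\<nu> \<in> Prob K"
    then have p: "prob_space \<nu>" by (simp add: Prob_iff)
    have "- bc \<le> transport_cost c \<mu> \<nu>"
      unfolding transport_cost_def
    proof (rule cINF_greatest[OF couplings_nonempty[OF \<mu>.prob_space_axioms p]])
      fix \<gamma> assume \<gamma>: "\<gamma> \<in> couplings \<mu> \<nu>"
      interpret \<gamma>: prob_space \<gamma> by (rule \<gamma>_prob[OF \<nu> \<gamma>])
      show "- bc \<le> (\<integral>p. c (fst p) (snd p) \<partial>\<gamma>)"
      proof (rule \<gamma>.integral_ge_const[OF c_integrable_\<gamma>[OF \<nu> \<gamma>]], rule AE_I2)
        fix p assume "p \<in> space \<gamma>"
        then have "\<bar>c (fst p) (snd p)\<bar> \<le> bc" using bc by (auto simp: space_\<gamma>[OF \<nu> \<gamma>])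
        then show "- bc \<le> c (fst p) (snd p)" by linarith
      qed
    qed
    moreover have "\<bar>\<integral>y. V y \<partial>\<nu>\<bar> \<le> bV" using bV by (intro abs_integral_Prob_le[OF \<nu> V_cont]) blast
    moreover have "\<bar>I \<nu> \<nu>\<bar> \<le> bW" using bW by (intro I_bound[OF \<nu> \<nu>]) blast
    ultimately show "- bc - bV - 1 / 2 * bW \<le> J \<nu>" unfolding J_eq by linarith
  qed
qed

lemma fixed_point_minimal:
  assumes \<nu>': "\<nu>' \<in> Prob K" "T \<nu>' = \<nu>'" and \<nu>0: "\<nu>0 \<in> Prob K"
  shows "J \<nu>' \<le> J \<nu>0"
proof -
  obtain bc where bc: "\<forall>x\<in>X. \<forall>y\<in>K. \<bar>c x y\<bar> \<le> bc" using c_bound ..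
  obtain bW0 where bW0: "\<forall>y\<in>K. \<forall>z\<in>K. \<bar>W y z\<bar> \<le> bW0" using W_bound ..
  define bW where "bW = max 0 bW0"
  have bW: "\<bar>W y z\<bar> \<le> bW" if "y \<in> K" "z \<in> K" for y z using bW0 that by (fastforce simp: bW_def)
  define m where "m = (INF \<nu>\<in>Prob K. J \<nu>)"
  \<comment> \<open>\<open>A * s\<close> will bound the first moment: \<open>1 / 2\<close> comes
    from the term \<open>s / 2\<close> in \<open>u \<le> s / 2 + u\<^sup>2 / (2 * s)\<close>, the
    rest from the second-moment bound. In \<open>L\<close>, the \<open>2\<close> stands for the
    slack of the almost minimiser and that of its plan, and \<open>lc + lV + lW\<close> is the
    Lipschitz constant of the energy.\<close>
  define A where "A = 1 / 2 + (2 + 2 * bW) / (\<eta> + \<kappa>)"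
  define L where "L = 2 + (lc + lV + lW) * (A / (1 - q))"
  have A: "0 \<le> A" using \<eta>(1) \<kappa> by (simp add: A_def bW_def)
  have L: "0 < L" using A q lc lV lW by (auto simp: L_def intro!: add_pos_nonneg mult_nonneg_nonneg)
  have key: "J \<nu>' \<le> m + s * L" if s: "0 < s" "s \<le> 1" for s
  proof -
    \<comment> \<open>A gap of order \<open>t\<close> bounds the second moment; with
      \<open>t = s\<^sup>2\<close> the first moment is then of order \<open>s\<close>.\<close>
    define t where "t = s\<^sup>2"
    have t: "0 < t" "t \<le> 1" using s by (simp_all add: t_def power_le_one)
    have "\<exists>\<nu>\<in>Prob K. J \<nu> < m + t\<^sup>2"
      using t(1) cINF_less_iff[of "Prob K" J "m + t\<^sup>2"] J_bdd_below \<nu>0 by (auto simp: m_def)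
    then obtain \<nu> where \<nu>: "\<nu> \<in> Prob K" "J \<nu> < m + t\<^sup>2" ..
    have near: "J \<nu> \<le> J \<rho> + t\<^sup>2" if "\<rho> \<in> Prob K" for \<rho>
      using cINF_lower[OF J_bdd_below that] \<nu>(2) by (simp add: m_def)
    obtain \<gamma> where \<gamma>: "\<gamma> \<in> couplings \<mu> \<nu>" "(\<integral>p. c (fst p) (snd p) \<partial>\<gamma>) < transport_cost c \<mu> \<nu> + t\<^sup>2"
    proof (rule transport_cost_approx[of \<mu> \<nu> c bc "t\<^sup>2"])
      show "prob_space \<nu>" using \<nu>(1) by (simp add: Prob_iff)
      show "\<bar>c x y\<bar> \<le> bc" if "x \<in> space \<mu>" "y \<in> space \<nu>" for x y
        using bc that by (simp add: space_Prob[OF \<mu>(1)] space_Prob[OF \<nu>(1)])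
    qed (use t \<mu>.prob_space_axioms in auto)
    interpret \<gamma>: prob_space \<gamma> by (rule \<gamma>_prob[OF \<nu>(1) \<gamma>(1)])
    note Sm = snd_\<gamma>[OF \<nu>(1) \<gamma>(1)]
    note Bm = B_fst_\<gamma>[OF \<nu>(1) \<gamma>(1) \<nu>(1)] and Bm' = B_fst_\<gamma>[OF \<nu>(1) \<gamma>(1) \<nu>'(1)]
    have n1: "integrable \<gamma> (\<lambda>p. norm (snd p - B \<nu> (fst p)))" and n2: "integrable \<gamma> (\<lambda>p. norm (snd p - B \<nu>' (fst p)))"
      and n3: "integrable \<gamma> (\<lambda>p. norm (B \<nu> (fst p) - B \<nu>' (fst p)))"
      by (rule norm_diff_integrable[OF Sm Bm(1) \<gamma>.prob_space_axioms],
          rule norm_diff_integrable[OF Sm Bm'(1) \<gamma>.prob_space_axioms],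
          rule norm_diff_integrable[OF Bm(1) Bm'(1) \<gamma>.prob_space_axioms])
    let ?D = "\<integral>p. norm (snd p - B \<nu>' (fst p)) \<partial>\<gamma>" and ?S = "\<integral>p. norm (snd p - B \<nu> (fst p)) \<partial>\<gamma>"
    let ?Q = "\<integral>p. (norm (snd p - B \<nu> (fst p)))\<^sup>2 \<partial>\<gamma>"
    have nsq: "integrable \<gamma> (\<lambda>p. (norm (snd p - B \<nu> (fst p)))\<^sup>2)"
    proof -
      obtain b where b: "\<forall>y\<in>K. \<forall>z\<in>K. norm (y - z) \<le> b" using bounded_K ..
      have "snd p \<in> K" "B \<nu> (fst p) \<in> K" if "p \<in> space \<gamma>" for p
        using measurable_space[OF Sm that] measurable_space[OF Bm(1) that] by (simp_all add: space_restrict_space)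
      then show ?thesis
        using b borel_measurable_integrable[OF n1] by (intro \<gamma>.integrable_const_bound[of _ "b\<^sup>2"]) (auto intro!: power_mono)
    qed
    have "(\<eta> + \<kappa>) / 2 * ?Q \<le> (2 + 2 * bW) * t"
      using near \<gamma>(2) bW by (intro near_minimizer_near_graph[OF \<nu>(1) \<gamma>(1) t]) auto
    then have "?Q \<le> 2 * ((2 + 2 * bW) / (\<eta> + \<kappa>)) * s\<^sup>2"
      using \<eta>(1) \<kappa> by (simp add: field_simps t_def)
    then have Q: "?Q / (2 * s) \<le> (2 + 2 * bW) / (\<eta> + \<kappa>) * s"
      using s(1) by (simp add: divide_le_eq power2_eq_square mult_ac)
    have "?S \<le> (\<integral>p. s / 2 + (norm (snd p - B \<nu> (fst p)))\<^sup>2 / (2 * s) \<partial>\<gamma>)"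
    proof (rule Bochner_Integration.integral_mono[OF n1])
      show "integrable \<gamma> (\<lambda>p. s / 2 + (norm (snd p - B \<nu> (fst p)))\<^sup>2 / (2 * s))" using nsq by simp
      have "u \<le> s / 2 + u\<^sup>2 / (2 * s)" for u :: real
        using zero_le_power2[of "u - s"] s(1) by (simp add: field_simps power2_eq_square)
      then show "norm (snd p - B \<nu> (fst p)) \<le> s / 2 + (norm (snd p - B \<nu> (fst p)))\<^sup>2 / (2 * s)" for p .
    qed
    also have "\<dots> = s / 2 + ?Q / (2 * s)" using nsq by (simp add: \<gamma>.prob_space)
    also have "\<dots> \<le> A * s" using Q by (simp add: A_def algebra_simps)
    finally have S: "?S \<le> A * s" .
    have tri: "norm (u - w) \<le> norm (u - v) + norm (v - w)" for u v w :: "real ^ 'n"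
      using norm_triangle_ineq[of "u - v" "v - w"] by simp
    have "?D \<le> (\<integral>p. norm (snd p - B \<nu> (fst p)) + norm (B \<nu> (fst p) - B \<nu>' (fst p)) \<partial>\<gamma>)"
      using n1 n2 n3 tri by (intro Bochner_Integration.integral_mono) auto
    also have "\<dots> = ?S + (\<integral>p. norm (B \<nu> (fst p) - B \<nu>' (fst p)) \<partial>\<gamma>)"
      using n1 n3 by (rule Bochner_Integration.integral_add)
    also have "(\<integral>p. norm (B \<nu> (fst p) - B \<nu>' (fst p)) \<partial>\<gamma>) = (\<integral>x. norm (B \<nu> x - B \<nu>' x) \<partial>\<mu>)"
    proof (rule couplings_integral_fst[OF \<gamma>(1)])
      show "(\<lambda>x. norm (B \<nu> x - B \<nu>' x)) \<in> borel_measurable \<mu>"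
        using norm_diff_integrable[OF B_measurable[OF \<nu>(1)] B_measurable[OF \<nu>'(1)] \<mu>.prob_space_axioms]
        by (rule borel_measurable_integrable)
    qed
    also have "\<dots> \<le> q * wasserstein1 \<nu> \<nu>'" by (rule B_dist_bound[OF \<nu>'(1) \<nu>(1)])
    finally have D1: "?D \<le> ?S + q * wasserstein1 \<nu> \<nu>'" by simp
    \<comment> \<open>The plan also couples \<open>\<nu>\<close> with the fixed point, so the
      contraction term is absorbed into the left-hand side of
      \<open>?D \<le> ?S + q * ?D\<close>.\<close>
    have "wasserstein1 \<nu> \<nu>' \<le> ?D"
      using wasserstein1_distr_le[OF Sm Bm'(1) \<gamma>.prob_space_axioms]
      unfolding distr_snd_\<gamma>[OF \<nu>(1) \<gamma>(1)] Bm'(2) \<nu>'(2) .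
    then have "q * wasserstein1 \<nu> \<nu>' \<le> q * ?D" using q(1) by (rule mult_left_mono)
    with D1 have "?D \<le> ?S + q * ?D" by linarith
    then have "(1 - q) * ?D \<le> A * s" using S by (simp add: algebra_simps)
    then have D: "?D \<le> A / (1 - q) * s" using q(2) by (simp add: field_simps)
    have "J \<nu>' \<le> (\<integral>p. c (fst p) (snd p) \<partial>\<gamma>) + (\<integral>y. V y \<partial>\<nu>) + 1 / 2 * I \<nu> \<nu> + (lc + lV + lW) * ?D"
      by (rule J_fixed_point_le[OF \<nu>(1) \<gamma>(1) \<nu>'])
    also have "\<dots> \<le> J \<nu> + t\<^sup>2 + (lc + lV + lW) * (A / (1 - q) * s)"
      using \<gamma>(2) mult_left_mono[OF D, of "lc + lV + lW"] lc lV lW unfolding J_eq by linarith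
    also have "\<dots> \<le> m + 2 * t\<^sup>2 + (lc + lV + lW) * (A / (1 - q) * s)" using \<nu>(2) by simp
    also have "t\<^sup>2 \<le> s"
      using s power_le_one[of s 3] mult_left_mono[of "s ^ 3" 1 s] by (simp add: t_def power2_eq_square power3_eq_cube mult.assoc)
    finally show ?thesis by (simp add: L_def algebra_simps)
  qed
  have "J \<nu>' \<le> m + e" if e: "e > 0" for e
  proof -
    have "J \<nu>' \<le> m + min 1 (e / L) * L" using e L by (intro key) auto
    also have "min 1 (e / L) * L \<le> e / L * L" using L by (intro mult_right_mono) auto
    finally show ?thesis using L by simp
  qed
  then have "J \<nu>' \<le> m" by (rule field_le_epsilon)
  also have "m \<le> J \<nu>0" unfolding m_def by (rule cINF_lower[OF J_bdd_below \<nu>0])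
  finally show ?thesis .
qed

theorem best_reply_contraction:
  "contraction_on (Prob K) wasserstein1 T \<and>
   (\<exists>\<nu>'. {\<nu> \<in> Prob K. T \<nu> = \<nu>} = {\<nu>'} \<and> is_arg_min J (\<lambda>\<nu>. \<nu> \<in> Prob K) \<nu>')"
proof
  show "contraction_on (Prob K) wasserstein1 T"
    unfolding contraction_on_def using T_Prob T_contraction q by blast
  obtain \<nu>' where \<nu>': "\<nu>' \<in> Prob K" "T \<nu>' = \<nu>'" using fixed_point_exists ..
  have "{\<nu> \<in> Prob K. T \<nu> = \<nu>} = {\<nu>'}" using \<nu>' fixed_point_unique by blast
  moreover have "is_arg_min J (\<lambda>\<nu>. \<nu> \<in> Prob K) \<nu>'"
    unfolding is_arg_min_def using \<nu>'(1) fixed_point_minimal[OF \<nu>'] by (simp add: not_less)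
  ultimately show "\<exists>\<nu>'. {\<nu> \<in> Prob K. T \<nu> = \<nu>} = {\<nu>'} \<and> is_arg_min J (\<lambda>\<nu>. \<nu> \<in> Prob K) \<nu>'" by blast
qed

end

theorem theorem19:
  fixes X :: "(real ^ 'm) set" and Y :: "(real ^ 'n) set"
    and c :: "real ^ 'm \<Rightarrow> real ^ 'n \<Rightarrow> real"
    and V :: "real ^ 'n \<Rightarrow> real" and W :: "real ^ 'n \<Rightarrow> real ^ 'n \<Rightarrow> real"
    and \<mu> :: "(real ^ 'm) measure"
    and C0 \<eta> \<kappa> M k C :: real
  assumes "CARD('m) > CARD('n)"
    and "bounded X" "open X"
    and "bounded Y" "open Y" "convex Y" "Y \<noteq> {}"
    and "C2_closure (\<lambda>(x, y). c x y) (X \<times> Y)" and "twisted c X Y"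
    and "C2_closure V Y"
    and "C2_closure (\<lambda>(y, z). W y z) (Y \<times> Y)"
    and "\<forall>y\<in>closure Y. \<forall>z\<in>closure Y. W y z = W z y"
    and "C0 > 0"
    and "\<forall>x\<in>X. \<forall>y\<in>Y. \<forall>z\<in>Y. matrix_ge (hessian (c x) y + hessian V y + hessian (W z) y) C0"
    and "\<forall>x\<in>X. \<forall>z\<in>Y. \<forall>y\<in>frontier Y. \<forall>n\<in>outward_unit_normals Y y.
           (gradient (c x) (at y within closure Y) + gradient V (at y within closure Y) +
            gradient (\<lambda>y'. W y' z) (at y within closure Y)) \<bullet> n \<ge> 0"
    and "\<mu> \<in> Prob X" and "absolutely_continuous (restrict_space lborel X) \<mu>"
    and "Linf_density X \<mu> < \<infinity>"
    and "\<eta> > 0" and "\<forall>x\<in>X. \<forall>y\<in>Y. matrix_ge (hessian (c x) y) \<eta>"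
    and "\<forall>x\<in>X. \<forall>y\<in>Y. rank (mixed_hessian c x y) = CARD('n)"
    and "\<kappa> > 0" and "k > 0"
    and "\<forall>\<nu>\<in>Prob (closure Y). \<forall>y\<in>Y. matrix_ge (hessian (first_variation V W \<nu>) y) \<kappa>"
    and "\<forall>\<nu>\<in>Prob (closure Y). \<forall>y\<in>Y.
           enn2ereal (hausdorff_measure (CARD('m) - CARD('n)) {x \<in> X. best_reply c V W Y \<nu> x = y})
             \<le> ereal M"
    and "\<forall>\<nu>\<in>Prob (closure Y). \<forall>x\<in>X. jacobian_factor (best_reply c V W Y \<nu>) x \<ge> k"
    and "\<forall>\<nu>\<^sub>0\<in>Prob (closure Y). \<forall>\<nu>\<^sub>1\<in>Prob (closure Y).
           (LINT y:Y|lborel. norm (gradient (first_variation V W \<nu>\<^sub>1) (at y)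
                                   - gradient (first_variation V W \<nu>\<^sub>0) (at y)))
             \<le> C * wasserstein1 \<nu>\<^sub>1 \<nu>\<^sub>0"
    and "enn2real (Linf_density X \<mu>) * M * C < k * (\<eta> + \<kappa>)"
  shows "contraction_on (Prob (closure Y)) wasserstein1 (best_reply_measure c V W Y \<mu>) \<and>
         (\<exists>\<nu>'. {\<nu> \<in> Prob (closure Y). best_reply_measure c V W Y \<mu> \<nu> = \<nu>} = {\<nu>'} \<and>
               is_arg_min (total_cost c V W \<mu>) (\<lambda>\<nu>. \<nu> \<in> Prob (closure Y)) \<nu>')"
proof -
  note X = assms(2,3) and Y = assms(4,5,6,7)
  \<comment> \<open>Embedding \<open>v\<close> as \<open>(0, v)\<close> selects derivatives in the
    second variable of \<open>c\<close>; for \<open>W\<close>, embedding it as \<open>(v, 0)\<close>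
    selects the first variable.\<close>
  obtain Dc and gc :: "(real ^ 'm) \<times> (real ^ 'n) \<Rightarrow> real ^ 'n" and Dgc lc where c:
    "continuous_on (closure (X \<times> Y)) (\<lambda>(x, y). c x y)" "continuous_on (closure (X \<times> Y)) gc"
    "\<And>v. continuous_on (closure (X \<times> Y)) (\<lambda>p. Dc p v)" "\<And>v. continuous_on (closure (X \<times> Y)) (\<lambda>p. Dgc p v)"
    "0 \<le> lc" "\<And>p v. Dc p (0, v) = gc p \<bullet> v"
    "\<And>S. open S \<Longrightarrow> convex S \<Longrightarrow> S \<subseteq> X \<times> Y \<Longrightarrow> usd (\<lambda>(x, y). c x y) Dc (closure S)"
    "\<And>S. open S \<Longrightarrow> convex S \<Longrightarrow> S \<subseteq> X \<times> Y \<Longrightarrow> usd gc Dgc (closure S)"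
    "\<And>S p q. open S \<Longrightarrow> convex S \<Longrightarrow> S \<subseteq> X \<times> Y \<Longrightarrow> p \<in> closure S \<Longrightarrow> q \<in> closure S \<Longrightarrow>
        \<bar>(\<lambda>(x, y). c x y) p - (\<lambda>(x, y). c x y) q\<bar> \<le> lc * norm (p - q)"
    "\<And>S p q. open S \<Longrightarrow> convex S \<Longrightarrow> S \<subseteq> X \<times> Y \<Longrightarrow> p \<in> closure S \<Longrightarrow> q \<in> closure S \<Longrightarrow>
        norm (gc p - gc q) \<le> lc * norm (p - q)"
    by (rule C2_closure_data[OF assms(8) bounded_Times[OF X(1) Y(1)], of "\<lambda>v. (0, v)"])
      (simp add: linear_iff, rule that)
  obtain DV and gV :: "real ^ 'n \<Rightarrow> real ^ 'n" and HV lV where V: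
    "continuous_on (closure Y) V" "continuous_on (closure Y) gV"
    "\<And>v. continuous_on (closure Y) (\<lambda>p. DV p v)" "\<And>v. continuous_on (closure Y) (\<lambda>p. HV p v)"
    "0 \<le> lV" "\<And>p v. DV p v = gV p \<bullet> v"
    "\<And>S. open S \<Longrightarrow> convex S \<Longrightarrow> S \<subseteq> Y \<Longrightarrow> usd V DV (closure S)"
    "\<And>S. open S \<Longrightarrow> convex S \<Longrightarrow> S \<subseteq> Y \<Longrightarrow> usd gV HV (closure S)"
    "\<And>S p q. open S \<Longrightarrow> convex S \<Longrightarrow> S \<subseteq> Y \<Longrightarrow> p \<in> closure S \<Longrightarrow> q \<in> closure S \<Longrightarrow>
        \<bar>V p - V q\<bar> \<le> lV * norm (p - q)"
    "\<And>S p q. open S \<Longrightarrow> convex S \<Longrightarrow> S \<subseteq> Y \<Longrightarrow> p \<in> closure S \<Longrightarrow> q \<in> closure S \<Longrightarrow>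
        norm (gV p - gV q) \<le> lV * norm (p - q)"
    by (rule C2_closure_data[OF assms(10) Y(1), of "\<lambda>v. v"]) (simp add: linear_iff, rule that)
  obtain DW and gW :: "(real ^ 'n) \<times> (real ^ 'n) \<Rightarrow> real ^ 'n" and DgW lW where W:
    "continuous_on (closure (Y \<times> Y)) (\<lambda>(y, z). W y z)" "continuous_on (closure (Y \<times> Y)) gW"
    "\<And>v. continuous_on (closure (Y \<times> Y)) (\<lambda>p. DW p v)" "\<And>v. continuous_on (closure (Y \<times> Y)) (\<lambda>p. DgW p v)"
    "0 \<le> lW" "\<And>p v. DW p (v, 0) = gW p \<bullet> v"
    "\<And>S. open S \<Longrightarrow> convex S \<Longrightarrow> S \<subseteq> Y \<times> Y \<Longrightarrow> usd (\<lambda>(y, z). W y z) DW (closure S)"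
    "\<And>S. open S \<Longrightarrow> convex S \<Longrightarrow> S \<subseteq> Y \<times> Y \<Longrightarrow> usd gW DgW (closure S)"
    "\<And>S p q. open S \<Longrightarrow> convex S \<Longrightarrow> S \<subseteq> Y \<times> Y \<Longrightarrow> p \<in> closure S \<Longrightarrow> q \<in> closure S \<Longrightarrow>
        \<bar>(\<lambda>(y, z). W y z) p - (\<lambda>(y, z). W y z) q\<bar> \<le> lW * norm (p - q)"
    "\<And>S p q. open S \<Longrightarrow> convex S \<Longrightarrow> S \<subseteq> Y \<times> Y \<Longrightarrow> p \<in> closure S \<Longrightarrow> q \<in> closure S \<Longrightarrow>
        norm (gW p - gW q) \<le> lW * norm (p - q)"
    by (rule C2_closure_data[OF assms(11) bounded_Times[OF Y(1) Y(1)], of "\<lambda>v. (v, 0)"])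
      (simp add: linear_iff, rule that)
  note c = c[unfolded case_prod_unfold closure_Times]
  \<comment> \<open>Since \<open>Y\<close> and \<open>Y \<times> Y\<close> are convex, the
    statements for \<open>V\<close> and \<open>W\<close> can be used with these sets themselves in
    the role of \<open>S\<close>.\<close>
  have YY: "open (Y \<times> Y)" "convex (Y \<times> Y)" using Y by (simp_all add: open_Times convex_Times)
  note V = V(5) V(7-10)[OF Y(2,3) order_refl, unfolded V(6)]
  note W = W(1-6)[unfolded case_prod_unfold closure_Times]
    W(7-10)[OF YY order_refl, unfolded case_prod_unfold closure_Times]
  interpret best_reply_game X Y c V W \<mu> \<eta> \<kappa> M k C Dc gc Dgc lc gV HV lV DW gW DgW lW
    by (rule best_reply_game.intro;
        fact assms(1) X Y c(1) c(5-10) V(1-4) W(1,2,4,5,6,7,8,9) assms(12-18) assms(19) assms(20) assms(22-28))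
  show ?thesis by (rule best_reply_contraction)
qed

end
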